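(* A finitely complete (locally small) category $\mathcal C$, of any size, is $\Phi_{\mathrm{reg}}$-exact if and only if it is regular.
   Context: All categories are ordinary locally small categories ($\mathcal V=\mathbf{Set}$); lex means finite-limit-preserving between finitely complete categories. A class of lex-weights $\Phi$ is a collection of functors $\phi:\mathcal K^{op}\to\mathbf{Set}$ with each $\mathcal K$ small and finitely complete. A $\Phi$-lex-colimit is a weighted colimit $\phi\star D$ with $\phi:\mathcal K^{op}\to\mathbf{Set}$ in $\Phi$ and $D$ a lex functor with domain $\mathcal K$. $\mathcal P\mathcal C$ is the category of small presheaves on $\mathcal C$ (presheaves that are left Kan extensions of their restriction to some small full subcategory); it is finitely complete if $\mathcal C$ is. For finitely complete $\mathcal C$, $\Phi_l\mathcal C$ is the smallest full replete subcategory of $\mathcal P\mathcal C$ containing the representables and closed under finite limits and $\Phi$-lex-colimits, and $W:\mathcal C\to\Phi_l\mathcal C$ is the restricted Yoneda embedding. $\mathcal C$ is $\Phi$-exact if it is finitely complete and $W$ has a finite-limit-preserving left adjoint. The class $\Phi_{\mathrm{reg}}$ consists of the single functor $\phi:\mathcal K^{op}\to\mathbf{Set}$, where $\mathcal K$ is the free category with finite limits generated by an arrow $f:X\to Y$ and $\phi$ is the coequaliser in $[\mathcal K^{op},\mathbf{Set}]$ of the kernel-pair of $\mathcal K(-,f):\mathcal K(-,X)\to\mathcal K(-,Y)$. (A finitely complete category has all $\Phi_{\mathrm{reg}}$-lex-colimits just when it has coequalisers of kernel-pairs.) A finitely complete category is regular if it has coequalisers of kernel-pairs and regular epimorphisms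 are stable under pullback. *)

theory Defs
  imports "HOL-Library.FuncSet"
begin

unbundle cardinal_syntax

text \<open>
  Size. A set, of any type, is small if its cardinality is below a fixed \<open>\<kappa>\<close>, a regular
  uncountable cardinal realised on the type \<open>'u\<close>, and \<open>Set\<close> is the category of small subsets
  of \<open>'u\<close>. Taking \<open>\<kappa>\<close> inaccessible gives the usual notion of smallness relative to a Grothendieck
  universe; regularity alone provides the small colimits in \<open>Set\<close> that presheaves need, and
  uncountability makes the finite-limit completion of a finite category small.
\<close>

definition universe :: "'u rel \<Rightarrow> bool" where
  "universe \<kappa> \<longleftrightarrow> Card_order \<kappa> \<and> regularCard \<kappa> \<and> natLeq <o \<kappa>"

definition small :: "'u rel \<Rightarrow> 'a set \<Rightarrow> bool" where
  "small \<kappa> A \<longleftrightarrow> |A| <o \<kappa>"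

section \<open>Categories, functors, natural transformations\<close>

text \<open>
  Hom-sets need not be disjoint, so identities and composition are indexed by objects:
  \<open>cmp C X Y Z g f\<close> is the composite of \<open>f : X \<rightarrow> Y\<close> and \<open>g : Y \<rightarrow> Z\<close>.
  With this presentation a locally small category has its hom-sets among the objects of \<open>Set\<close>,
  while its objects may form a set of any type and any size.
\<close>

record ('o, 'm) cat =
  ob :: "'o set"
  hom :: "'o \<Rightarrow> 'o \<Rightarrow> 'm set"
  ide :: "'o \<Rightarrow> 'm"
  cmp :: "'o \<Rightarrow> 'o \<Rightarrow> 'o \<Rightarrow> 'm \<Rightarrow> 'm \<Rightarrow> 'm"

definition category :: "('o, 'm) cat \<Rightarrow> bool" where
  "category C \<longleftrightarrow>
     (\<forall>X\<in>ob C. ide C X \<in> hom C X X) \<and>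
     (\<forall>X\<in>ob C. \<forall>Y\<in>ob C. \<forall>Z\<in>ob C. \<forall>f\<in>hom C X Y. \<forall>g\<in>hom C Y Z.
        cmp C X Y Z g f \<in> hom C X Z) \<and>
     (\<forall>X\<in>ob C. \<forall>Y\<in>ob C. \<forall>f\<in>hom C X Y.
        cmp C X X Y f (ide C X) = f \<and> cmp C X Y Y (ide C Y) f = f) \<and>
     (\<forall>W\<in>ob C. \<forall>X\<in>ob C. \<forall>Y\<in>ob C. \<forall>Z\<in>ob C.
        \<forall>f\<in>hom C W X. \<forall>g\<in>hom C X Y. \<forall>h\<in>hom C Y Z.
        cmp C W Y Z h (cmp C W X Y g f) = cmp C W X Z (cmp C X Y Z h g) f)"

definition locally_small :: "'u rel \<Rightarrow> ('o, 'm) cat \<Rightarrow> bool" where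
  "locally_small \<kappa> C \<longleftrightarrow> (\<forall>X\<in>ob C. \<forall>Y\<in>ob C. small \<kappa> (hom C X Y))"

definition small_category :: "'u rel \<Rightarrow> ('o, 'm) cat \<Rightarrow> bool" where
  "small_category \<kappa> C \<longleftrightarrow> category C \<and> small \<kappa> (ob C) \<and> locally_small \<kappa> C"

definition finite_category :: "('o, 'm) cat \<Rightarrow> bool" where
  "finite_category C \<longleftrightarrow>
     category C \<and> finite (ob C) \<and> (\<forall>X\<in>ob C. \<forall>Y\<in>ob C. finite (hom C X Y))"

definition op_cat :: "('o, 'm) cat \<Rightarrow> ('o, 'm) cat" where
  "op_cat C = \<lparr>ob = ob C, hom = (\<lambda>X Y. hom C Y X), ide = ide C,
     cmp = (\<lambda>X Y Z g f. cmp C Z Y X f g)\<rparr>"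

definition full_subcat :: "('o, 'm) cat \<Rightarrow> 'o set \<Rightarrow> ('o, 'm) cat" where
  "full_subcat C S = C\<lparr>ob := S\<rparr>"

definition set_cat :: "'u rel \<Rightarrow> ('u set, 'u \<Rightarrow> 'u) cat" where
  "set_cat \<kappa> = \<lparr>ob = {A. small \<kappa> A}, hom = (\<lambda>A B. A \<rightarrow>\<^sub>E B), ide = (\<lambda>A. \<lambda>x\<in>A. x),
     cmp = (\<lambda>A B C g f. compose A g f)\<rparr>"

definition iso_in :: "('o, 'm) cat \<Rightarrow> 'o \<Rightarrow> 'o \<Rightarrow> 'm \<Rightarrow> bool" where
  "iso_in C X Y f \<longleftrightarrow>
     f \<in> hom C X Y \<and> (\<exists>g\<in>hom C Y X. cmp C X Y X g f = ide C X \<and> cmp C Y X Y f g = ide C Y)"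

definition isomorphic :: "('o, 'm) cat \<Rightarrow> 'o \<Rightarrow> 'o \<Rightarrow> bool" where
  "isomorphic C X Y \<longleftrightarrow> (\<exists>f. iso_in C X Y f)"

record ('o, 'm, 'p, 'n) func =
  fob :: "'o \<Rightarrow> 'p"
  fmap :: "'o \<Rightarrow> 'o \<Rightarrow> 'm \<Rightarrow> 'n"

definition is_functor :: "('o, 'm) cat \<Rightarrow> ('p, 'n) cat \<Rightarrow> ('o, 'm, 'p, 'n) func \<Rightarrow> bool" where
  "is_functor A B F \<longleftrightarrow> category A \<and> category B \<and>
     (\<forall>X\<in>ob A. fob F X \<in> ob B) \<and>
     (\<forall>X\<in>ob A. \<forall>Y\<in>ob A. \<forall>f\<in>hom A X Y. fmap F X Y f \<in> hom B (fob F X) (fob F Y)) \<and>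
     (\<forall>X\<in>ob A. fmap F X X (ide A X) = ide B (fob F X)) \<and>
     (\<forall>X\<in>ob A. \<forall>Y\<in>ob A. \<forall>Z\<in>ob A. \<forall>f\<in>hom A X Y. \<forall>g\<in>hom A Y Z.
        fmap F X Z (cmp A X Y Z g f) =
        cmp B (fob F X) (fob F Y) (fob F Z) (fmap F Y Z g) (fmap F X Y f))"

definition id_func :: "('o, 'm, 'o, 'm) func" where
  "id_func = \<lparr>fob = (\<lambda>X. X), fmap = (\<lambda>X Y f. f)\<rparr>"

definition func_comp ::
  "('p, 'n, 'q, 'l) func \<Rightarrow> ('o, 'm, 'p, 'n) func \<Rightarrow> ('o, 'm, 'q, 'l) func" where
  "func_comp G F = \<lparr>fob = (\<lambda>X. fob G (fob F X)),
     fmap = (\<lambda>X Y f. fmap G (fob F X) (fob F Y) (fmap F X Y f))\<rparr>"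

definition nat_trans ::
  "('o, 'm) cat \<Rightarrow> ('p, 'n) cat \<Rightarrow> ('o, 'm, 'p, 'n) func \<Rightarrow> ('o, 'm, 'p, 'n) func
     \<Rightarrow> ('o \<Rightarrow> 'n) set" where
  "nat_trans A B F G = {\<alpha> \<in> (\<Pi>\<^sub>E X\<in>ob A. hom B (fob F X) (fob G X)).
     \<forall>X\<in>ob A. \<forall>Y\<in>ob A. \<forall>f\<in>hom A X Y.
       cmp B (fob F X) (fob G X) (fob G Y) (fmap G X Y f) (\<alpha> X) =
       cmp B (fob F X) (fob F Y) (fob G Y) (\<alpha> Y) (fmap F X Y f)}"

text \<open>
  Natural transformations are extensional, so equality of morphisms is the mathematical one.
  Records that differ only outside the carriers of \<open>A\<close> are isomorphic as functors; since functors
  are only ever compared up to isomorphism, they are not made extensional.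
\<close>

definition functor_cat ::
  "('o, 'm) cat \<Rightarrow> ('p, 'n) cat \<Rightarrow> (('o, 'm, 'p, 'n) func, 'o \<Rightarrow> 'n) cat" where
  "functor_cat A B = \<lparr>ob = {F. is_functor A B F}, hom = nat_trans A B,
     ide = (\<lambda>F. \<lambda>X\<in>ob A. ide B (fob F X)),
     cmp = (\<lambda>F G H \<beta> \<alpha>. \<lambda>X\<in>ob A. cmp B (fob F X) (fob G X) (fob H X) (\<beta> X) (\<alpha> X))\<rparr>"

text \<open>Adjunctions \<open>L \<stileturn> R\<close>, with \<open>L : A \<rightarrow> B\<close>, by natural bijections of hom-sets.\<close>

definition adjunction ::
  "('o, 'm) cat \<Rightarrow> ('p, 'n) cat \<Rightarrow> ('o, 'm, 'p, 'n) func \<Rightarrow> ('p, 'n, 'o, 'm) func \<Rightarrow> bool" where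
  "adjunction A B L R \<longleftrightarrow> is_functor A B L \<and> is_functor B A R \<and>
     (\<exists>\<theta>. (\<forall>X\<in>ob A. \<forall>Y\<in>ob B.
              bij_betw (\<theta> X Y) (hom B (fob L X) Y) (hom A X (fob R Y))) \<and>
          (\<forall>X\<in>ob A. \<forall>X'\<in>ob A. \<forall>Y\<in>ob B. \<forall>Y'\<in>ob B.
             \<forall>u\<in>hom A X' X. \<forall>v\<in>hom B Y Y'. \<forall>h\<in>hom B (fob L X) Y.
             \<theta> X' Y' (cmp B (fob L X') Y Y' v (cmp B (fob L X') (fob L X) Y h (fmap L X' X u))) =
             cmp A X' (fob R Y) (fob R Y') (fmap R Y Y' v)
               (cmp A X' X (fob R Y) (\<theta> X Y h) u)))"

section \<open>Finite limits, kernel pairs, coequalisers, regular categories\<close>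

definition is_cone ::
  "('j, 'i) cat \<Rightarrow> ('o, 'm) cat \<Rightarrow> ('j, 'i, 'o, 'm) func \<Rightarrow> 'o \<Rightarrow> ('j \<Rightarrow> 'm) \<Rightarrow> bool" where
  "is_cone J C D L p \<longleftrightarrow> L \<in> ob C \<and> (\<forall>j\<in>ob J. p j \<in> hom C L (fob D j)) \<and>
     (\<forall>i\<in>ob J. \<forall>j\<in>ob J. \<forall>u\<in>hom J i j.
        cmp C L (fob D i) (fob D j) (fmap D i j u) (p i) = p j)"

definition is_limit ::
  "('j, 'i) cat \<Rightarrow> ('o, 'm) cat \<Rightarrow> ('j, 'i, 'o, 'm) func \<Rightarrow> 'o \<Rightarrow> ('j \<Rightarrow> 'm) \<Rightarrow> bool" where
  "is_limit J C D L p \<longleftrightarrow> is_cone J C D L p \<and>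
     (\<forall>M q. is_cone J C D M q \<longrightarrow>
        (\<exists>!h. h \<in> hom C M L \<and> (\<forall>j\<in>ob J. cmp C M L (fob D j) (p j) h = q j)))"

text \<open>Every finite category is isomorphic to one whose objects and arrows are natural numbers.\<close>

definition finitely_complete :: "('o, 'm) cat \<Rightarrow> bool" where
  "finitely_complete C \<longleftrightarrow> category C \<and>
     (\<forall>(J :: (nat, nat) cat) D. finite_category J \<longrightarrow> is_functor J C D \<longrightarrow> (\<exists>L p. is_limit J C D L p))"

text \<open>
  Finite completeness of domain and codomain is not part of the next definition; where it is
  used it is either assumed or automatic.
\<close>

definition lex_functor :: "('o, 'm) cat \<Rightarrow> ('p, 'n) cat \<Rightarrow> ('o, 'm, 'p, 'n) func \<Rightarrow> bool" where
  "lex_functor A B F \<longleftrightarrow> is_functor A B F \<and>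
     (\<forall>(J :: (nat, nat) cat) D L p. finite_category J \<longrightarrow> is_functor J A D \<longrightarrow> is_limit J A D L p \<longrightarrow>
        is_limit J B (func_comp F D) (fob F L) (\<lambda>j. fmap F L (fob D j) (p j)))"

text \<open>
  \<open>P\<close> with \<open>p : P \<rightarrow> X\<close> and \<open>q : P \<rightarrow> Y\<close> is a pullback of \<open>f : X \<rightarrow> Z\<close> and \<open>g : Y \<rightarrow> Z\<close>.
\<close>

definition is_pullback ::
  "('o, 'm) cat \<Rightarrow> 'o \<Rightarrow> 'o \<Rightarrow> 'o \<Rightarrow> 'm \<Rightarrow> 'm \<Rightarrow> 'o \<Rightarrow> 'm \<Rightarrow> 'm \<Rightarrow> bool" where
  "is_pullback C X Y Z f g P p q \<longleftrightarrow>
     P \<in> ob C \<and> p \<in> hom C P X \<and> q \<in> hom C P Y \<and> cmp C P X Z f p = cmp C P Y Z g q \<and>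
     (\<forall>Q\<in>ob C. \<forall>a\<in>hom C Q X. \<forall>b\<in>hom C Q Y. cmp C Q X Z f a = cmp C Q Y Z g b \<longrightarrow>
        (\<exists>!h. h \<in> hom C Q P \<and> cmp C Q P X p h = a \<and> cmp C Q P Y q h = b))"

definition is_kernel_pair ::
  "('o, 'm) cat \<Rightarrow> 'o \<Rightarrow> 'o \<Rightarrow> 'm \<Rightarrow> 'o \<Rightarrow> 'm \<Rightarrow> 'm \<Rightarrow> bool" where
  "is_kernel_pair C X Y f R p q \<longleftrightarrow> is_pullback C X X Y f f R p q"

definition is_coequaliser ::
  "('o, 'm) cat \<Rightarrow> 'o \<Rightarrow> 'o \<Rightarrow> 'm \<Rightarrow> 'm \<Rightarrow> 'o \<Rightarrow> 'm \<Rightarrow> bool" where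
  "is_coequaliser C R X p q Q e \<longleftrightarrow>
     Q \<in> ob C \<and> e \<in> hom C X Q \<and> cmp C R X Q e p = cmp C R X Q e q \<and>
     (\<forall>Z\<in>ob C. \<forall>a\<in>hom C X Z. cmp C R X Z a p = cmp C R X Z a q \<longrightarrow>
        (\<exists>!h. h \<in> hom C Q Z \<and> cmp C X Q Z h e = a))"

definition regular_epi :: "('o, 'm) cat \<Rightarrow> 'o \<Rightarrow> 'o \<Rightarrow> 'm \<Rightarrow> bool" where
  "regular_epi C X Q e \<longleftrightarrow>
     (\<exists>R\<in>ob C. \<exists>p\<in>hom C R X. \<exists>q\<in>hom C R X. is_coequaliser C R X p q Q e)"

definition has_coequalisers_of_kernel_pairs :: "('o, 'm) cat \<Rightarrow> bool" where
  "has_coequalisers_of_kernel_pairs C \<longleftrightarrow>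
     (\<forall>X\<in>ob C. \<forall>Y\<in>ob C. \<forall>f\<in>hom C X Y. \<forall>R p q. is_kernel_pair C X Y f R p q \<longrightarrow>
        (\<exists>Q e. is_coequaliser C R X p q Q e))"

definition regular_epis_stable :: "('o, 'm) cat \<Rightarrow> bool" where
  "regular_epis_stable C \<longleftrightarrow>
     (\<forall>X\<in>ob C. \<forall>Y\<in>ob C. \<forall>Z\<in>ob C. \<forall>e\<in>hom C X Z. \<forall>g\<in>hom C Y Z. \<forall>P p q.
        regular_epi C X Z e \<longrightarrow> is_pullback C X Y Z e g P p q \<longrightarrow> regular_epi C P Y q)"

definition regular_category :: "('o, 'm) cat \<Rightarrow> bool" where
  "regular_category C \<longleftrightarrow>
     finitely_complete C \<and> has_coequalisers_of_kernel_pairs C \<and> regular_epis_stable C"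

section \<open>Small presheaves\<close>

type_synonym ('o, 'u) presheaf = "('o, 'u, 'u set, 'u \<Rightarrow> 'u) func"

definition presheaf_cat :: "'u rel \<Rightarrow> ('o, 'u) cat \<Rightarrow> (('o, 'u) presheaf, 'o \<Rightarrow> 'u \<Rightarrow> 'u) cat" where
  "presheaf_cat \<kappa> C = functor_cat (op_cat C) (set_cat \<kappa>)"

definition yoneda_ob :: "('o, 'u) cat \<Rightarrow> 'o \<Rightarrow> ('o, 'u) presheaf" where
  "yoneda_ob C X = \<lparr>fob = (\<lambda>Z. hom C Z X),
     fmap = (\<lambda>Z Z' h. \<lambda>f\<in>hom C Z X. cmp C Z' Z X f h)\<rparr>"

definition yoneda_map :: "('o, 'u) cat \<Rightarrow> 'o \<Rightarrow> 'o \<Rightarrow> 'u \<Rightarrow> 'o \<Rightarrow> 'u \<Rightarrow> 'u" where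
  "yoneda_map C X Y g = (\<lambda>Z\<in>ob C. \<lambda>f\<in>hom C Z X. cmp C Z X Y g f)"

definition yoneda ::
  "('o, 'u) cat \<Rightarrow> ('o, 'u, ('o, 'u) presheaf, 'o \<Rightarrow> 'u \<Rightarrow> 'u) func" where
  "yoneda C = \<lparr>fob = yoneda_ob C, fmap = yoneda_map C\<rparr>"

text \<open>\<open>L : B \<rightarrow> E\<close> with unit \<open>\<eta> : G \<rightarrow> L J\<close> is a left Kan extension of \<open>G : A \<rightarrow> E\<close> along \<open>J : A \<rightarrow> B\<close>.\<close>

definition is_left_kan_extension ::
  "('a, 'i) cat \<Rightarrow> ('b, 'j) cat \<Rightarrow> ('e, 'k) cat \<Rightarrow> ('a, 'i, 'b, 'j) func \<Rightarrow> ('a, 'i, 'e, 'k) func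
     \<Rightarrow> ('b, 'j, 'e, 'k) func \<Rightarrow> ('a \<Rightarrow> 'k) \<Rightarrow> bool" where
  "is_left_kan_extension A B E J G L \<eta> \<longleftrightarrow>
     is_functor A B J \<and> is_functor A E G \<and> is_functor B E L \<and>
     \<eta> \<in> nat_trans A E G (func_comp L J) \<and>
     (\<forall>H \<beta>. is_functor B E H \<longrightarrow> \<beta> \<in> nat_trans A E G (func_comp H J) \<longrightarrow>
        (\<exists>!\<alpha>. \<alpha> \<in> nat_trans B E L H \<and>
           (\<forall>X\<in>ob A. cmp E (fob G X) (fob L (fob J X)) (fob H (fob J X)) (\<alpha> (fob J X)) (\<eta> X) = \<beta> X)))"

definition small_presheaf :: "'u rel \<Rightarrow> ('o, 'u) cat \<Rightarrow> ('o, 'u) presheaf \<Rightarrow> bool" where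
  "small_presheaf \<kappa> C F \<longleftrightarrow> is_functor (op_cat C) (set_cat \<kappa>) F \<and>
     (\<exists>S \<subseteq> ob C. small \<kappa> S \<and>
        is_left_kan_extension (op_cat (full_subcat C S)) (op_cat C) (set_cat \<kappa>)
          id_func (func_comp F id_func) F (\<lambda>X\<in>S. ide (set_cat \<kappa>) (fob F X)))"

definition small_presheaf_cat ::
  "'u rel \<Rightarrow> ('o, 'u) cat \<Rightarrow> (('o, 'u) presheaf, 'o \<Rightarrow> 'u \<Rightarrow> 'u) cat" where
  "small_presheaf_cat \<kappa> C = full_subcat (presheaf_cat \<kappa> C) {F. small_presheaf \<kappa> C F}"

section \<open>Lex-weights, lex-colimits and exactness\<close>

text \<open>
  A pair \<open>(K, \<phi>)\<close> is a weight \<open>\<phi> : K\<^sup>o\<^sup>p \<rightarrow> Set\<close>. Up to isomorphism every small category lives on \<open>'u\<close>.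
\<close>

type_synonym 'u weight = "('u, 'u) cat \<times> ('u, 'u) presheaf"

definition lex_weight :: "'u rel \<Rightarrow> 'u weight \<Rightarrow> bool" where
  "lex_weight \<kappa> = (\<lambda>(K, \<phi>).
     small_category \<kappa> K \<and> finitely_complete K \<and> is_functor (op_cat K) (set_cat \<kappa>) \<phi>)"

text \<open>
  \<open>L\<close> with \<open>\<eta> : \<phi> \<rightarrow> E(D-, L)\<close> is a weighted colimit \<open>\<phi> \<star> D\<close>: composition with \<open>\<eta>\<close> is a bijection
  from \<open>E(L, M)\<close> to the natural transformations \<open>\<phi> \<rightarrow> E(D-, M)\<close>. The latter are spelled out because
  the hom-sets of \<open>E\<close> need not be subsets of \<open>'u\<close>.
\<close>

definition weighted_cocone ::
  "('k, 'l) cat \<Rightarrow> ('k, 'l, 'u set, 'u \<Rightarrow> 'u) func \<Rightarrow> ('o, 'm) cat \<Rightarrow> ('k, 'l, 'o, 'm) func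
     \<Rightarrow> 'o \<Rightarrow> ('k \<Rightarrow> 'u \<Rightarrow> 'm) \<Rightarrow> bool" where
  "weighted_cocone K \<phi> E D L \<eta> \<longleftrightarrow> L \<in> ob E \<and>
     (\<forall>k\<in>ob K. \<forall>x\<in>fob \<phi> k. \<eta> k x \<in> hom E (fob D k) L) \<and>
     (\<forall>k\<in>ob K. \<forall>k'\<in>ob K. \<forall>u\<in>hom K k k'. \<forall>x\<in>fob \<phi> k'.
        \<eta> k (fmap \<phi> k' k u x) = cmp E (fob D k) (fob D k') L (\<eta> k' x) (fmap D k k' u))"

definition is_weighted_colimit ::
  "('k, 'l) cat \<Rightarrow> ('k, 'l, 'u set, 'u \<Rightarrow> 'u) func \<Rightarrow> ('o, 'm) cat \<Rightarrow> ('k, 'l, 'o, 'm) func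
     \<Rightarrow> 'o \<Rightarrow> ('k \<Rightarrow> 'u \<Rightarrow> 'm) \<Rightarrow> bool" where
  "is_weighted_colimit K \<phi> E D L \<eta> \<longleftrightarrow> weighted_cocone K \<phi> E D L \<eta> \<and>
     (\<forall>M \<theta>. weighted_cocone K \<phi> E D M \<theta> \<longrightarrow>
        (\<exists>!h. h \<in> hom E L M \<and> (\<forall>k\<in>ob K. \<forall>x\<in>fob \<phi> k. cmp E (fob D k) L M h (\<eta> k x) = \<theta> k x)))"

definition replete_in :: "('o, 'm) cat \<Rightarrow> 'o set \<Rightarrow> bool" where
  "replete_in E S \<longleftrightarrow> S \<subseteq> ob E \<and> (\<forall>X\<in>S. \<forall>Y\<in>ob E. isomorphic E X Y \<longrightarrow> Y \<in> S)"

definition closed_under_finite_limits :: "('o, 'm) cat \<Rightarrow> 'o set \<Rightarrow> bool" where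
  "closed_under_finite_limits E S \<longleftrightarrow>
     (\<forall>(J :: (nat, nat) cat) D L p. finite_category J \<longrightarrow> is_functor J E D \<longrightarrow>
        (\<forall>j\<in>ob J. fob D j \<in> S) \<longrightarrow> is_limit J E D L p \<longrightarrow> L \<in> S)"

definition closed_under_lex_colimits :: "'u weight set \<Rightarrow> ('o, 'm) cat \<Rightarrow> 'o set \<Rightarrow> bool" where
  "closed_under_lex_colimits \<Phi> E S \<longleftrightarrow>
     (\<forall>(K, \<phi>)\<in>\<Phi>. \<forall>D L \<eta>. lex_functor K E D \<longrightarrow> (\<forall>k\<in>ob K. fob D k \<in> S) \<longrightarrow>
        is_weighted_colimit K \<phi> E D L \<eta> \<longrightarrow> L \<in> S)"

definition Phi_l_ob :: "'u rel \<Rightarrow> 'u weight set \<Rightarrow> ('o, 'u) cat \<Rightarrow> ('o, 'u) presheaf set" where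
  "Phi_l_ob \<kappa> \<Phi> C = \<Inter> {S. replete_in (small_presheaf_cat \<kappa> C) S \<and> yoneda_ob C ` ob C \<subseteq> S \<and>
     closed_under_finite_limits (small_presheaf_cat \<kappa> C) S \<and>
     closed_under_lex_colimits \<Phi> (small_presheaf_cat \<kappa> C) S}"

definition Phi_l ::
  "'u rel \<Rightarrow> 'u weight set \<Rightarrow> ('o, 'u) cat \<Rightarrow> (('o, 'u) presheaf, 'o \<Rightarrow> 'u \<Rightarrow> 'u) cat" where
  "Phi_l \<kappa> \<Phi> C = full_subcat (small_presheaf_cat \<kappa> C) (Phi_l_ob \<kappa> \<Phi> C)"

definition Phi_exact :: "'u rel \<Rightarrow> 'u weight set \<Rightarrow> ('o, 'u) cat \<Rightarrow> bool" where
  "Phi_exact \<kappa> \<Phi> C \<longleftrightarrow> finitely_complete C \<and>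
     (\<exists>L. lex_functor (Phi_l \<kappa> \<Phi> C) C L \<and> adjunction (Phi_l \<kappa> \<Phi> C) C L (yoneda C))"

section \<open>The class of weights for regularity\<close>

text \<open>
  \<open>K\<close> is the free category with finite limits on an arrow \<open>f : X \<rightarrow> Y\<close>: for every small finitely
  complete \<open>D\<close>, evaluation at \<open>f\<close> is an equivalence from the category of lex functors \<open>K \<rightarrow> D\<close> to the
  category of arrows of \<open>D\<close>. The two quantified clauses are essential surjectivity and full
  faithfulness of this functor.
\<close>

definition free_lex_on_arrow :: "'u rel \<Rightarrow> ('u, 'u) cat \<Rightarrow> 'u \<Rightarrow> 'u \<Rightarrow> 'u \<Rightarrow> bool" where
  "free_lex_on_arrow \<kappa> K X Y f \<longleftrightarrow>
     small_category \<kappa> K \<and> finitely_complete K \<and> X \<in> ob K \<and> Y \<in> ob K \<and> f \<in> hom K X Y \<and>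
     (\<forall>D :: ('u, 'u) cat. small_category \<kappa> D \<longrightarrow> finitely_complete D \<longrightarrow>
        (\<forall>A\<in>ob D. \<forall>B\<in>ob D. \<forall>g\<in>hom D A B. \<exists>F a b. lex_functor K D F \<and>
           iso_in D (fob F X) A a \<and> iso_in D (fob F Y) B b \<and>
           cmp D (fob F X) A B g a = cmp D (fob F X) (fob F Y) B b (fmap F X Y f)) \<and>
        (\<forall>F G. lex_functor K D F \<longrightarrow> lex_functor K D G \<longrightarrow>
           (\<forall>u\<in>hom D (fob F X) (fob G X). \<forall>v\<in>hom D (fob F Y) (fob G Y).
              cmp D (fob F X) (fob G X) (fob G Y) (fmap G X Y f) u =
              cmp D (fob F X) (fob F Y) (fob G Y) v (fmap F X Y f) \<longrightarrow>
              (\<exists>!\<alpha>. \<alpha> \<in> nat_trans K D F G \<and> \<alpha> X = u \<and> \<alpha> Y = v))))"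

text \<open>
  The free \<open>K\<close> is determined up to equivalence and \<open>\<phi>\<close> up to isomorphism, so the class is
  given by a predicate that holds for every choice of them.
\<close>

definition is_Phi_reg :: "'u rel \<Rightarrow> 'u weight set \<Rightarrow> bool" where
  "is_Phi_reg \<kappa> \<Phi> \<longleftrightarrow>
     (\<exists>K X Y f \<phi> R p q e. \<Phi> = {(K, \<phi>)} \<and> free_lex_on_arrow \<kappa> K X Y f \<and>
        is_kernel_pair (presheaf_cat \<kappa> K) (yoneda_ob K X) (yoneda_ob K Y) (yoneda_map K X Y f) R p q \<and>
        is_coequaliser (presheaf_cat \<kappa> K) R (yoneda_ob K X) p q \<phi> e)"

lemma is_Phi_reg_lex_weight:
  assumes "is_Phi_reg \<kappa> \<Phi>" and "w \<in> \<Phi>"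
  shows "lex_weight \<kappa> w"
  using assms
  by (auto simp: is_Phi_reg_def lex_weight_def free_lex_on_arrow_def is_coequaliser_def
      presheaf_cat_def functor_cat_def)

end

theory Submission
  imports Defs
begin

text \<open>
  A lex-colimit weighted by the single weight of \<open>\<Phi>\<close> is the image of an arrow \<open>D f\<close>.

  If \<open>C\<close> is regular, consider the presheaves \<open>F\<close> with a monomorphism into a representable \<open>y I\<close> whose
  image contains a regular epimorphism \<open>X \<rightarrow> I\<close>. Then \<open>F \<rightarrow> y I\<close> is the sheafification of \<open>F\<close> for the
  regular topology, so \<open>I\<close> is a reflection of \<open>F\<close>. Such presheaves are closed under finite limits
  and images, hence contain \<open>\<Phi>\<^sub>l C\<close>, and their reflection is lex because finitely many covers
  have a common refinement.

  Conversely, given a lex reflection \<open>L\<close>, let \<open>H\<close> be the image of \<open>y f\<close> for \<open>f : X \<rightarrow> Y\<close>. It lies in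
  \<open>\<Phi>\<^sub>l C\<close>, since \<open>f\<close> lives in a small full subcategory of \<open>C\<close> closed under finite limits and is
  classified by a lex functor on the free category. Then \<open>X \<rightarrow> L H\<close> is a coequaliser of the kernel
  pair of \<open>f\<close>, and regular epimorphisms are stable because images of presheaves are and \<open>L\<close> preserves
  pullbacks.
\<close>

section \<open>Pullbacks and effective epimorphisms\<close>

text \<open>Only subobjects of representables occur because the weight adds nothing but images: an
  image embeds in its codomain, and a finite limit of subobjects of representables embeds in the
  representable of the limit. Such an \<open>F\<close>, embedded in \<open>y I\<close>, is a sieve
  on \<open>I\<close>, and every arrow into \<open>I\<close> belongs to it after restriction to a
  cover, so the reflection can be handled with elements.

  In the converse the delicate point is stability. An arrow \<open>e : X -> Z\<close> is a regular
  epimorphism exactly when the comparison from the reflected presheaf image of \<open>e\<close> to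
  \<open>Z\<close> is invertible. If \<open>q\<close> is the pullback of \<open>e\<close> along
  \<open>g\<close>, its comparison is, up to isomorphism, a pullback of that of \<open>e\<close>,
  hence invertible too.

  Size enters twice. The free category is tested only against small categories with objects of type
  \<open>'u\<close>, so a small piece of \<open>C\<close> has to be renamed into \<open>'u\<close>.
  And images of lex diagrams must again be small presheaves; this holds because such an image is the
  quotient of one value of the diagram by another, the value at a kernel pair.\<close>

locale cat =
  fixes C :: "('o, 'm) cat"
  assumes category: "category C"
begin

lemma ide_hom [simp, intro]: "X \<in> ob C \<Longrightarrow> ide C X \<in> hom C X X"
  using category by (simp add: category_def)

lemma cmp_hom [simp, intro]:
  "\<lbrakk>X \<in> ob C; Y \<in> ob C; Z \<in> ob C; f \<in> hom C X Y; g \<in> hom C Y Z\<rbrakk> \<Longrightarrow> cmp C X Y Z g f \<in> hom C X Z"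
  using category by (simp add: category_def)

lemma cmp_ide [simp]:
  assumes "X \<in> ob C" "Y \<in> ob C" "f \<in> hom C X Y"
  shows "cmp C X X Y f (ide C X) = f" "cmp C X Y Y (ide C Y) f = f"
  using category assms by (simp_all add: category_def)

lemma cmp_assoc:
  "\<lbrakk>W \<in> ob C; X \<in> ob C; Y \<in> ob C; Z \<in> ob C; f \<in> hom C W X; g \<in> hom C X Y; h \<in> hom C Y Z\<rbrakk>
    \<Longrightarrow> cmp C W X Z (cmp C X Y Z h g) f = cmp C W Y Z h (cmp C W X Y g f)"
  using category by (simp add: category_def)

lemma category_op: "category (op_cat C)"
  using category unfolding category_def op_cat_def by simp

lemma category_full: "S \<subseteq> ob C \<Longrightarrow> category (full_subcat C S)"
  using category unfolding category_def full_subcat_def by (simp add: subset_iff)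

lemma is_pullbackD:
  assumes "is_pullback C X Y Z f g P p q"
  shows "P \<in> ob C" "p \<in> hom C P X" "q \<in> hom C P Y" "cmp C P X Z f p = cmp C P Y Z g q"
  using assms by (simp_all add: is_pullback_def)

lemma pullback_lift:
  assumes "is_pullback C X Y Z f g P p q" "Q \<in> ob C" "a \<in> hom C Q X" "b \<in> hom C Q Y"
    and "cmp C Q X Z f a = cmp C Q Y Z g b"
  obtains h where "h \<in> hom C Q P" "cmp C Q P X p h = a" "cmp C Q P Y q h = b"
  using assms unfolding is_pullback_def by blast

lemma pullback_unique:
  assumes pb: "is_pullback C X Y Z f g P p q" and ob: "X \<in> ob C" "Y \<in> ob C" "Z \<in> ob C" "Q \<in> ob C"
    and fg: "f \<in> hom C X Z" "g \<in> hom C Y Z"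
    and h: "h \<in> hom C Q P" "k \<in> hom C Q P"
    and eq: "cmp C Q P X p h = cmp C Q P X p k" "cmp C Q P Y q h = cmp C Q P Y q k"
  shows "h = k"
proof -
  note D = is_pullbackD[OF pb]
  have "cmp C Q X Z f (cmp C Q P X p h) = cmp C Q Y Z g (cmp C Q P Y q h)"
    using D ob fg h cmp_assoc[of Q P X Z h p f] cmp_assoc[of Q P Y Z h q g] by simp
  moreover have "cmp C Q P X p h \<in> hom C Q X" "cmp C Q P Y q h \<in> hom C Q Y"
    using D ob h by auto
  ultimately have "\<exists>!l. l \<in> hom C Q P \<and> cmp C Q P X p l = cmp C Q P X p h \<and>
      cmp C Q P Y q l = cmp C Q P Y q h"
    using pb ob(4) unfolding is_pullback_def by blast
  then show ?thesis using h eq by metis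
qed

end

lemma lex_functor_comp:
  assumes F: "lex_functor A B F" and G: "lex_functor B C G"
  shows "lex_functor A C (func_comp G F)"
proof -
  have F': "is_functor A B F" and G': "is_functor B C G" using F G by (simp_all add: lex_functor_def)
  have "is_functor A C (func_comp G F)"
    using F' G' by (simp add: is_functor_def func_comp_def)
  moreover have "is_limit J C (func_comp (func_comp G F) D) (fob (func_comp G F) L)
      (\<lambda>j. fmap (func_comp G F) L (fob D j) (p j))"
    if J: "finite_category J" and D: "is_functor J A D" and lim: "is_limit J A D L p"
    for J :: "(nat, nat) cat" and D L p
  proof -
    have "is_functor J B (func_comp F D)"
      using D F' by (simp add: is_functor_def func_comp_def)
    moreover have "is_limit J B (func_comp F D) (fob F L) (\<lambda>j. fmap F L (fob D j) (p j))"
      using F J D lim unfolding lex_functor_def by blast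
    ultimately have "is_limit J C (func_comp G (func_comp F D)) (fob G (fob F L))
        (\<lambda>j. fmap G (fob F L) (fob (func_comp F D) j) (fmap F L (fob D j) (p j)))"
      using G J unfolding lex_functor_def by blast
    then show ?thesis by (simp add: func_comp_def)
  qed
  ultimately show ?thesis by (simp add: lex_functor_def)
qed

text \<open>The shape 0 -> 2 <- 1 is a preorder, so each hom-set is \<open>{0}\<close> or empty and
  composition can be constant. It is typed over \<open>nat\<close> because finite limits are
  quantified over such shapes only.\<close>

definition cospan :: "(nat, nat) cat" where
  "cospan = \<lparr>ob = {0, 1, 2}, hom = (\<lambda>i j. if i = j \<or> j = 2 then {0} else {}),
     ide = (\<lambda>_. 0), cmp = (\<lambda>_ _ _ _ _. 0)\<rparr>"

definition cospan_diagram ::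
  "('o, 'm) cat \<Rightarrow> 'o \<Rightarrow> 'o \<Rightarrow> 'o \<Rightarrow> 'm \<Rightarrow> 'm \<Rightarrow> (nat, nat, 'o, 'm) func" where
  "cospan_diagram C X Y Z f g = \<lparr>fob = (\<lambda>j. if j = 0 then X else if j = 1 then Y else Z),
     fmap = (\<lambda>i j u. if i = j then ide C (if j = 0 then X else if j = 1 then Y else Z)
                     else if i = 0 then f else g)\<rparr>"

lemma finite_category_cospan: "finite_category cospan"
  by (auto simp: finite_category_def category_def cospan_def split: if_splits)

context cat
begin

lemma is_functor_cospan_diagram:
  assumes "X \<in> ob C" "Y \<in> ob C" "Z \<in> ob C" "f \<in> hom C X Z" "g \<in> hom C Y Z"
  shows "is_functor cospan C (cospan_diagram C X Y Z f g)"
proof -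
  let ?D = "cospan_diagram C X Y Z f g"
  have obD: "fob ?D i \<in> ob C" for i
    using assms(1-3) by (simp add: cospan_diagram_def)
  have D: "fmap ?D i i u = ide C (fob ?D i)" for i u
    by (simp add: cospan_diagram_def)
  have homD: "fmap ?D i j u \<in> hom C (fob ?D i) (fob ?D j)"
    if ij: "i \<in> ob cospan" "j \<in> ob cospan" "u \<in> hom cospan i j" for i j u
  proof (cases "i = j")
    case True
    then show ?thesis using obD D by simp
  next
    case False
    then have "j = 2" "i = 0 \<or> i = 1" using ij by (auto simp: cospan_def split: if_splits)
    then show ?thesis using assms by (auto simp: cospan_diagram_def)
  qed
  have "fmap ?D i k (cmp cospan i j k v u) = cmp C (fob ?D i) (fob ?D j) (fob ?D k) (fmap ?D j k v) (fmap ?D i j u)"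
    if ijk: "i \<in> ob cospan" "j \<in> ob cospan" "k \<in> ob cospan" "u \<in> hom cospan i j" "v \<in> hom cospan j k"
    for i j k u v
  proof -
    have uv: "u = 0" "v = 0" "cmp cospan i j k v u = 0" and "i = j \<or> j = k"
      using ijk by (auto simp: cospan_def split: if_splits)
    then show ?thesis
      using homD[OF ijk(1,2,4)] homD[OF ijk(2,3,5)] obD by (auto simp: D)
  qed
  then show ?thesis
    using finite_category_cospan category obD homD D
    unfolding is_functor_def finite_category_def by blast
qed

text \<open>The hypotheses fix the values of \<open>D\<close> on the arrows of the shape instead of
  asking \<open>D = cospan_diagram ...\<close>: the result is also applied to
  \<open>func_comp F (cospan_diagram ...)\<close>, which is a different record.\<close>

lemma is_cone_cospan:
  assumes "fob D 0 = X" "fob D 1 = Y" "fob D 2 = Z" "fmap D 0 2 0 = f" "fmap D 1 2 0 = g"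
    and "\<forall>i\<in>{0, 1, 2}. fmap D i i 0 = ide C (fob D i)"
    and "X \<in> ob C" "Y \<in> ob C" "Z \<in> ob C"
  shows "is_cone cospan C D L p \<longleftrightarrow> L \<in> ob C \<and> p 0 \<in> hom C L X \<and> p 1 \<in> hom C L Y \<and>
    p 2 \<in> hom C L Z \<and> cmp C L X Z f (p 0) = p 2 \<and> cmp C L Y Z g (p 1) = p 2"
proof -
  have J: "ob cospan = {0, 1, 2}" by (simp add: cospan_def)
  have arrows: "(\<forall>i\<in>{0, 1, 2}. \<forall>j\<in>{0, 1, 2}. \<forall>u\<in>hom cospan i j. Q i j u) \<longleftrightarrow>
    Q 0 0 0 \<and> Q 1 1 0 \<and> Q 2 2 0 \<and> Q 0 2 0 \<and> Q 1 2 0" for Q :: "nat \<Rightarrow> nat \<Rightarrow> nat \<Rightarrow> bool"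
    by (simp add: cospan_def) blast
  have "fmap D 0 0 0 = ide C X" "fmap D 1 1 0 = ide C Y" "fmap D 2 2 0 = ide C Z"
    using assms(1,2,3,6) by (metis insertCI)+
  note D = assms(1-5) this
  show ?thesis
    unfolding is_cone_def J arrows
    by (simp only: ball_simps simp_thms D) (use assms(7-9) cmp_ide(2) in metis)
qed

text \<open>The leg at 2 is forced by the leg at 0, so it appears as an equation beside the pullback
  property.\<close>

lemma is_limit_cospan:
  assumes D: "fob D 0 = X" "fob D 1 = Y" "fob D 2 = Z" "fmap D 0 2 0 = f" "fmap D 1 2 0 = g"
      "\<forall>i\<in>{0, 1, 2}. fmap D i i 0 = ide C (fob D i)"
    and ob: "X \<in> ob C" "Y \<in> ob C" "Z \<in> ob C" "f \<in> hom C X Z" "g \<in> hom C Y Z"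
  shows "is_limit cospan C D P p \<longleftrightarrow>
    is_pullback C X Y Z f g P (p 0) (p 1) \<and> p 2 = cmp C P X Z f (p 0)"
proof -
  note cone = is_cone_cospan[of D X Y Z f g, OF D ob(1-3)]
  have J: "ob cospan = {0, 1, 2}" by (simp add: cospan_def)
  show ?thesis
  proof
    assume lim: "is_limit cospan C D P p"
    then have c: "P \<in> ob C" "p 0 \<in> hom C P X" "p 1 \<in> hom C P Y" "p 2 \<in> hom C P Z"
        "cmp C P X Z f (p 0) = p 2" "cmp C P Y Z g (p 1) = p 2"
      by (auto simp: is_limit_def cone)
    have "\<exists>!h. h \<in> hom C Q P \<and> cmp C Q P X (p 0) h = a \<and> cmp C Q P Y (p 1) h = b"
      if Q: "Q \<in> ob C" "a \<in> hom C Q X" "b \<in> hom C Q Y" "cmp C Q X Z f a = cmp C Q Y Z g b" for Q a b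
    proof -
      define q where "q = (\<lambda>j::nat. if j = 0 then a else if j = 1 then b else cmp C Q X Z f a)"
      have "is_cone cospan C D Q q"
        using Q ob unfolding cone by (auto simp: q_def)
      then have ex: "\<exists>!h. h \<in> hom C Q P \<and> (\<forall>j\<in>ob cospan. cmp C Q P (fob D j) (p j) h = q j)"
        using lim by (simp add: is_limit_def)
      have "cmp C Q P Z (p 2) h = cmp C Q X Z f a"
        if "h \<in> hom C Q P" "cmp C Q P X (p 0) h = a" for h
        using c(1,2,5) that Q ob cmp_assoc[of Q P X Z h "p 0" f] by simp
      then have "(h \<in> hom C Q P \<and> (\<forall>j\<in>ob cospan. cmp C Q P (fob D j) (p j) h = q j)) \<longleftrightarrow>
          (h \<in> hom C Q P \<and> cmp C Q P X (p 0) h = a \<and> cmp C Q P Y (p 1) h = b)" for h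
        using D(1-3) by (auto simp: J q_def)
      then show ?thesis using ex by simp
    qed
    then show "is_pullback C X Y Z f g P (p 0) (p 1) \<and> p 2 = cmp C P X Z f (p 0)"
      using c by (simp add: is_pullback_def)
  next
    assume "is_pullback C X Y Z f g P (p 0) (p 1) \<and> p 2 = cmp C P X Z f (p 0)"
    then have pb: "is_pullback C X Y Z f g P (p 0) (p 1)" and p2: "p 2 = cmp C P X Z f (p 0)"
      by auto
    note c = is_pullbackD[OF pb]
    have "is_cone cospan C D P p"
      using c ob by (simp add: cone p2)
    moreover have "\<exists>!h. h \<in> hom C Q P \<and> (\<forall>j\<in>ob cospan. cmp C Q P (fob D j) (p j) h = q j)"
      if "is_cone cospan C D Q q" for Q q
    proof -
      have q: "Q \<in> ob C" "q 0 \<in> hom C Q X" "q 1 \<in> hom C Q Y" "q 2 \<in> hom C Q Z"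
        "cmp C Q X Z f (q 0) = q 2" "cmp C Q Y Z g (q 1) = q 2"
        using that unfolding cone by auto
      then have ex: "\<exists>!h. h \<in> hom C Q P \<and> cmp C Q P X (p 0) h = q 0 \<and> cmp C Q P Y (p 1) h = q 1"
        using pb by (simp add: is_pullback_def)
      have "cmp C Q P Z (p 2) h = q 2" if "h \<in> hom C Q P" "cmp C Q P X (p 0) h = q 0" for h
        using c(1,2) that q ob cmp_assoc[of Q P X Z h "p 0" f] by (simp add: p2)
      then have "(h \<in> hom C Q P \<and> (\<forall>j\<in>ob cospan. cmp C Q P (fob D j) (p j) h = q j)) \<longleftrightarrow>
          (h \<in> hom C Q P \<and> cmp C Q P X (p 0) h = q 0 \<and> cmp C Q P Y (p 1) h = q 1)" for h
        using D(1-3) by (auto simp: J)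
      then show ?thesis using ex by simp
    qed
    ultimately show "is_limit cospan C D P p" by (simp add: is_limit_def)
  qed
qed

lemma pullback_exists:
  assumes "finitely_complete C" "X \<in> ob C" "Y \<in> ob C" "Z \<in> ob C" "f \<in> hom C X Z" "g \<in> hom C Y Z"
  obtains P p q where "is_pullback C X Y Z f g P p q"
proof -
  let ?D = "cospan_diagram C X Y Z f g"
  obtain P p where "is_limit cospan C ?D P p"
    using assms finite_category_cospan is_functor_cospan_diagram unfolding finitely_complete_def by metis
  then have "is_pullback C X Y Z f g P (p 0) (p 1)"
    using assms is_limit_cospan[of ?D X Y Z f g P p] by (simp add: cospan_diagram_def)
  then show thesis using that by blast
qed

lemma lex_functor_pullback:
  assumes F: "lex_functor C B F" and pb: "is_pullback C X Y Z f g P p q"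
    and ob: "X \<in> ob C" "Y \<in> ob C" "Z \<in> ob C" "f \<in> hom C X Z" "g \<in> hom C Y Z"
  shows "is_pullback B (fob F X) (fob F Y) (fob F Z) (fmap F X Z f) (fmap F Y Z g)
           (fob F P) (fmap F P X p) (fmap F P Y q)"
proof -
  let ?D = "cospan_diagram C X Y Z f g"
  let ?p = "\<lambda>j::nat. if j = 0 then p else if j = 1 then q else cmp C P X Z f p"
  have fF: "is_functor C B F" using F by (simp add: lex_functor_def)
  interpret B: cat B using fF by unfold_locales (simp add: is_functor_def)
  have "is_limit cospan C ?D P ?p"
    using is_limit_cospan[of ?D X Y Z f g P ?p] ob pb by (simp add: cospan_diagram_def)
  then have lim: "is_limit cospan B (func_comp F ?D) (fob F P) (\<lambda>j. fmap F P (fob ?D j) (?p j))"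
    using F finite_category_cospan is_functor_cospan_diagram[OF ob] unfolding lex_functor_def by blast
  have "fmap F X Z f \<in> hom B (fob F X) (fob F Z)" "fmap F Y Z g \<in> hom B (fob F Y) (fob F Z)"
    and "fob F X \<in> ob B" "fob F Y \<in> ob B" "fob F Z \<in> ob B"
    and "\<And>A. A \<in> ob C \<Longrightarrow> fmap F A A (ide C A) = ide B (fob F A)"
    using fF ob by (auto simp: is_functor_def)
  then have "is_pullback B (fob F X) (fob F Y) (fob F Z) (fmap F X Z f) (fmap F Y Z g)
           (fob F P) (fmap F P (fob ?D 0) (?p 0)) (fmap F P (fob ?D 1) (?p 1))"
    using B.is_limit_cospan[of "func_comp F ?D" "fob F X" "fob F Y" "fob F Z" "fmap F X Z f"
      "fmap F Y Z g" "fob F P" "\<lambda>j. fmap F P (fob ?D j) (?p j)"] lim ob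
    by (simp add: func_comp_def cospan_diagram_def)
  then show ?thesis by (simp add: cospan_diagram_def)
qed

text \<open>This says that \<open>e\<close> is the quotient of \<open>X\<close> by its kernel pair,
  with generalised elements \<open>r, s : T -> X\<close> in place of a chosen kernel pair.\<close>

definition eff_epi :: "'o \<Rightarrow> 'o \<Rightarrow> 'm \<Rightarrow> bool" where
  "eff_epi X Q e \<longleftrightarrow> X \<in> ob C \<and> Q \<in> ob C \<and> e \<in> hom C X Q \<and>
     (\<forall>Z\<in>ob C. \<forall>a\<in>hom C X Z.
        (\<forall>T\<in>ob C. \<forall>r\<in>hom C T X. \<forall>s\<in>hom C T X.
           cmp C T X Q e r = cmp C T X Q e s \<longrightarrow> cmp C T X Z a r = cmp C T X Z a s) \<longrightarrow>
        (\<exists>!h. h \<in> hom C Q Z \<and> cmp C X Q Z h e = a))"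

lemma eff_epiD:
  assumes "eff_epi X Q e"
  shows "X \<in> ob C" "Q \<in> ob C" "e \<in> hom C X Q"
  using assms by (simp_all add: eff_epi_def)

lemma eff_epi_descend:
  assumes "eff_epi X Q e" "Z \<in> ob C" "a \<in> hom C X Z"
    and "\<And>T r s. \<lbrakk>T \<in> ob C; r \<in> hom C T X; s \<in> hom C T X; cmp C T X Q e r = cmp C T X Q e s\<rbrakk>
           \<Longrightarrow> cmp C T X Z a r = cmp C T X Z a s"
  obtains h where "h \<in> hom C Q Z" "cmp C X Q Z h e = a"
  using assms unfolding eff_epi_def by blast

lemma eff_epi_cancel:
  assumes e: "eff_epi X Q e" and Z: "Z \<in> ob C" "h \<in> hom C Q Z" "k \<in> hom C Q Z"
    and eq: "cmp C X Q Z h e = cmp C X Q Z k e"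
  shows "h = k"
proof -
  note D = eff_epiD[OF e]
  have "cmp C T X Z (cmp C X Q Z h e) r = cmp C T X Z (cmp C X Q Z h e) s"
    if "T \<in> ob C" "r \<in> hom C T X" "s \<in> hom C T X" "cmp C T X Q e r = cmp C T X Q e s" for T r s
    using that D Z by (simp add: cmp_assoc)
  moreover have "cmp C X Q Z h e \<in> hom C X Z" using D Z by simp
  ultimately have "\<exists>!l. l \<in> hom C Q Z \<and> cmp C X Q Z l e = cmp C X Q Z h e"
    using e Z(1) unfolding eff_epi_def by blast
  then show ?thesis using Z eq by metis
qed

lemma eff_epi_ide: "X \<in> ob C \<Longrightarrow> eff_epi X X (ide C X)"
  unfolding eff_epi_def using cmp_ide(1) by (intro conjI ballI impI ex1I) auto

text \<open>An arrow that identifies all pairs identified by \<open>e\<close> identifies in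
  particular the pair of which \<open>e\<close> is a coequaliser.\<close>

lemma regular_epi_imp_eff_epi:
  assumes "X \<in> ob C" "regular_epi C X Q e"
  shows "eff_epi X Q e"
proof -
  obtain R p q where R: "R \<in> ob C" "p \<in> hom C R X" "q \<in> hom C R X" "is_coequaliser C R X p q Q e"
    using assms(2) by (auto simp: regular_epi_def)
  then show ?thesis
    using assms(1) unfolding eff_epi_def is_coequaliser_def by blast
qed

text \<open>Pairs identified by \<open>f\<close> are exactly those that factor through
  \<open>R\<close>, so identifying \<open>p\<close> with \<open>q\<close> amounts to identifying all
  of them. The right-hand side no longer mentions \<open>R\<close>, \<open>p\<close> and
  \<open>q\<close>.\<close>

lemma is_coequaliser_kernel_pair_iff:
  assumes kp: "is_kernel_pair C X Y f R p q" and ob: "X \<in> ob C" "Y \<in> ob C" "f \<in> hom C X Y"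
  shows "is_coequaliser C R X p q Q e \<longleftrightarrow> Q \<in> ob C \<and> e \<in> hom C X Q \<and>
     (\<forall>T\<in>ob C. \<forall>r\<in>hom C T X. \<forall>s\<in>hom C T X.
        cmp C T X Y f r = cmp C T X Y f s \<longrightarrow> cmp C T X Q e r = cmp C T X Q e s) \<and>
     (\<forall>Z\<in>ob C. \<forall>a\<in>hom C X Z.
        (\<forall>T\<in>ob C. \<forall>r\<in>hom C T X. \<forall>s\<in>hom C T X.
           cmp C T X Y f r = cmp C T X Y f s \<longrightarrow> cmp C T X Z a r = cmp C T X Z a s) \<longrightarrow>
        (\<exists>!h. h \<in> hom C Q Z \<and> cmp C X Q Z h e = a))"
proof -
  have pb: "is_pullback C X X Y f f R p q" using kp by (simp add: is_kernel_pair_def)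
  note R = is_pullbackD[OF pb]
  have *: "(\<forall>T\<in>ob C. \<forall>r\<in>hom C T X. \<forall>s\<in>hom C T X.
      cmp C T X Y f r = cmp C T X Y f s \<longrightarrow> cmp C T X Z a r = cmp C T X Z a s)
    \<longleftrightarrow> cmp C R X Z a p = cmp C R X Z a q" if Z: "Z \<in> ob C" "a \<in> hom C X Z" for Z a
  proof
    assume eq: "cmp C R X Z a p = cmp C R X Z a q"
    have "cmp C T X Z a r = cmp C T X Z a s"
      if T: "T \<in> ob C" "r \<in> hom C T X" "s \<in> hom C T X" "cmp C T X Y f r = cmp C T X Y f s" for T r s
    proof -
      obtain h where h: "h \<in> hom C T R" "cmp C T R X p h = r" "cmp C T R X q h = s"
        using pullback_lift[OF pb T] by blast
      have "cmp C T R Z (cmp C R X Z a p) h = cmp C T R Z (cmp C R X Z a q) h" using eq by simp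
      then show ?thesis using cmp_assoc[of T R X Z h _ a] R(1-3) h T(1) Z ob(1) by simp
    qed
    then show "\<forall>T\<in>ob C. \<forall>r\<in>hom C T X. \<forall>s\<in>hom C T X.
      cmp C T X Y f r = cmp C T X Y f s \<longrightarrow> cmp C T X Z a r = cmp C T X Z a s" by blast
  qed (use R in blast)
  show ?thesis
    unfolding is_coequaliser_def
    by (intro conj_cong ball_cong refl arg_cong2[where f = "(\<longrightarrow>)"]) (simp_all only: *)
qed

lemma eff_epi_imp_regular_epi:
  assumes fc: "finitely_complete C" and e: "eff_epi X Q e"
  shows "regular_epi C X Q e"
proof -
  note D = eff_epiD[OF e]
  obtain R p q where pb: "is_pullback C X X Q e e R p q"
    using pullback_exists[OF fc D(1) D(1) D(2) D(3) D(3)] by blast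
  then have kp: "is_kernel_pair C X Q e R p q" by (simp add: is_kernel_pair_def)
  have "is_coequaliser C R X p q Q e"
    unfolding is_coequaliser_kernel_pair_iff[OF kp D] using e unfolding eff_epi_def by blast
  then show ?thesis
    using is_pullbackD[OF pb] by (auto simp: regular_epi_def)
qed

end

section \<open>Effective epimorphisms in a regular category\<close>

locale regcat = cat C for C :: "('o, 'm) cat" +
  assumes regular: "regular_category C"
begin

lemma complete: "finitely_complete C"
  using regular by (simp add: regular_category_def)

lemma eff_epi_pullback:
  assumes e: "eff_epi X Z e" and g: "Y \<in> ob C" "g \<in> hom C Y Z"
  obtains P p q where "P \<in> ob C" "p \<in> hom C P X" "eff_epi P Y q" "cmp C P X Z e p = cmp C P Y Z g q"
proof -
  note D = eff_epiD[OF e]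
  obtain P p q where pb: "is_pullback C X Y Z e g P p q"
    using pullback_exists[OF complete D(1) g(1) D(2) D(3) g(2)] by blast
  have "regular_epi C P Y q"
    using regular eff_epi_imp_regular_epi[OF complete e] pb D g
    unfolding regular_category_def regular_epis_stable_def by blast
  then have "eff_epi P Y q"
    using is_pullbackD[OF pb] regular_epi_imp_eff_epi by blast
  then show thesis
    using is_pullbackD[OF pb] that by blast
qed

text \<open>An arrow out of \<open>X\<close> first descends along \<open>e\<close> to some
  \<open>b\<close> on \<open>Y\<close>. That \<open>b\<close> respects the fibres of
  \<open>f\<close> is checked on a cover where arrows into \<open>Y\<close> lift to
  \<open>X\<close>; stability under pullback provides this cover, and effective epimorphisms can be
  cancelled afterwards.\<close>

lemma eff_epi_cmp:
  assumes e: "eff_epi X Y e" and f: "eff_epi Y Z f"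
  shows "eff_epi X Z (cmp C X Y Z f e)"
proof -
  note D = eff_epiD[OF e] eff_epiD(2,3)[OF f]
  have desc: "\<exists>!h. h \<in> hom C Z W \<and> cmp C X Z W h (cmp C X Y Z f e) = a"
    if W: "W \<in> ob C" and a: "a \<in> hom C X W"
      and co: "\<And>T r s. \<lbrakk>T \<in> ob C; r \<in> hom C T X; s \<in> hom C T X;
         cmp C T X Z (cmp C X Y Z f e) r = cmp C T X Z (cmp C X Y Z f e) s\<rbrakk>
         \<Longrightarrow> cmp C T X W a r = cmp C T X W a s" for W a
  proof -
    obtain b where b: "b \<in> hom C Y W" "cmp C X Y W b e = a"
      using eff_epi_descend[OF e W a] co D by (metis cmp_assoc)
    have "cmp C S Y W b r = cmp C S Y W b s"
      if S: "S \<in> ob C" "r \<in> hom C S Y" "s \<in> hom C S Y" "cmp C S Y Z f r = cmp C S Y Z f s" for S r s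
    proof -
      \<comment> \<open>Two successive covers: over \<open>S1\<close> the arrow \<open>r\<close>
        lifts along \<open>e\<close>, over \<open>S2\<close> also \<open>s\<close> does. On
        \<open>S2\<close> the hypothesis \<open>co\<close> about arrows into \<open>X\<close>
        applies.\<close>
      obtain S1 s1 c1 where 1: "S1 \<in> ob C" "s1 \<in> hom C S1 X" "eff_epi S1 S c1"
        "cmp C S1 X Y e s1 = cmp C S1 S Y r c1"
        using eff_epi_pullback[OF e S(1,2)] by blast
      note c1 = eff_epiD(3)[OF 1(3)]
      have sc: "cmp C S1 S Y s c1 \<in> hom C S1 Y" using 1 c1 S D by blast
      obtain S2 s2 c2 where 2: "S2 \<in> ob C" "s2 \<in> hom C S2 X" "eff_epi S2 S1 c2"
        "cmp C S2 X Y e s2 = cmp C S2 S1 Y (cmp C S1 S Y s c1) c2"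
        using eff_epi_pullback[OF e 1(1) sc] by blast
      note c2 = eff_epiD(3)[OF 2(3)]
      have brs: "cmp C S Y W b r \<in> hom C S W" "cmp C S Y W b s \<in> hom C S W"
        using S D W b(1) by simp_all
      let ?t = "cmp C S2 S1 X s1 c2" and ?c = "cmp C S2 S1 S c1 c2"
      have t: "?t \<in> hom C S2 X" "?c \<in> hom C S2 S" using 1 2 c1 c2 S D by auto
      have et: "cmp C S2 X Y e ?t = cmp C S2 S Y r ?c"
        using 1 2 c1 c2 S D cmp_assoc[of S2 S1 X Y c2 s1 e] cmp_assoc[of S2 S1 S Y c2 c1 r] by simp
      have es: "cmp C S2 X Y e s2 = cmp C S2 S Y s ?c"
        using 1 2 c1 c2 S D cmp_assoc[of S2 S1 S Y c2 c1 s] by simp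
      have "cmp C S2 S Z (cmp C S Y Z f r) ?c = cmp C S2 S Z (cmp C S Y Z f s) ?c"
        using S by simp
      then have "cmp C S2 Y Z f (cmp C S2 X Y e ?t) = cmp C S2 Y Z f (cmp C S2 X Y e s2)"
        unfolding et es
        using cmp_assoc[of S2 S Y Z ?c r f] cmp_assoc[of S2 S Y Z ?c s f] S t 2 D by metis
      then have "cmp C S2 X Z (cmp C X Y Z f e) ?t = cmp C S2 X Z (cmp C X Y Z f e) s2"
        using cmp_assoc[of S2 X Y Z _ e f] t 2 D by simp
      then have "cmp C S2 X W a ?t = cmp C S2 X W a s2"
        using co[OF 2(1) t(1) 2(2)] by blast
      then have "cmp C S2 Y W b (cmp C S2 X Y e ?t) = cmp C S2 Y W b (cmp C S2 X Y e s2)"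
        using b cmp_assoc[of S2 X Y W _ e b] t 2 D W by simp
      then have "cmp C S2 S W (cmp C S Y W b r) ?c = cmp C S2 S W (cmp C S Y W b s) ?c"
        unfolding et es
        using cmp_assoc[of S2 S Y W ?c r b] cmp_assoc[of S2 S Y W ?c s b] S t 2 D W b by metis
      then have "cmp C S2 S1 W (cmp C S1 S W (cmp C S Y W b r) c1) c2
        = cmp C S2 S1 W (cmp C S1 S W (cmp C S Y W b s) c1) c2"
        using cmp_assoc[of S2 S1 S W c2 c1] c1 c2 S 1 2 D W b by simp
      then have "cmp C S1 S W (cmp C S Y W b r) c1 = cmp C S1 S W (cmp C S Y W b s) c1"
        by (rule eff_epi_cancel[OF 2(3) W cmp_hom[OF 1(1) S(1) W c1 brs(1)] cmp_hom[OF 1(1) S(1) W c1 brs(2)]])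
      then show ?thesis
        by (rule eff_epi_cancel[OF 1(3) W brs])
    qed
    then obtain h where h: "h \<in> hom C Z W" "cmp C Y Z W h f = b"
      using eff_epi_descend[OF f W b(1)] by blast
    show ?thesis
    proof (rule ex1I[of _ h])
      show "h \<in> hom C Z W \<and> cmp C X Z W h (cmp C X Y Z f e) = a"
        using h b D W cmp_assoc[of X Y Z W e f h] by simp
      fix k assume k: "k \<in> hom C Z W \<and> cmp C X Z W k (cmp C X Y Z f e) = a"
      then have "cmp C X Y W (cmp C Y Z W k f) e = cmp C X Y W b e"
        using b D W cmp_assoc[of X Y Z W e f k] by simp
      then have kf: "cmp C Y Z W k f = b"
        by (rule eff_epi_cancel[OF e W cmp_hom[OF D(2) D(4) W D(5) conjunct1[OF k]] b(1)])
      show "k = h"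
        by (rule eff_epi_cancel[OF f W conjunct1[OF k] h(1) trans[OF kf h(2)[symmetric]]])
    qed
  qed
  have "cmp C X Y Z f e \<in> hom C X Z" using D by simp
  then show ?thesis
    unfolding eff_epi_def by (intro conjI ballI impI D(1,4) desc) blast+
qed

end

section \<open>Presheaves\<close>

lemma small_subset: "small \<kappa> A \<Longrightarrow> B \<subseteq> A \<Longrightarrow> small \<kappa> B"
  unfolding small_def using card_of_mono1 ordLeq_ordLess_trans by blast

lemma small_image: "small \<kappa> A \<Longrightarrow> small \<kappa> (f ` A)"
  unfolding small_def using card_of_image ordLeq_ordLess_trans by blast

lemma category_set_cat: "category (set_cat \<kappa>)"
  unfolding category_def set_cat_def
  by (auto simp: compose_def PiE_iff extensional_def restrict_def fun_eq_iff)

locale presheaves = cat C for C :: "('o, 'u) cat" +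
  fixes \<kappa> :: "'u rel"
  assumes locally_small: "locally_small \<kappa> C"
begin

abbreviation psh :: "('o, 'u) presheaf \<Rightarrow> bool" where
  "psh \<equiv> is_functor (op_cat C) (set_cat \<kappa>)"

abbreviation nt :: "('o, 'u) presheaf \<Rightarrow> ('o, 'u) presheaf \<Rightarrow> ('o \<Rightarrow> 'u \<Rightarrow> 'u) set" where
  "nt \<equiv> nat_trans (op_cat C) (set_cat \<kappa>)"

abbreviation y :: "'o \<Rightarrow> ('o, 'u) presheaf" where
  "y \<equiv> yoneda_ob C"

lemma psh_small: "psh F \<Longrightarrow> Z \<in> ob C \<Longrightarrow> small \<kappa> (fob F Z)"
  by (simp add: is_functor_def op_cat_def set_cat_def)

lemma psh_fmap: "\<lbrakk>psh F; Z \<in> ob C; Z' \<in> ob C; h \<in> hom C Z' Z\<rbrakk> \<Longrightarrow> fmap F Z Z' h \<in> fob F Z \<rightarrow>\<^sub>E fob F Z'"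
  by (simp add: is_functor_def op_cat_def set_cat_def)

lemma psh_in [simp]:
  "\<lbrakk>psh F; Z \<in> ob C; Z' \<in> ob C; h \<in> hom C Z' Z; x \<in> fob F Z\<rbrakk> \<Longrightarrow> fmap F Z Z' h x \<in> fob F Z'"
  using psh_fmap by blast

lemma psh_ide [simp]: "\<lbrakk>psh F; Z \<in> ob C; x \<in> fob F Z\<rbrakk> \<Longrightarrow> fmap F Z Z (ide C Z) x = x"
  by (simp add: is_functor_def op_cat_def set_cat_def)

lemma psh_cmp:
  "\<lbrakk>psh F; Z \<in> ob C; Z' \<in> ob C; Z'' \<in> ob C; f \<in> hom C Z' Z; g \<in> hom C Z'' Z'; x \<in> fob F Z\<rbrakk>
    \<Longrightarrow> fmap F Z Z'' (cmp C Z'' Z' Z f g) x = fmap F Z' Z'' g (fmap F Z Z' f x)"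
  by (simp add: is_functor_def op_cat_def set_cat_def compose_def)

lemma pshI:
  assumes "\<And>Z. Z \<in> ob C \<Longrightarrow> small \<kappa> (fob F Z)"
    and fmap: "\<And>Z Z' h. \<lbrakk>Z \<in> ob C; Z' \<in> ob C; h \<in> hom C Z' Z\<rbrakk> \<Longrightarrow> fmap F Z Z' h \<in> fob F Z \<rightarrow>\<^sub>E fob F Z'"
    and ide: "\<And>Z x. \<lbrakk>Z \<in> ob C; x \<in> fob F Z\<rbrakk> \<Longrightarrow> fmap F Z Z (ide C Z) x = x"
    and cmp: "\<And>Z Z' Z'' f g x. \<lbrakk>Z \<in> ob C; Z' \<in> ob C; Z'' \<in> ob C; f \<in> hom C Z' Z; g \<in> hom C Z'' Z';
      x \<in> fob F Z\<rbrakk> \<Longrightarrow> fmap F Z Z'' (cmp C Z'' Z' Z f g) x = fmap F Z' Z'' g (fmap F Z Z' f x)"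
  shows "psh F"
proof -
  have "fmap F Z Z (ide C Z) = (\<lambda>x\<in>fob F Z. x)" if Z: "Z \<in> ob C" for Z
    using fmap[OF Z Z ide_hom[OF Z]] ide[OF Z] by (intro PiE_ext[where k = "fob F Z" and s = "\<lambda>_. fob F Z"]) auto
  moreover have "fmap F Z Z'' (cmp C Z'' Z' Z f g) = compose (fob F Z) (fmap F Z' Z'' g) (fmap F Z Z' f)"
    if Z: "Z \<in> ob C" "Z' \<in> ob C" "Z'' \<in> ob C" and fg: "f \<in> hom C Z' Z" "g \<in> hom C Z'' Z'" for Z Z' Z'' f g
  proof (rule PiE_ext[where k = "fob F Z" and s = "\<lambda>_. fob F Z''"])
    show "fmap F Z Z'' (cmp C Z'' Z' Z f g) \<in> fob F Z \<rightarrow>\<^sub>E fob F Z''"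
      by (rule fmap) (use Z fg in simp_all)
    show "compose (fob F Z) (fmap F Z' Z'' g) (fmap F Z Z' f) \<in> fob F Z \<rightarrow>\<^sub>E fob F Z''"
      using fmap[OF Z(1,2) fg(1)] fmap[OF Z(2,3) fg(2)] by (auto simp: compose_def)
    show "\<And>i. i \<in> fob F Z \<Longrightarrow> fmap F Z Z'' (cmp C Z'' Z' Z f g) i = compose (fob F Z) (fmap F Z' Z'' g) (fmap F Z Z' f) i"
      using cmp[OF Z fg] by (simp add: compose_def)
  qed
  ultimately show ?thesis
    using assms(1) fmap category_op category_set_cat[of \<kappa>]
    by (simp add: is_functor_def op_cat_def set_cat_def)
qed

lemma ntD:
  assumes "\<alpha> \<in> nt F G"
  shows nt_extensional: "\<alpha> \<in> extensional (ob C)"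
    and nt_PiE: "Z \<in> ob C \<Longrightarrow> \<alpha> Z \<in> fob F Z \<rightarrow>\<^sub>E fob G Z"
    and nt_in [simp]: "Z \<in> ob C \<Longrightarrow> x \<in> fob F Z \<Longrightarrow> \<alpha> Z x \<in> fob G Z"
  using assms by (auto simp: nat_trans_def op_cat_def set_cat_def PiE_iff)

lemma nt_natural:
  assumes "\<alpha> \<in> nt F G" "Z \<in> ob C" "Z' \<in> ob C" "h \<in> hom C Z' Z" "x \<in> fob F Z"
  shows "\<alpha> Z' (fmap F Z Z' h x) = fmap G Z Z' h (\<alpha> Z x)"
proof -
  have "compose (fob F Z) (fmap G Z Z' h) (\<alpha> Z) = compose (fob F Z) (\<alpha> Z') (fmap F Z Z' h)"
    using assms(1-4) by (simp add: nat_trans_def op_cat_def set_cat_def)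
  then have "compose (fob F Z) (fmap G Z Z' h) (\<alpha> Z) x = compose (fob F Z) (\<alpha> Z') (fmap F Z Z' h) x"
    by simp
  then show ?thesis using assms(5) by (simp add: compose_def)
qed

lemma nt_eqI:
  assumes "\<alpha> \<in> nt F G" "\<beta> \<in> nt F G" "\<And>Z x. Z \<in> ob C \<Longrightarrow> x \<in> fob F Z \<Longrightarrow> \<alpha> Z x = \<beta> Z x"
  shows "\<alpha> = \<beta>"
  using nt_extensional[OF assms(1)] nt_extensional[OF assms(2)]
proof (rule extensionalityI)
  fix Z assume Z: "Z \<in> ob C"
  show "\<alpha> Z = \<beta> Z"
    by (rule PiE_ext[OF nt_PiE[OF assms(1) Z] nt_PiE[OF assms(2) Z] assms(3)[OF Z]])
qed

definition mknt :: "('o, 'u) presheaf \<Rightarrow> ('o \<Rightarrow> 'u \<Rightarrow> 'u) \<Rightarrow> 'o \<Rightarrow> 'u \<Rightarrow> 'u" where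
  "mknt F t = (\<lambda>Z\<in>ob C. \<lambda>x\<in>fob F Z. t Z x)"

lemma mknt_apply [simp]: "Z \<in> ob C \<Longrightarrow> x \<in> fob F Z \<Longrightarrow> mknt F t Z x = t Z x"
  by (simp add: mknt_def)

lemma mknt_in:
  assumes F: "psh F"
    and into: "\<And>Z x. Z \<in> ob C \<Longrightarrow> x \<in> fob F Z \<Longrightarrow> t Z x \<in> fob G Z"
    and natural: "\<And>Z Z' h x. \<lbrakk>Z \<in> ob C; Z' \<in> ob C; h \<in> hom C Z' Z; x \<in> fob F Z\<rbrakk> \<Longrightarrow>
      t Z' (fmap F Z Z' h x) = fmap G Z Z' h (t Z x)"
  shows "mknt F t \<in> nt F G"
proof -
  have "mknt F t \<in> (\<Pi>\<^sub>E Z\<in>ob C. fob F Z \<rightarrow>\<^sub>E fob G Z)"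
    using into by (simp add: mknt_def)
  moreover have "compose (fob F Z) (fmap G Z Z' h) (mknt F t Z) = compose (fob F Z) (mknt F t Z') (fmap F Z Z' h)"
    if "Z \<in> ob C" "Z' \<in> ob C" "h \<in> hom C Z' Z" for Z Z' h
    using that natural psh_in[OF F] by (auto simp: compose_def fun_eq_iff restrict_def)
  ultimately show ?thesis
    by (simp add: nat_trans_def op_cat_def set_cat_def)
qed

definition vcmp :: "('o, 'u) presheaf \<Rightarrow> ('o \<Rightarrow> 'u \<Rightarrow> 'u) \<Rightarrow> ('o \<Rightarrow> 'u \<Rightarrow> 'u) \<Rightarrow> 'o \<Rightarrow> 'u \<Rightarrow> 'u" where
  "vcmp F \<beta> \<alpha> = (\<lambda>Z\<in>ob C. compose (fob F Z) (\<beta> Z) (\<alpha> Z))"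

lemma vcmp_apply [simp]: "Z \<in> ob C \<Longrightarrow> x \<in> fob F Z \<Longrightarrow> vcmp F \<beta> \<alpha> Z x = \<beta> Z (\<alpha> Z x)"
  by (simp add: vcmp_def compose_def)

lemma vcmp_eq_mknt: "vcmp F \<beta> \<alpha> = mknt F (\<lambda>Z x. \<beta> Z (\<alpha> Z x))"
  by (simp add: vcmp_def mknt_def compose_def)

lemma vcmp_in:
  assumes "psh F" "\<alpha> \<in> nt F G" "\<beta> \<in> nt G H"
  shows "vcmp F \<beta> \<alpha> \<in> nt F H"
  unfolding vcmp_eq_mknt using assms
  by (intro mknt_in) (simp_all add: nt_natural)

lemma vcmp_eq_iff:
  assumes "psh F" "\<alpha> \<in> nt F G" "\<beta> \<in> nt G H" "\<gamma> \<in> nt F H"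
  shows "vcmp F \<beta> \<alpha> = \<gamma> \<longleftrightarrow> (\<forall>Z\<in>ob C. \<forall>x\<in>fob F Z. \<beta> Z (\<alpha> Z x) = \<gamma> Z x)"
  by (rule iffI, force, rule nt_eqI[OF vcmp_in[OF assms(1-3)] assms(4)], simp)

text \<open>Naturality is a consequence of uniqueness: the restriction of the chosen element
  satisfies \<open>P\<close> at the new stage, hence is the one chosen there. Maps into limits and
  out of quotients are built this way.\<close>

lemma nt_by_unique_choice:
  assumes F: "psh F" and G: "psh G"
    and ex: "\<And>Z x. \<lbrakk>Z \<in> ob C; x \<in> fob F Z\<rbrakk> \<Longrightarrow> \<exists>!m. m \<in> fob G Z \<and> P Z x m"
    and restrict: "\<And>Z Z' h x m. \<lbrakk>Z \<in> ob C; Z' \<in> ob C; h \<in> hom C Z' Z; x \<in> fob F Z; m \<in> fob G Z; P Z x m\<rbrakk>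
      \<Longrightarrow> P Z' (fmap F Z Z' h x) (fmap G Z Z' h m)"
  shows "\<exists>!t. t \<in> nt F G \<and> (\<forall>Z\<in>ob C. \<forall>x\<in>fob F Z. P Z x (t Z x))"
proof -
  define t where "t Z x = (THE m. m \<in> fob G Z \<and> P Z x m)" for Z x
  have t: "t Z x \<in> fob G Z" "P Z x (t Z x)" if "Z \<in> ob C" "x \<in> fob F Z" for Z x
    using theI'[OF ex[OF that]] unfolding t_def by auto
  have t_eq: "m = t Z x" if "Z \<in> ob C" "x \<in> fob F Z" "m \<in> fob G Z" "P Z x m" for Z x m
    using ex[OF that(1,2)] t[OF that(1,2)] that(3,4) by blast
  have nt: "mknt F t \<in> nt F G"
  proof (rule mknt_in[OF F])
    fix Z Z' h x assume a: "Z \<in> ob C" "Z' \<in> ob C" "h \<in> hom C Z' Z" "x \<in> fob F Z"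
    note tx = t[OF a(1,4)]
    show "t Z' (fmap F Z Z' h x) = fmap G Z Z' h (t Z x)"
      by (rule t_eq[OF a(2) psh_in[OF F a] psh_in[OF G a(1-3) tx(1)] restrict[OF a tx], symmetric])
  qed (use t in blast)
  show ?thesis
  proof (rule ex1I[of _ "mknt F t"])
    show "mknt F t \<in> nt F G \<and> (\<forall>Z\<in>ob C. \<forall>x\<in>fob F Z. P Z x (mknt F t Z x))"
      using nt t(2) by simp
    fix k assume k: "k \<in> nt F G \<and> (\<forall>Z\<in>ob C. \<forall>x\<in>fob F Z. P Z x (k Z x))"
    show "k = mknt F t"
      by (rule nt_eqI[OF conjunct1[OF k] nt]) (use k t_eq ntD(3)[OF conjunct1[OF k]] in simp)
  qed
qed

text \<open>Full subcategories of presheaves are all treated as one family: every presheaf, the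
  small ones, and \<open>Phi_l\<close> are instances. Hom-sets and composition do not depend on
  \<open>T\<close>.\<close>

definition PE :: "('o, 'u) presheaf set \<Rightarrow> (('o, 'u) presheaf, 'o \<Rightarrow> 'u \<Rightarrow> 'u) cat" where
  "PE T = full_subcat (presheaf_cat \<kappa> C) T"

lemma PE_simps [simp]:
  "ob (PE T) = T" "hom (PE T) = nt" "ide (PE T) F = mknt F (\<lambda>Z x. x)"
  "cmp (PE T) F G H \<beta> \<alpha> = vcmp F \<beta> \<alpha>"
  by (simp_all add: PE_def full_subcat_def presheaf_cat_def functor_cat_def op_cat_def set_cat_def
      vcmp_def mknt_def)

lemma presheaf_cat_PE: "presheaf_cat \<kappa> C = PE {F. psh F}"
  by (simp add: PE_def full_subcat_def presheaf_cat_def functor_cat_def)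

lemma small_presheaf_cat_PE: "small_presheaf_cat \<kappa> C = PE {F. small_presheaf \<kappa> C F}"
  by (simp add: PE_def small_presheaf_cat_def)

lemma Phi_l_PE: "Phi_l \<kappa> \<Phi> C = PE (Phi_l_ob \<kappa> \<Phi> C)"
  by (simp add: PE_def small_presheaf_cat_def Phi_l_def full_subcat_def)

lemma ide_in: "psh F \<Longrightarrow> mknt F (\<lambda>Z x. x) \<in> nt F F"
  by (rule mknt_in) simp_all

lemma category_PE:
  assumes T: "T \<subseteq> {F. psh F}"
  shows "category (PE T)"
proof -
  have "vcmp F \<alpha> (mknt F (\<lambda>Z x. x)) = \<alpha> \<and> vcmp F (mknt G (\<lambda>Z x. x)) \<alpha> = \<alpha>"
    if "F \<in> T" "G \<in> T" and \<alpha>: "\<alpha> \<in> nt F G" for F G \<alpha>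
  proof -
    have FG: "psh F" "psh G" using T that by auto
    show ?thesis
      using ntD(3)[OF \<alpha>]
      by (intro conjI nt_eqI[OF vcmp_in[OF FG(1) ide_in[OF FG(1)] \<alpha>] \<alpha>]
          nt_eqI[OF vcmp_in[OF FG(1) \<alpha> ide_in[OF FG(2)]] \<alpha>]) simp_all
  qed
  moreover have "vcmp A \<gamma> (vcmp A \<beta> \<alpha>) = vcmp A (vcmp B \<gamma> \<beta>) \<alpha>"
    if "A \<in> T" "B \<in> T" "F \<in> T" "G \<in> T" "\<alpha> \<in> nt A B" "\<beta> \<in> nt B F" "\<gamma> \<in> nt F G" for A B F G \<alpha> \<beta> \<gamma>
  proof -
    have psh: "psh A" "psh B" "psh F" using T that by auto
    show ?thesis
      by (rule nt_eqI[of _ A G]) (use that psh in \<open>simp_all add: vcmp_in[of A _ F] vcmp_in[of A _ B]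
          vcmp_in[of B _ F] ntD(3)[OF that(5)]\<close>)
  qed
  moreover have "vcmp F \<beta> \<alpha> \<in> nt F H" if "F \<in> T" "\<alpha> \<in> nt F G" "\<beta> \<in> nt G H" for F G H \<alpha> \<beta>
    using T that vcmp_in by blast
  moreover have "mknt F (\<lambda>Z x. x) \<in> nt F F" if "F \<in> T" for F
    using T that ide_in by blast
  ultimately show ?thesis
    unfolding category_def PE_simps by simp
qed

section \<open>The Yoneda embedding\<close>

lemma y_simps [simp]:
  "fob (y X) Z = hom C Z X"
  "f \<in> hom C Z X \<Longrightarrow> fmap (y X) Z Z' h f = cmp C Z' Z X f h"
  by (simp_all add: yoneda_ob_def)

lemma psh_y: "X \<in> ob C \<Longrightarrow> psh (y X)"
  using locally_small
  by (intro pshI) (auto simp: locally_small_def cmp_assoc yoneda_ob_def PiE_iff)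

lemma yoneda_map_eq: "yoneda_map C X Y g = mknt (y X) (\<lambda>Z f. cmp C Z X Y g f)"
  by (simp add: yoneda_map_def mknt_def)

lemma yoneda_map_in: "\<lbrakk>X \<in> ob C; Y \<in> ob C; g \<in> hom C X Y\<rbrakk> \<Longrightarrow> yoneda_map C X Y g \<in> nt (y X) (y Y)"
  unfolding yoneda_map_eq by (rule mknt_in) (simp_all add: psh_y cmp_assoc)

lemma yoneda_map_apply [simp]:
  "Z \<in> ob C \<Longrightarrow> f \<in> hom C Z X \<Longrightarrow> yoneda_map C X Y g Z f = cmp C Z X Y g f"
  by (simp add: yoneda_map_eq)

text \<open>The transformation \<open>y Z -> F\<close> that corresponds to the element
  \<open>x\<close> of \<open>F\<close> at \<open>Z\<close> under the Yoneda lemma.\<close>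

definition yelt :: "('o, 'u) presheaf \<Rightarrow> 'o \<Rightarrow> 'u \<Rightarrow> 'o \<Rightarrow> 'u \<Rightarrow> 'u" where
  "yelt F Z x = mknt (y Z) (\<lambda>W h. fmap F Z W h x)"

lemma yelt_in: "\<lbrakk>psh F; Z \<in> ob C; x \<in> fob F Z\<rbrakk> \<Longrightarrow> yelt F Z x \<in> nt (y Z) F"
  unfolding yelt_def by (rule mknt_in) (simp_all add: psh_y psh_cmp)

lemma yelt_apply [simp]: "W \<in> ob C \<Longrightarrow> h \<in> hom C W Z \<Longrightarrow> yelt F Z x W h = fmap F Z W h x"
  by (simp add: yelt_def)

lemma nt_y:
  assumes "t \<in> nt (y Z) F" "Z \<in> ob C" "W \<in> ob C" "h \<in> hom C W Z"
  shows "t W h = fmap F Z W h (t Z (ide C Z))"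
  using nt_natural[of t "y Z" F Z W h "ide C Z"] assms by simp

lemma is_functor_yoneda:
  assumes "T \<subseteq> {F. psh F}" "y ` ob C \<subseteq> T"
  shows "is_functor C (PE T) (yoneda C)"
proof -
  have "yoneda_map C X X (ide C X) = mknt (y X) (\<lambda>Z x. x)" if "X \<in> ob C" for X
    by (rule nt_eqI[OF yoneda_map_in ide_in]) (simp_all add: that psh_y)
  moreover have "yoneda_map C X Z (cmp C X Y Z g f) = vcmp (y X) (yoneda_map C Y Z g) (yoneda_map C X Y f)"
    if "X \<in> ob C" "Y \<in> ob C" "Z \<in> ob C" "f \<in> hom C X Y" "g \<in> hom C Y Z" for X Y Z f g
    by (rule nt_eqI[OF yoneda_map_in vcmp_in[OF _ yoneda_map_in yoneda_map_in]])
      (use that in \<open>simp_all add: psh_y cmp_assoc\<close>)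
  ultimately show ?thesis
    unfolding is_functor_def yoneda_def using assms category category_PE yoneda_map_in
    by (simp add: image_subset_iff)
qed

end

text \<open>Since \<open>T\<close> contains the representables, an element at \<open>Z\<close> is a
  morphism from \<open>y Z\<close> within the subcategory. Limits that exist in \<open>PE T\<close>
  are therefore computed pointwise, although \<open>T\<close> may lack limits of its own.\<close>

locale presheaf_subcat = presheaves C \<kappa> for C :: "('o, 'u) cat" and \<kappa> +
  fixes T :: "('o, 'u) presheaf set"
  assumes T_psh: "T \<subseteq> {F. psh F}" and T_y: "y ` ob C \<subseteq> T"
begin

lemma psh_T: "F \<in> T \<Longrightarrow> psh F"
  using T_psh by blast

lemma y_T: "X \<in> ob C \<Longrightarrow> y X \<in> T"
  using T_y by blast

text \<open>By Yoneda a compatible family of elements at \<open>Z\<close> is a cone with vertex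
  \<open>y Z\<close>, and mediating morphisms from \<open>y Z\<close> are elements of
  \<open>M\<close> at \<open>Z\<close>.\<close>

lemma limit_elements:
  assumes lim: "is_limit J (PE T) D M p" and D: "is_functor J (PE T) D"
    and Z: "Z \<in> ob C" and d: "\<And>j. j \<in> ob J \<Longrightarrow> d j \<in> fob (fob D j) Z"
    and compat: "\<And>i j u. \<lbrakk>i \<in> ob J; j \<in> ob J; u \<in> hom J i j\<rbrakk> \<Longrightarrow> fmap D i j u Z (d i) = d j"
  shows "\<exists>!m. m \<in> fob M Z \<and> (\<forall>j\<in>ob J. p j Z m = d j)"
proof -
  have cone: "M \<in> T" "\<And>j. j \<in> ob J \<Longrightarrow> p j \<in> nt M (fob D j)"
    using lim by (auto simp: is_limit_def is_cone_def)
  have DT: "fob D j \<in> T" if "j \<in> ob J" for j using D that by (simp add: is_functor_def)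
  have Dm: "fmap D i j u \<in> nt (fob D i) (fob D j)" if "i \<in> ob J" "j \<in> ob J" "u \<in> hom J i j" for i j u
    using D that by (simp add: is_functor_def)
  note P = psh_T[OF cone(1)] psh_T[OF DT] psh_y[OF Z] yelt_in[OF psh_T[OF DT] Z d]
  let ?q = "\<lambda>j. yelt (fob D j) Z (d j)"
  have "vcmp (y Z) (fmap D i j u) (?q i) = ?q j" if ij: "i \<in> ob J" "j \<in> ob J" "u \<in> hom J i j" for i j u
    by (rule nt_eqI[OF vcmp_in[OF P(3) P(4)[OF ij(1,1)] Dm[OF ij]] P(4)[OF ij(2,2)]])
      (use Z in \<open>simp add: nt_natural[OF Dm[OF ij]] d[OF ij(1)] compat[OF ij]\<close>)
  then have "is_cone J (PE T) D (y Z) ?q"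
    using P(4) y_T[OF Z] by (simp add: is_cone_def)
  then have ex: "\<exists>!t. t \<in> nt (y Z) M \<and> (\<forall>j\<in>ob J. vcmp (y Z) (p j) t = ?q j)"
    using lim by (simp add: is_limit_def)
  then obtain t where t: "t \<in> nt (y Z) M" "\<And>j. j \<in> ob J \<Longrightarrow> vcmp (y Z) (p j) t = ?q j" by blast
  show ?thesis
  proof (rule ex1I[of _ "t Z (ide C Z)"])
    have "p j Z (t Z (ide C Z)) = d j" if j: "j \<in> ob J" for j
      using fun_cong[OF fun_cong[OF t(2)[OF j]], of Z "ide C Z"] Z P(2)[OF j] d[OF j] by simp
    then show "t Z (ide C Z) \<in> fob M Z \<and> (\<forall>j\<in>ob J. p j Z (t Z (ide C Z)) = d j)"
      using ntD(3)[OF t(1) Z] Z by simp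
    fix m assume m: "m \<in> fob M Z \<and> (\<forall>j\<in>ob J. p j Z m = d j)"
    have "vcmp (y Z) (p j) (yelt M Z m) = ?q j" if j: "j \<in> ob J" for j
      by (rule nt_eqI[OF vcmp_in[OF P(3) yelt_in[OF P(1) Z] cone(2)[OF j]] P(4)[OF j j]])
        (use m Z j in \<open>simp_all add: nt_natural[OF cone(2)[OF j]]\<close>)
    then have "yelt M Z m = t"
      using ex t yelt_in[OF P(1) Z] m by blast
    then show "m = t Z (ide C Z)"
      using Z m P(1) by force
  qed
qed

text \<open>The mediating transformation is assembled stage by stage; its naturality comes from
  \<open>nt_by_unique_choice\<close>.\<close>

lemma limit_from_elements:
  assumes cone: "is_cone J (PE T) D M p" and D: "is_functor J (PE T) D"
    and elements: "\<And>Z d. \<lbrakk>Z \<in> ob C; \<And>j. j \<in> ob J \<Longrightarrow> d j \<in> fob (fob D j) Z;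
       \<And>i j u. \<lbrakk>i \<in> ob J; j \<in> ob J; u \<in> hom J i j\<rbrakk> \<Longrightarrow> fmap D i j u Z (d i) = d j\<rbrakk>
      \<Longrightarrow> \<exists>!m. m \<in> fob M Z \<and> (\<forall>j\<in>ob J. p j Z m = d j)"
  shows "is_limit J (PE T) D M p"
  unfolding is_limit_def
proof (intro conjI cone allI impI)
  have M: "M \<in> T" "\<And>j. j \<in> ob J \<Longrightarrow> p j \<in> nt M (fob D j)"
    using cone by (auto simp: is_cone_def)
  have DT: "fob D j \<in> T" if "j \<in> ob J" for j using D that by (simp add: is_functor_def)
  fix N q assume "is_cone J (PE T) D N q"
  then have N: "N \<in> T" "\<And>j. j \<in> ob J \<Longrightarrow> q j \<in> nt N (fob D j)"
    "\<And>i j u. \<lbrakk>i \<in> ob J; j \<in> ob J; u \<in> hom J i j\<rbrakk> \<Longrightarrow> vcmp N (fmap D i j u) (q i) = q j"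
    by (auto simp: is_cone_def)
  have ex: "\<exists>!m. m \<in> fob M Z \<and> (\<forall>j\<in>ob J. p j Z m = q j Z x)" if Zx: "Z \<in> ob C" "x \<in> fob N Z" for Z x
  proof (rule elements[OF Zx(1)])
    show "fmap D i j u Z (q i Z x) = q j Z x" if "i \<in> ob J" "j \<in> ob J" "u \<in> hom J i j" for i j u
      using fun_cong[OF fun_cong[OF N(3)[OF that]], of Z x] Zx by simp
  qed (use Zx ntD(3)[OF N(2)] in blast)
  have restrict: "\<forall>j\<in>ob J. p j Z' (fmap M Z Z' h m) = q j Z' (fmap N Z Z' h x)"
    if a: "Z \<in> ob C" "Z' \<in> ob C" "h \<in> hom C Z' Z" "x \<in> fob N Z" and m: "m \<in> fob M Z" "\<forall>j\<in>ob J. p j Z m = q j Z x"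
    for Z Z' h x m
    using nt_natural[OF M(2) a(1-3) m(1)] nt_natural[OF N(2) a] m(2) by simp
  have "\<exists>!h. h \<in> nt N M \<and> (\<forall>Z\<in>ob C. \<forall>x\<in>fob N Z. \<forall>j\<in>ob J. p j Z (h Z x) = q j Z x)"
    by (rule nt_by_unique_choice[OF psh_T[OF N(1)] psh_T[OF M(1)] ex restrict])
  moreover have "(\<forall>j\<in>ob J. vcmp N (p j) h = q j) \<longleftrightarrow> (\<forall>Z\<in>ob C. \<forall>x\<in>fob N Z. \<forall>j\<in>ob J. p j Z (h Z x) = q j Z x)"
    if "h \<in> nt N M" for h
    using vcmp_eq_iff[OF psh_T[OF N(1)] that M(2) N(2)] by blast
  ultimately show "\<exists>!h. h \<in> hom (PE T) N M \<and> (\<forall>j\<in>ob J. cmp (PE T) N M (fob D j) (p j) h = q j)"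
    by (simp cong: conj_cong)
qed

lemma pullback_elements:
  assumes pb: "is_pullback (PE T) F G H f g P p q" and T: "F \<in> T" "G \<in> T" "H \<in> T"
    and fg: "f \<in> nt F H" "g \<in> nt G H"
    and Z: "Z \<in> ob C" "a \<in> fob F Z" "b \<in> fob G Z" "f Z a = g Z b"
  obtains m where "m \<in> fob P Z" "p Z m = a" "q Z m = b"
proof -
  note ps = psh_T[OF T(1)] psh_T[OF T(2)] psh_y[OF Z(1)]
  note el = yelt_in[OF ps(1) Z(1,2)] yelt_in[OF ps(2) Z(1,3)]
  have "vcmp (y Z) f (yelt F Z a) = vcmp (y Z) g (yelt G Z b)"
    by (rule nt_eqI[OF vcmp_in[OF ps(3) el(1) fg(1)] vcmp_in[OF ps(3) el(2) fg(2)]])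
      (use Z in \<open>simp add: nt_natural[OF fg(1)] nt_natural[OF fg(2)]\<close>)
  then have "\<exists>!h. h \<in> nt (y Z) P \<and> vcmp (y Z) p h = yelt F Z a \<and> vcmp (y Z) q h = yelt G Z b"
    using pb y_T[OF Z(1)] el by (simp add: is_pullback_def)
  then obtain h where h: "h \<in> nt (y Z) P" "vcmp (y Z) p h = yelt F Z a" "vcmp (y Z) q h = yelt G Z b"
    by blast
  have "h Z (ide C Z) \<in> fob P Z" using ntD(3)[OF h(1) Z(1)] Z by simp
  moreover have "p Z (h Z (ide C Z)) = a" "q Z (h Z (ide C Z)) = b"
    using fun_cong[OF fun_cong[OF h(2)], of Z "ide C Z"] fun_cong[OF fun_cong[OF h(3)], of Z "ide C Z"]
      Z ps by simp_all
  ultimately show thesis using that by blast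
qed

lemma pullback_from_elements:
  assumes T: "P \<in> T" "F \<in> T" "G \<in> T" "H \<in> T"
    and f: "f \<in> nt F H" and g: "g \<in> nt G H" and p: "p \<in> nt P F" and q: "q \<in> nt P G"
    and comm: "\<And>Z m. \<lbrakk>Z \<in> ob C; m \<in> fob P Z\<rbrakk> \<Longrightarrow> f Z (p Z m) = g Z (q Z m)"
    and elements: "\<And>Z a b. \<lbrakk>Z \<in> ob C; a \<in> fob F Z; b \<in> fob G Z; f Z a = g Z b\<rbrakk>
       \<Longrightarrow> \<exists>!m. m \<in> fob P Z \<and> p Z m = a \<and> q Z m = b"
  shows "is_pullback (PE T) F G H f g P p q"
proof -
  have "vcmp P f p = vcmp P g q"
    by (rule nt_eqI[OF vcmp_in[OF psh_T[OF T(1)] p f] vcmp_in[OF psh_T[OF T(1)] q g]]) (simp add: comm)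
  moreover have "\<exists>!h. h \<in> nt N P \<and> vcmp N p h = u \<and> vcmp N q h = v"
    if N: "N \<in> T" and u: "u \<in> nt N F" and v: "v \<in> nt N G" and eq: "vcmp N f u = vcmp N g v" for N u v
  proof -
    have ex: "\<exists>!m. m \<in> fob P Z \<and> p Z m = u Z x \<and> q Z m = v Z x" if Zx: "Z \<in> ob C" "x \<in> fob N Z" for Z x
      by (rule elements[OF Zx(1) ntD(3)[OF u Zx] ntD(3)[OF v Zx]])
        (use fun_cong[OF fun_cong[OF eq], of Z x] Zx in simp)
    have restrict: "p Z' (fmap P Z Z' h m) = u Z' (fmap N Z Z' h x) \<and> q Z' (fmap P Z Z' h m) = v Z' (fmap N Z Z' h x)"
      if a: "Z \<in> ob C" "Z' \<in> ob C" "h \<in> hom C Z' Z" "x \<in> fob N Z" and m: "m \<in> fob P Z" "p Z m = u Z x \<and> q Z m = v Z x"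
      for Z Z' h x m
      using nt_natural[OF p a(1-3) m(1)] nt_natural[OF q a(1-3) m(1)] nt_natural[OF u a] nt_natural[OF v a] m(2)
      by simp
    have "\<exists>!h. h \<in> nt N P \<and> (\<forall>Z\<in>ob C. \<forall>x\<in>fob N Z. p Z (h Z x) = u Z x \<and> q Z (h Z x) = v Z x)"
      by (rule nt_by_unique_choice[OF psh_T[OF N] psh_T[OF T(1)] ex restrict])
    moreover have "vcmp N p h = u \<and> vcmp N q h = v \<longleftrightarrow>
        (\<forall>Z\<in>ob C. \<forall>x\<in>fob N Z. p Z (h Z x) = u Z x \<and> q Z (h Z x) = v Z x)" if "h \<in> nt N P" for h
      using vcmp_eq_iff[OF psh_T[OF N] that p u] vcmp_eq_iff[OF psh_T[OF N] that q v] by blast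
    ultimately show ?thesis by (simp cong: conj_cong)
  qed
  ultimately show ?thesis
    using T f g p q by (simp add: is_pullback_def)
qed

text \<open>A compatible family of elements at \<open>Z\<close> in the diagram of representables is
  literally a cone over \<open>D\<close> with vertex \<open>Z\<close>, so pointwise universality is
  the universality of \<open>L\<close>.\<close>

lemma yoneda_limit:
  assumes D: "is_functor J C D" and lim: "is_limit J C D L p"
  shows "is_limit J (PE T) (func_comp (yoneda C) D) (y L) (\<lambda>j. yoneda_map C L (fob D j) (p j))"
proof -
  have Dob: "fob D j \<in> ob C" if "j \<in> ob J" for j using D that by (simp add: is_functor_def)
  have Dhom: "fmap D i j u \<in> hom C (fob D i) (fob D j)" if "i \<in> ob J" "j \<in> ob J" "u \<in> hom J i j" for i j u
    using D that by (simp add: is_functor_def)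
  have L: "L \<in> ob C" "\<And>j. j \<in> ob J \<Longrightarrow> p j \<in> hom C L (fob D j)"
    "\<And>i j u. \<lbrakk>i \<in> ob J; j \<in> ob J; u \<in> hom J i j\<rbrakk> \<Longrightarrow> cmp C L (fob D i) (fob D j) (fmap D i j u) (p i) = p j"
    using lim by (auto simp: is_limit_def is_cone_def)
  note Y = is_functor_yoneda[OF T_psh T_y]
  have F: "is_functor J (PE T) (func_comp (yoneda C) D)"
    using D Y by (simp add: is_functor_def func_comp_def)
  have "fmap (yoneda C) L (fob D j) (cmp C L (fob D i) (fob D j) (fmap D i j u) (p i)) =
      vcmp (y L) (yoneda_map C (fob D i) (fob D j) (fmap D i j u)) (yoneda_map C L (fob D i) (p i))"
    if ij: "i \<in> ob J" "j \<in> ob J" "u \<in> hom J i j" for i j u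
  proof -
    have "fmap (yoneda C) L (fob D j) (cmp C L (fob D i) (fob D j) (fmap D i j u) (p i)) =
      cmp (PE T) (fob (yoneda C) L) (fob (yoneda C) (fob D i)) (fob (yoneda C) (fob D j))
       (fmap (yoneda C) (fob D i) (fob D j) (fmap D i j u)) (fmap (yoneda C) L (fob D i) (p i))"
      using Y L(1) L(2)[OF ij(1)] Dob[OF ij(1)] Dob[OF ij(2)] Dhom[OF ij] unfolding is_functor_def by blast
    then show ?thesis by (simp add: yoneda_def)
  qed
  then have cone: "is_cone J (PE T) (func_comp (yoneda C) D) (y L) (\<lambda>j. yoneda_map C L (fob D j) (p j))"
    using L y_T[OF L(1)] Dob yoneda_map_in by (simp add: is_cone_def func_comp_def yoneda_def)
  show ?thesis
  proof (rule limit_from_elements[OF cone F])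
    fix Z d
    assume Z: "Z \<in> ob C" and d: "\<And>j. j \<in> ob J \<Longrightarrow> d j \<in> fob (fob (func_comp (yoneda C) D) j) Z"
      and compat: "\<And>i j u. \<lbrakk>i \<in> ob J; j \<in> ob J; u \<in> hom J i j\<rbrakk> \<Longrightarrow> fmap (func_comp (yoneda C) D) i j u Z (d i) = d j"
    have d': "d j \<in> hom C Z (fob D j)" if "j \<in> ob J" for j
      using d[OF that] by (simp add: func_comp_def yoneda_def)
    have "cmp C Z (fob D i) (fob D j) (fmap D i j u) (d i) = d j"
      if "i \<in> ob J" "j \<in> ob J" "u \<in> hom J i j" for i j u
      using compat[OF that] Z d'[OF that(1)] by (simp add: func_comp_def yoneda_def)
    then have "is_cone J C D Z d"
      using Z d' by (simp add: is_cone_def)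
    then have "\<exists>!h. h \<in> hom C Z L \<and> (\<forall>j\<in>ob J. cmp C Z L (fob D j) (p j) h = d j)"
      using lim by (simp add: is_limit_def)
    moreover have "(m \<in> fob (y L) Z \<and> (\<forall>j\<in>ob J. yoneda_map C L (fob D j) (p j) Z m = d j)) \<longleftrightarrow>
      (m \<in> hom C Z L \<and> (\<forall>j\<in>ob J. cmp C Z L (fob D j) (p j) m = d j))" for m
      using Z by auto
    ultimately show "\<exists>!m. m \<in> fob (y L) Z \<and> (\<forall>j\<in>ob J. yoneda_map C L (fob D j) (p j) Z m = d j)"
      by simp
  qed
qed

lemma lex_functor_yoneda: "lex_functor C (PE T) (yoneda C)"
  unfolding lex_functor_def
proof (intro conjI allI impI is_functor_yoneda T_psh T_y)
  show "is_limit J (PE T) (func_comp (yoneda C) D) (fob (yoneda C) L) (\<lambda>j. fmap (yoneda C) L (fob D j) (p j))"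
    if "is_functor J C D" "is_limit J C D L p" for J :: "(nat, nat) cat" and D L p
    using yoneda_limit[OF that] by (simp add: yoneda_def)
qed

end

section \<open>Images of presheaves and small presheaves\<close>

lemma universe_Cinfinite: "universe \<kappa> \<Longrightarrow> Cinfinite \<kappa>"
  unfolding universe_def using cinfinite_mono[OF ordLess_imp_ordLeq natLeq_cinfinite] by blast

lemma small_finite:
  assumes "universe \<kappa>" "finite A"
  shows "small \<kappa> A"
  using universe_Cinfinite[OF assms(1)] assms(2)
  finite_ordLess_infinite[OF card_of_Well_order[of A] card_order_on_well_order_on, of \<kappa>]
  unfolding small_def cinfinite_def by (simp add: Field_card_of)

lemma small_Un:
  assumes "universe \<kappa>" "small \<kappa> A" "small \<kappa> B"
  shows "small \<kappa> (A \<union> B)"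
  using universe_Cinfinite[OF assms(1)] assms(2,3)
  unfolding small_def cinfinite_def by (intro card_of_Un_ordLess_infinite_Field) blast+

text \<open>The closure conditions speak of every colimit, while the constructions produce one
  particular image; repleteness together with this comparison bridges the two.\<close>

lemma weighted_colimit_isomorphic:
  assumes E: "category E" and D: "\<And>k. k \<in> ob K \<Longrightarrow> fob D k \<in> ob E"
    and L: "is_weighted_colimit K \<phi> E D L \<eta>" and M: "is_weighted_colimit K \<phi> E D M \<theta>"
  shows "isomorphic E L M"
proof -
  interpret cat E using E by unfold_locales
  have cocone: "weighted_cocone K \<phi> E D L \<eta>" "weighted_cocone K \<phi> E D M \<theta>"
    using L M by (simp_all add: is_weighted_colimit_def)
  then have ob: "L \<in> ob E" "M \<in> ob E"
    and in_L: "\<And>k x. k \<in> ob K \<Longrightarrow> x \<in> fob \<phi> k \<Longrightarrow> \<eta> k x \<in> hom E (fob D k) L"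
    and in_M: "\<And>k x. k \<in> ob K \<Longrightarrow> x \<in> fob \<phi> k \<Longrightarrow> \<theta> k x \<in> hom E (fob D k) M"
    by (simp_all add: weighted_cocone_def)
  obtain h where h: "h \<in> hom E L M" "\<And>k x. k \<in> ob K \<Longrightarrow> x \<in> fob \<phi> k \<Longrightarrow> cmp E (fob D k) L M h (\<eta> k x) = \<theta> k x"
    using L cocone(2) unfolding is_weighted_colimit_def by metis
  obtain g where g: "g \<in> hom E M L" "\<And>k x. k \<in> ob K \<Longrightarrow> x \<in> fob \<phi> k \<Longrightarrow> cmp E (fob D k) M L g (\<theta> k x) = \<eta> k x"
    using M cocone(1) unfolding is_weighted_colimit_def by metis
  \<comment> \<open>An endomorphism of a colimit that fixes its cocone is the identity. It is stated
    symmetrically so as to cover both composites.\<close>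
  have endo: "cmp E A B A v u = ide E A"
    if A: "is_weighted_colimit K \<phi> E D A \<alpha>" and ob: "A \<in> ob E" "B \<in> ob E"
      and in_A: "\<And>k x. k \<in> ob K \<Longrightarrow> x \<in> fob \<phi> k \<Longrightarrow> \<alpha> k x \<in> hom E (fob D k) A"
      and u: "u \<in> hom E A B" "\<And>k x. k \<in> ob K \<Longrightarrow> x \<in> fob \<phi> k \<Longrightarrow> cmp E (fob D k) A B u (\<alpha> k x) = \<beta> k x"
      and v: "v \<in> hom E B A" "\<And>k x. k \<in> ob K \<Longrightarrow> x \<in> fob \<phi> k \<Longrightarrow> cmp E (fob D k) B A v (\<beta> k x) = \<alpha> k x"
    for A B \<alpha> \<beta> u v
  proof -
    have "cmp E (fob D k) A A (cmp E A B A v u) (\<alpha> k x) = \<alpha> k x" if "k \<in> ob K" "x \<in> fob \<phi> k" for k x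
      using cmp_assoc[OF D[OF that(1)] ob(1,2,1) in_A[OF that] u(1) v(1)] u(2)[OF that] v(2)[OF that] by simp
    moreover have "cmp E (fob D k) A A (ide E A) (\<alpha> k x) = \<alpha> k x" if "k \<in> ob K" "x \<in> fob \<phi> k" for k x
      using D[OF that(1)] ob in_A[OF that] by simp
    moreover have "\<exists>!l. l \<in> hom E A A \<and> (\<forall>k\<in>ob K. \<forall>x\<in>fob \<phi> k. cmp E (fob D k) A A l (\<alpha> k x) = \<alpha> k x)"
      using A by (simp add: is_weighted_colimit_def)
    moreover have "cmp E A B A v u \<in> hom E A A" "ide E A \<in> hom E A A"
      using ob u(1) v(1) by simp_all
    ultimately show ?thesis by blast
  qed
  have "cmp E L M L g h = ide E L" by (rule endo[OF L ob in_L h g])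
  moreover have "cmp E M L M h g = ide E M" by (rule endo[OF M ob(2,1) in_M g h])
  ultimately show ?thesis
    using h(1) g(1) unfolding isomorphic_def iso_in_def by blast
qed

context presheaves
begin

definition surj_nt :: "('o, 'u) presheaf \<Rightarrow> ('o, 'u) presheaf \<Rightarrow> ('o \<Rightarrow> 'u \<Rightarrow> 'u) \<Rightarrow> bool" where
  "surj_nt F H c \<longleftrightarrow> (\<forall>Z\<in>ob C. \<forall>z\<in>fob H Z. \<exists>x\<in>fob F Z. c Z x = z)"

definition inj_nt :: "('o, 'u) presheaf \<Rightarrow> ('o \<Rightarrow> 'u \<Rightarrow> 'u) \<Rightarrow> bool" where
  "inj_nt F n \<longleftrightarrow> (\<forall>Z\<in>ob C. inj_on (n Z) (fob F Z))"

lemma surj_ntE: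
  assumes "surj_nt F H c" "Z \<in> ob C" "z \<in> fob H Z"
  obtains x where "x \<in> fob F Z" "c Z x = z"
  using assms unfolding surj_nt_def by blast

lemma inj_ntD: "\<lbrakk>inj_nt F n; Z \<in> ob C; x \<in> fob F Z; x' \<in> fob F Z; n Z x = n Z x'\<rbrakk> \<Longrightarrow> x = x'"
  unfolding inj_nt_def inj_on_def by blast

lemma surj_nt_cancel:
  assumes "surj_nt F H c" "t \<in> nt H G" "t' \<in> nt H G"
    and "\<And>Z x. Z \<in> ob C \<Longrightarrow> x \<in> fob F Z \<Longrightarrow> t Z (c Z x) = t' Z (c Z x)"
  shows "t = t'"
proof (rule nt_eqI[OF assms(2,3)])
  fix Z z assume Z: "Z \<in> ob C" "z \<in> fob H Z"
  obtain x where "x \<in> fob F Z" "c Z x = z" using surj_ntE[OF assms(1) Z] by blast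
  then show "t Z z = t' Z z" using assms(4)[OF Z(1)] by blast
qed

text \<open>A pointwise surjection is the quotient by its fibres. The relation \<open>?P\<close> is
  the graph of the factorisation; \<open>eq\<close> makes it single-valued.\<close>

lemma factor_through_surj:
  assumes F: "psh F" and H: "psh H" and G: "psh G" and c: "c \<in> nt F H" "surj_nt F H c"
    and \<alpha>: "\<alpha> \<in> nt F G"
    and eq: "\<And>Z x x'. \<lbrakk>Z \<in> ob C; x \<in> fob F Z; x' \<in> fob F Z; c Z x = c Z x'\<rbrakk> \<Longrightarrow> \<alpha> Z x = \<alpha> Z x'"
  obtains t where "t \<in> nt H G" "\<And>Z x. Z \<in> ob C \<Longrightarrow> x \<in> fob F Z \<Longrightarrow> t Z (c Z x) = \<alpha> Z x"
proof -
  let ?P = "\<lambda>Z z w. \<exists>x\<in>fob F Z. c Z x = z \<and> \<alpha> Z x = w"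
  have "\<exists>!t. t \<in> nt H G \<and> (\<forall>Z\<in>ob C. \<forall>z\<in>fob H Z. ?P Z z (t Z z))"
  proof (rule nt_by_unique_choice[OF H G])
    fix Z z assume Z: "Z \<in> ob C" "z \<in> fob H Z"
    obtain x where x: "x \<in> fob F Z" "c Z x = z" using surj_ntE[OF c(2) Z] by blast
    show "\<exists>!w. w \<in> fob G Z \<and> ?P Z z w"
    proof (rule ex1I[of _ "\<alpha> Z x"])
      show "\<alpha> Z x \<in> fob G Z \<and> ?P Z z (\<alpha> Z x)" using x ntD(3)[OF \<alpha> Z(1) x(1)] by blast
      fix w assume "w \<in> fob G Z \<and> ?P Z z w"
      then obtain x' where x': "x' \<in> fob F Z" "c Z x' = z" "\<alpha> Z x' = w" by blast
      show "w = \<alpha> Z x" using eq[OF Z(1) x'(1) x(1)] x(2) x'(2,3) by simp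
    qed
  next
    fix Z Z' h z w assume a: "Z \<in> ob C" "Z' \<in> ob C" "h \<in> hom C Z' Z" and "?P Z z w"
    then obtain x where x: "x \<in> fob F Z" "c Z x = z" "\<alpha> Z x = w" by blast
    show "?P Z' (fmap H Z Z' h z) (fmap G Z Z' h w)"
      by (rule bexI[OF _ psh_in[OF F a x(1)]]) (simp add: nt_natural[OF c(1) a x(1)] nt_natural[OF \<alpha> a x(1)] x(2,3))
  qed
  then obtain t where t: "t \<in> nt H G" "\<And>Z z. \<lbrakk>Z \<in> ob C; z \<in> fob H Z\<rbrakk> \<Longrightarrow> ?P Z z (t Z z)" by blast
  have "t Z (c Z x) = \<alpha> Z x" if Z: "Z \<in> ob C" "x \<in> fob F Z" for Z x
  proof -
    obtain x' where x': "x' \<in> fob F Z" "c Z x' = c Z x" "\<alpha> Z x' = t Z (c Z x)"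
      using t(2)[OF Z(1) ntD(3)[OF c(1) Z]] by blast
    show ?thesis using eq[OF Z(1) x'(1) Z(2) x'(2)] x'(3) by simp
  qed
  then show thesis using that t(1) by blast
qed

definition subpsh :: "('o, 'u) presheaf \<Rightarrow> ('o \<Rightarrow> 'u \<Rightarrow> bool) \<Rightarrow> ('o, 'u) presheaf" where
  "subpsh G P = \<lparr>fob = (\<lambda>Z. {z \<in> fob G Z. P Z z}),
     fmap = (\<lambda>Z Z' h. \<lambda>z\<in>{z \<in> fob G Z. P Z z}. fmap G Z Z' h z)\<rparr>"

lemma subpsh:
  assumes G: "psh G"
    and P: "\<And>Z Z' h z. \<lbrakk>Z \<in> ob C; Z' \<in> ob C; h \<in> hom C Z' Z; z \<in> fob G Z; P Z z\<rbrakk> \<Longrightarrow> P Z' (fmap G Z Z' h z)"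
  shows "psh (subpsh G P)" "mknt (subpsh G P) (\<lambda>Z z. z) \<in> nt (subpsh G P) G"
proof -
  show *: "psh (subpsh G P)"
  proof (rule pshI)
    fix Z assume "Z \<in> ob C"
    then show "small \<kappa> (fob (subpsh G P) Z)"
      using small_subset[OF psh_small[OF G]] by (simp add: subpsh_def)
  qed (use G P psh_cmp[OF G] in \<open>simp_all add: subpsh_def\<close>)
  show "mknt (subpsh G P) (\<lambda>Z z. z) \<in> nt (subpsh G P) G"
    by (rule mknt_in[OF *]) (simp_all add: subpsh_def)
qed

text \<open>The image is cut out of \<open>G\<close> instead of being formed as a quotient of
  \<open>F\<close>, so its values are subsets of small sets and remain of type
  \<open>'u set\<close>.\<close>

lemma image_factorisation:
  assumes F: "psh F" and G: "psh G" and f: "f \<in> nt F G"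
  obtains H c n where "psh H" "c \<in> nt F H" "n \<in> nt H G" "surj_nt F H c" "inj_nt H n"
    "\<And>Z x. Z \<in> ob C \<Longrightarrow> x \<in> fob F Z \<Longrightarrow> n Z (c Z x) = f Z x"
proof -
  define P where "P Z z \<longleftrightarrow> (\<exists>x\<in>fob F Z. f Z x = z)" for Z z
  let ?H = "subpsh G P"
  have P: "P Z' (fmap G Z Z' h z)"
    if "Z \<in> ob C" "Z' \<in> ob C" "h \<in> hom C Z' Z" "P Z z" for Z Z' h z
    using that nt_natural[OF f that(1-3)] psh_in[OF F that(1-3)] unfolding P_def by metis
  note H = subpsh[of G P, OF G P]
  have HZ: "fob ?H Z = {z \<in> fob G Z. P Z z}" for Z by (simp add: subpsh_def)
  have fH: "f Z x \<in> fob ?H Z" if "Z \<in> ob C" "x \<in> fob F Z" for Z x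
    using that ntD(3)[OF f] unfolding HZ P_def by blast
  have "mknt F f \<in> nt F ?H"
  proof (rule mknt_in[OF F fH])
    fix Z Z' h x assume a: "Z \<in> ob C" "Z' \<in> ob C" "h \<in> hom C Z' Z" "x \<in> fob F Z"
    then show "f Z' (fmap F Z Z' h x) = fmap ?H Z Z' h (f Z x)"
      using fH[OF a(1,4)] nt_natural[OF f a] by (simp add: subpsh_def)
  qed
  moreover have "surj_nt F ?H (mknt F f)"
    unfolding surj_nt_def HZ P_def by simp
  moreover have "inj_nt ?H (mknt ?H (\<lambda>Z z. z))"
    by (simp add: inj_nt_def inj_on_def)
  ultimately show thesis
    using that[OF H(1) _ H(2)] fH by simp
qed

text \<open>The coequaliser is known only by its universal property. Testing it against the
  pointwise image of \<open>c\<close> gives surjectivity, and testing it against the pointwise image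
  of \<open>f\<close> shows that \<open>c\<close> identifies no more than \<open>f\<close>
  does.\<close>

lemma coequaliser_of_kernel_pair_elements:
  assumes kp: "is_kernel_pair (presheaf_cat \<kappa> C) F G f R p q" and co: "is_coequaliser (presheaf_cat \<kappa> C) R F p q H c"
    and F: "psh F" and G: "psh G" and f: "f \<in> nt F G"
  shows "c \<in> nt F H" "surj_nt F H c"
    and "\<And>Z x x'. \<lbrakk>Z \<in> ob C; x \<in> fob F Z; x' \<in> fob F Z\<rbrakk> \<Longrightarrow> c Z x = c Z x' \<longleftrightarrow> f Z x = f Z x'"
proof -
  let ?T = "{F. psh F}"
  interpret presheaf_subcat C \<kappa> ?T
    by unfold_locales (auto simp: psh_y)
  have pb: "is_pullback (PE ?T) F F G f f R p q"
    using kp by (simp add: is_kernel_pair_def presheaf_cat_PE)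
  have co': "is_coequaliser (PE ?T) R F p q H c" using co by (simp add: presheaf_cat_PE)
  have R: "psh R" "p \<in> nt R F" "q \<in> nt R F" "vcmp R f p = vcmp R f q"
    using pb by (simp_all add: is_pullback_def)
  have H: "psh H" and c: "c \<in> nt F H" and cpq: "vcmp R c p = vcmp R c q"
    using co' by (simp_all add: is_coequaliser_def)
  have univ: "\<exists>!h. h \<in> nt H A \<and> vcmp F h c = a" if "psh A" "a \<in> nt F A" "vcmp R a p = vcmp R a q" for A a
    using co' that by (simp add: is_coequaliser_def)
  have fpq: "f Z (p Z r) = f Z (q Z r)" "c Z (p Z r) = c Z (q Z r)" if "Z \<in> ob C" "r \<in> fob R Z" for Z r
    using fun_cong[OF fun_cong[OF R(4)], of Z r] fun_cong[OF fun_cong[OF cpq], of Z r] that by simp_all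
  \<comment> \<open>A pointwise mono reflects equality, so \<open>a\<close> equalises
    \<open>p\<close> and \<open>q\<close> as soon as \<open>m\<close> after \<open>a\<close> does,
    and then descends to \<open>H\<close>. This is used for the images of \<open>c\<close> and of
    \<open>f\<close>.\<close>
  have factor: thesis
    if A: "psh A" "a \<in> nt F A" "inj_nt A m" and m: "\<And>Z x. \<lbrakk>Z \<in> ob C; x \<in> fob F Z\<rbrakk> \<Longrightarrow> m Z (a Z x) = g Z x"
      and g: "\<And>Z r. \<lbrakk>Z \<in> ob C; r \<in> fob R Z\<rbrakk> \<Longrightarrow> g Z (p Z r) = g Z (q Z r)"
      and thesis: "\<And>h. \<lbrakk>h \<in> nt H A; vcmp F h c = a\<rbrakk> \<Longrightarrow> thesis" for A a m g thesis
  proof -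
    have "vcmp R a p = vcmp R a q"
    proof (rule nt_eqI[OF vcmp_in[OF R(1,2) A(2)] vcmp_in[OF R(1,3) A(2)]])
      fix Z r assume Zr: "Z \<in> ob C" "r \<in> fob R Z"
      note pr = ntD(3)[OF R(2) Zr] ntD(3)[OF R(3) Zr]
      have "a Z (p Z r) = a Z (q Z r)"
        by (rule inj_ntD[OF A(3) Zr(1)]) (use Zr pr g[OF Zr] m ntD(3)[OF A(2)] in simp_all)
      then show "vcmp R a p Z r = vcmp R a q Z r" using Zr by simp
    qed
    then show thesis using univ[OF A(1,2)] thesis by blast
  qed
  show "c \<in> nt F H" by (rule c)
  show "surj_nt F H c"
  proof -
    obtain H1 c1 n1 where 1: "psh H1" "c1 \<in> nt F H1" "n1 \<in> nt H1 H" "surj_nt F H1 c1" "inj_nt H1 n1"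
      "\<And>Z x. Z \<in> ob C \<Longrightarrow> x \<in> fob F Z \<Longrightarrow> n1 Z (c1 Z x) = c Z x"
      using image_factorisation[OF F H c] by blast
    obtain h where h: "h \<in> nt H H1" "vcmp F h c = c1"
      by (rule factor[OF 1(1,2,5) 1(6) fpq(2)])
    have hc: "h Z (c Z x) = c1 Z x" if "Z \<in> ob C" "x \<in> fob F Z" for Z x
      using fun_cong[OF fun_cong[OF h(2)], of Z x] that by simp
    have "vcmp F (vcmp H n1 h) c = c"
      by (rule nt_eqI[OF vcmp_in[OF F c vcmp_in[OF H h(1) 1(3)]] c])
        (simp add: hc 1(6) ntD(3)[OF c])
    moreover have "vcmp F (mknt H (\<lambda>Z z. z)) c = c"
      by (rule nt_eqI[OF vcmp_in[OF F c ide_in[OF H]] c]) (simp add: ntD(3)[OF c])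
    \<comment> \<open>Both endomorphisms of \<open>H\<close> restrict to \<open>c\<close> along
      \<open>c\<close>. Hence the inclusion \<open>n1\<close> of the image of \<open>c\<close> has a
      section and is pointwise onto.\<close>
    ultimately have n1h: "vcmp H n1 h = mknt H (\<lambda>Z z. z)"
      using univ[OF H c cpq] vcmp_in[OF H h(1) 1(3)] ide_in[OF H] by blast
    have "\<exists>x\<in>fob F Z. c Z x = z" if Zz: "Z \<in> ob C" "z \<in> fob H Z" for Z z
    proof -
      obtain x where x: "x \<in> fob F Z" "c1 Z x = h Z z"
        using surj_ntE[OF 1(4) Zz(1) ntD(3)[OF h(1) Zz]] by blast
      then have "c Z x = n1 Z (h Z z)" using 1(6)[OF Zz(1) x(1)] by simp
      then show ?thesis
        using x fun_cong[OF fun_cong[OF n1h], of Z z] Zz by auto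
    qed
    then show ?thesis by (simp add: surj_nt_def)
  qed
  fix Z x x' assume Z: "Z \<in> ob C" "x \<in> fob F Z" "x' \<in> fob F Z"
  show "c Z x = c Z x' \<longleftrightarrow> f Z x = f Z x'"
  proof
    \<comment> \<open>As \<open>c0\<close> factors through \<open>c\<close>, equality under
      \<open>c\<close> implies equality under \<open>c0\<close>, and so under
      \<open>f\<close>.\<close>
    obtain H0 c0 n0 where 0: "psh H0" "c0 \<in> nt F H0" "n0 \<in> nt H0 G" "surj_nt F H0 c0" "inj_nt H0 n0"
      "\<And>Z x. Z \<in> ob C \<Longrightarrow> x \<in> fob F Z \<Longrightarrow> n0 Z (c0 Z x) = f Z x"
      using image_factorisation[OF F G f] by blast
    obtain h where h: "h \<in> nt H H0" "vcmp F h c = c0"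
      by (rule factor[OF 0(1,2,5) 0(6) fpq(1)])
    assume "c Z x = c Z x'"
    then have "c0 Z x = c0 Z x'"
      using fun_cong[OF fun_cong[OF h(2)], of Z x] fun_cong[OF fun_cong[OF h(2)], of Z x'] Z by simp
    then show "f Z x = f Z x'"
      using 0(6)[OF Z(1,2)] 0(6)[OF Z(1,3)] by simp
  next
    assume "f Z x = f Z x'"
    then obtain r where "r \<in> fob R Z" "p Z r = x" "q Z r = x'"
      using pullback_elements[OF pb _ _ _ f f Z] F G by blast
    then show "c Z x = c Z x'" using fpq(2)[OF Z(1)] by metis
  qed
qed

section \<open>Small presheaves as Kan extensions from a set of objects\<close>

definition partial_nt :: "'o set \<Rightarrow> ('o, 'u) presheaf \<Rightarrow> ('o, 'u) presheaf \<Rightarrow> ('o \<Rightarrow> 'u \<Rightarrow> 'u) \<Rightarrow> bool" where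
  "partial_nt S F H b \<longleftrightarrow> (\<forall>Z\<in>S. \<forall>x\<in>fob F Z. b Z x \<in> fob H Z) \<and>
     (\<forall>Z\<in>S. \<forall>Z'\<in>S. \<forall>h\<in>hom C Z' Z. \<forall>x\<in>fob F Z. b Z' (fmap F Z Z' h x) = fmap H Z Z' h (b Z x))"

text \<open>The elementwise form of "\<open>F\<close> is the left Kan extension of its restriction
  to \<open>S\<close>". The family \<open>b\<close> is constrained only on \<open>S\<close> and need
  not be extensional.\<close>

definition kan :: "'o set \<Rightarrow> ('o, 'u) presheaf \<Rightarrow> bool" where
  "kan S F \<longleftrightarrow> (\<forall>H b. psh H \<longrightarrow> partial_nt S F H b \<longrightarrow>
     (\<exists>!\<alpha>. \<alpha> \<in> nt F H \<and> (\<forall>Z\<in>S. \<forall>x\<in>fob F Z. \<alpha> Z x = b Z x)))"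

lemma partial_nt_of_nt: "\<alpha> \<in> nt F H \<Longrightarrow> S \<subseteq> ob C \<Longrightarrow> partial_nt S F H \<alpha>"
  unfolding partial_nt_def
  by (intro conjI ballI) (blast intro: ntD(3), rule nt_natural, blast+)

lemma kan_unique:
  assumes "kan S F" "S \<subseteq> ob C" "psh H" "\<alpha> \<in> nt F H" "\<beta> \<in> nt F H"
    and "\<And>Z x. Z \<in> S \<Longrightarrow> x \<in> fob F Z \<Longrightarrow> \<alpha> Z x = \<beta> Z x"
  shows "\<alpha> = \<beta>"
proof -
  have "\<exists>!\<gamma>. \<gamma> \<in> nt F H \<and> (\<forall>Z\<in>S. \<forall>x\<in>fob F Z. \<gamma> Z x = \<beta> Z x)"
    using assms(1,3) partial_nt_of_nt[OF assms(5,2)] unfolding kan_def by blast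
  then show ?thesis using assms(4-6) by blast
qed

text \<open>The restriction of \<open>F\<close> is the same record read over the full subcategory on
  \<open>S\<close>, and the unit is an identity. What differs is extensionality, which
  \<open>R.mknt\<close> restores.\<close>

lemma is_left_kan_extension_iff:
  assumes S: "S \<subseteq> ob C" and F: "psh F"
  shows "is_left_kan_extension (op_cat (full_subcat C S)) (op_cat C) (set_cat \<kappa>)
          id_func (func_comp F id_func) F (\<lambda>X\<in>S. ide (set_cat \<kappa>) (fob F X)) \<longleftrightarrow> kan S F"
proof -
  \<comment> \<open>Instantiating the presheaf calculus at the full subcategory itself gives
    transformations between restrictions as \<open>R.nt\<close>.\<close>
  interpret R: presheaves "full_subcat C S" \<kappa>
    using category_full[OF S] locally_small S
    by unfold_locales (auto simp: locally_small_def full_subcat_def)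
  have R_simps [simp]: "ob (full_subcat C S) = S" "hom (full_subcat C S) = hom C"
    "ide (full_subcat C S) = ide C" "cmp (full_subcat C S) = cmp C"
    by (simp_all add: full_subcat_def)
  have id: "func_comp G id_func = G" for G :: "('o, 'u) presheaf"
    by (simp add: func_comp_def id_func_def)
  have R_psh: "R.psh G" if "psh G" for G
    by (rule R.pshI) (use that S psh_small psh_fmap psh_cmp in \<open>auto simp: subset_iff\<close>)
  have fJ: "is_functor (op_cat (full_subcat C S)) (op_cat C) id_func"
    using category_op R.category_op S
    by (simp add: is_functor_def id_func_def op_cat_def subset_iff)
  have pnt: "\<beta> \<in> R.nt F H \<Longrightarrow> partial_nt S F H \<beta>" for \<beta> H
    unfolding partial_nt_def using R.nt_natural R.ntD(3) by simp
  have pnt': "R.mknt F b \<in> R.nt F H" if "psh H" "partial_nt S F H b" for b H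
    by (rule R.mknt_in[OF R_psh[OF F]]) (use that in \<open>simp_all add: partial_nt_def\<close>)
  have \<eta>: "(\<lambda>X\<in>S. ide (set_cat \<kappa>) (fob F X)) = R.mknt F (\<lambda>Z x. x)"
    by (simp add: R.mknt_def set_cat_def)
  have agree: "(\<forall>X\<in>S. cmp (set_cat \<kappa>) (fob F X) (fob F X) (fob H X) (\<alpha> X) (R.mknt F (\<lambda>Z x. x) X) = \<beta> X)
      \<longleftrightarrow> (\<forall>Z\<in>S. \<forall>x\<in>fob F Z. \<alpha> Z x = \<beta> Z x)" if "\<beta> \<in> R.nt F H" "\<alpha> \<in> nt F H" for \<alpha> \<beta> H
  proof (intro ball_cong refl iffI)
    fix X assume X: "X \<in> S"
    let ?l = "cmp (set_cat \<kappa>) (fob F X) (fob F X) (fob H X) (\<alpha> X) (R.mknt F (\<lambda>Z x. x) X)"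
    have l: "?l x = \<alpha> X x" if "x \<in> fob F X" for x
      using that X by (simp add: set_cat_def compose_def)
    have XC: "X \<in> ob C" using X S by blast
    have "?l \<in> fob F X \<rightarrow>\<^sub>E fob H X"
      using X ntD(3)[OF that(2) XC] by (auto simp: set_cat_def compose_def)
    moreover have "\<beta> X \<in> fob F X \<rightarrow>\<^sub>E fob H X"
      using R.nt_PiE[OF that(1), of X] X by simp
    ultimately show "?l = \<beta> X" if "\<forall>x\<in>fob F X. \<alpha> X x = \<beta> X x"
      by (rule PiE_ext) (use that l in simp)
    show "\<forall>x\<in>fob F X. \<alpha> X x = \<beta> X x" if "?l = \<beta> X"
      using l that by metis
  qed
  have ex1: "(\<exists>!\<alpha>. \<alpha> \<in> nt F H \<and>
        (\<forall>X\<in>S. cmp (set_cat \<kappa>) (fob F X) (fob F X) (fob H X) (\<alpha> X) (R.mknt F (\<lambda>Z x. x) X) = \<beta> X)) \<longleftrightarrow>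
      (\<exists>!\<alpha>. \<alpha> \<in> nt F H \<and> (\<forall>Z\<in>S. \<forall>x\<in>fob F Z. \<alpha> Z x = \<beta> Z x))" if "\<beta> \<in> R.nt F H" for \<beta> H
    by (rule arg_cong[where f = Ex1], rule ext, rule conj_cong[OF refl], rule agree[OF that])
  have J: "fob id_func X = X" "ob (op_cat (full_subcat C S)) = S" for X :: 'o
    by (simp_all add: id_func_def op_cat_def)
  have "is_left_kan_extension (op_cat (full_subcat C S)) (op_cat C) (set_cat \<kappa>)
          id_func (func_comp F id_func) F (\<lambda>X\<in>S. ide (set_cat \<kappa>) (fob F X)) \<longleftrightarrow>
      (\<forall>H \<beta>. psh H \<longrightarrow> \<beta> \<in> R.nt F H \<longrightarrow>
        (\<exists>!\<alpha>. \<alpha> \<in> nt F H \<and> (\<forall>Z\<in>S. \<forall>x\<in>fob F Z. \<alpha> Z x = \<beta> Z x)))"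
    unfolding is_left_kan_extension_def id \<eta> J using fJ F R_psh[OF F] R.ide_in[OF R_psh[OF F]]
    by (simp only: ex1 simp_thms cong: imp_cong)
  also have "\<dots> \<longleftrightarrow> kan S F"
  proof
    assume K: "\<forall>H \<beta>. psh H \<longrightarrow> \<beta> \<in> R.nt F H \<longrightarrow>
        (\<exists>!\<alpha>. \<alpha> \<in> nt F H \<and> (\<forall>Z\<in>S. \<forall>x\<in>fob F Z. \<alpha> Z x = \<beta> Z x))"
    show "kan S F"
      unfolding kan_def
    proof (intro allI impI)
      fix H b assume H: "psh H" "partial_nt S F H b"
      have "\<exists>!\<alpha>. \<alpha> \<in> nt F H \<and> (\<forall>Z\<in>S. \<forall>x\<in>fob F Z. \<alpha> Z x = R.mknt F b Z x)"
        by (rule K[rule_format, OF H(1) pnt'[OF H]])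
      moreover have "R.mknt F b Z x = b Z x" if "Z \<in> S" "x \<in> fob F Z" for Z x
        using that by simp
      ultimately show "\<exists>!\<alpha>. \<alpha> \<in> nt F H \<and> (\<forall>Z\<in>S. \<forall>x\<in>fob F Z. \<alpha> Z x = b Z x)"
        by (simp cong: ball_cong)
    qed
  next
    assume K: "kan S F"
    show "\<forall>H \<beta>. psh H \<longrightarrow> \<beta> \<in> R.nt F H \<longrightarrow>
        (\<exists>!\<alpha>. \<alpha> \<in> nt F H \<and> (\<forall>Z\<in>S. \<forall>x\<in>fob F Z. \<alpha> Z x = \<beta> Z x))"
      by (intro allI impI) (rule K[unfolded kan_def, rule_format, OF _ pnt])
  qed
  finally show ?thesis .
qed

lemma small_presheaf_iff:
  "small_presheaf \<kappa> C F \<longleftrightarrow> psh F \<and> (\<exists>S\<subseteq>ob C. small \<kappa> S \<and> kan S F)"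
proof -
  have "(\<exists>S\<subseteq>ob C. small \<kappa> S \<and> is_left_kan_extension (op_cat (full_subcat C S)) (op_cat C) (set_cat \<kappa>)
          id_func (func_comp F id_func) F (\<lambda>X\<in>S. ide (set_cat \<kappa>) (fob F X))) \<longleftrightarrow>
      (\<exists>S\<subseteq>ob C. small \<kappa> S \<and> kan S F)" if F: "psh F"
    by (rule arg_cong[where f = Ex], rule ext) (use is_left_kan_extension_iff[OF _ F] in \<open>simp cong: conj_cong\<close>)
  then show ?thesis
    unfolding small_presheaf_def by (simp only: cong: conj_cong)
qed

text \<open>The elements restricted from \<open>S\<close> form a subpresheaf that agrees with
  \<open>F\<close> on \<open>S\<close>. The identity on \<open>S\<close> extends to a map from
  \<open>F\<close> into it, which by uniqueness is a section of the inclusion.\<close>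

lemma kan_generates:
  assumes F: "psh F" and S: "S \<subseteq> ob C" and kan: "kan S F" and Z: "Z \<in> ob C" "x \<in> fob F Z"
  obtains s h x' where "s \<in> S" "h \<in> hom C Z s" "x' \<in> fob F s" "x = fmap F s Z h x'"
proof -
  define P where "P Z x \<longleftrightarrow> (\<exists>s\<in>S. \<exists>h\<in>hom C Z s. \<exists>x'\<in>fob F s. x = fmap F s Z h x')" for Z x
  have P: "P Z' (fmap F Z Z' h x)" if a: "Z \<in> ob C" "Z' \<in> ob C" "h \<in> hom C Z' Z" "P Z x" for Z Z' h x
  proof -
    obtain s g x' where s: "s \<in> S" "g \<in> hom C Z s" "x' \<in> fob F s" "x = fmap F s Z g x'"
      using a(4) unfolding P_def by blast
    then have "s \<in> ob C" using S by blast
    then have "cmp C Z' Z s g h \<in> hom C Z' s" "fmap F Z Z' h x = fmap F s Z' (cmp C Z' Z s g h) x'"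
      using a s psh_cmp[OF F _ a(1,2) s(2) a(3) s(3)] by simp_all
    then show ?thesis using s unfolding P_def by blast
  qed
  let ?F' = "subpsh F P"
  note F' = subpsh[of F P, OF F P]
  have F'Z: "fob ?F' Z = {z \<in> fob F Z. P Z z}" for Z by (simp add: subpsh_def)
  have PS: "x \<in> fob ?F' s" if "s \<in> S" "x \<in> fob F s" for s x
  proof -
    have "s \<in> ob C" using S that by blast
    then have "ide C s \<in> hom C s s" "x = fmap F s s (ide C s) x" using that F by simp_all
    then show ?thesis using that unfolding F'Z P_def by blast
  qed
  have "partial_nt S F ?F' (\<lambda>Z x. x)"
    unfolding partial_nt_def using PS unfolding subpsh_def by simp
  then obtain \<alpha> where \<alpha>: "\<alpha> \<in> nt F ?F'" "\<And>Z x. Z \<in> S \<Longrightarrow> x \<in> fob F Z \<Longrightarrow> \<alpha> Z x = x"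
    using kan F'(1) unfolding kan_def by blast
  \<comment> \<open>Both sides are endomorphisms of \<open>F\<close> that are the identity on
    \<open>S\<close>.\<close>
  have eq: "vcmp F (mknt ?F' (\<lambda>Z z. z)) \<alpha> = mknt F (\<lambda>Z z. z)"
  proof (rule kan_unique[OF kan S F vcmp_in[OF F \<alpha>(1) F'(2)] ide_in[OF F]])
    fix Z x assume Zx: "Z \<in> S" "x \<in> fob F Z"
    then show "vcmp F (mknt ?F' (\<lambda>Z z. z)) \<alpha> Z x = mknt F (\<lambda>Z z. z) Z x"
      using S \<alpha>(2) PS by (simp add: subset_iff)
  qed
  have "\<alpha> Z x = x"
    using fun_cong[OF fun_cong[OF eq], of Z x] Z ntD(3)[OF \<alpha>(1) Z] by simp
  then have "P Z x" using ntD(3)[OF \<alpha>(1) Z] F'Z by simp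
  then show thesis using that unfolding P_def by blast
qed

text \<open>Every element is a restriction of one over \<open>S\<close>, so naturality propagates
  agreement from \<open>S\<close> to \<open>S'\<close>. Enlarging \<open>S\<close> lets several
  small presheaves share one set of objects.\<close>

lemma kan_mono:
  assumes F: "psh F" and kan: "kan S F" and S: "S \<subseteq> S'" "S' \<subseteq> ob C"
  shows "kan S' F"
  unfolding kan_def
proof (intro allI impI)
  have SC: "S \<subseteq> ob C" using S by blast
  fix H b assume H: "psh H" and b: "partial_nt S' F H b"
  then have "partial_nt S F H b" unfolding partial_nt_def using S by blast
  then have ex: "\<exists>!\<alpha>. \<alpha> \<in> nt F H \<and> (\<forall>Z\<in>S. \<forall>x\<in>fob F Z. \<alpha> Z x = b Z x)"
    using kan H unfolding kan_def by blast
  have eq: "(\<forall>Z\<in>S'. \<forall>x\<in>fob F Z. \<alpha> Z x = b Z x) \<longleftrightarrow> (\<forall>Z\<in>S. \<forall>x\<in>fob F Z. \<alpha> Z x = b Z x)" if \<alpha>: "\<alpha> \<in> nt F H" for \<alpha>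
  proof
    assume eq: "\<forall>Z\<in>S. \<forall>x\<in>fob F Z. \<alpha> Z x = b Z x"
    show "\<forall>Z\<in>S'. \<forall>x\<in>fob F Z. \<alpha> Z x = b Z x"
    proof (intro ballI)
      fix Z x assume Z: "Z \<in> S'" "x \<in> fob F Z"
      have ZC: "Z \<in> ob C" using S Z by blast
      obtain s h x' where s: "s \<in> S" "h \<in> hom C Z s" "x' \<in> fob F s" "x = fmap F s Z h x'"
        using kan_generates[OF F SC kan ZC Z(2)] by blast
      then have sC: "s \<in> ob C" "s \<in> S'" using S by blast+
      have "\<alpha> Z x = fmap H s Z h (b s x')"
        using nt_natural[OF \<alpha> sC(1) ZC s(2,3)] s eq by simp
      also have "\<dots> = b Z x"
        using b s sC Z unfolding partial_nt_def by simp
      finally show "\<alpha> Z x = b Z x" .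
    qed
  qed (use S in blast)
  show "\<exists>!\<alpha>. \<alpha> \<in> nt F H \<and> (\<forall>Z\<in>S'. \<forall>x\<in>fob F Z. \<alpha> Z x = b Z x)"
    using ex by (simp only: eq cong: conj_cong)
qed

text \<open>Left Kan extension commutes with coequalisers, here in elements: a family on
  \<open>S\<close> out of \<open>H\<close> is first extended to \<open>F\<close>; it equalises
  \<open>p\<close> and \<open>q\<close> by uniqueness of extensions from \<open>R\<close>, and so
  descends along \<open>c\<close>.\<close>

lemma kan_quotient:
  assumes psh: "psh F" "psh R" "psh H" and p: "p \<in> nt R F" and q: "q \<in> nt R F"
    and c: "c \<in> nt F H" "surj_nt F H c"
    and cpq: "\<And>Z r. Z \<in> ob C \<Longrightarrow> r \<in> fob R Z \<Longrightarrow> c Z (p Z r) = c Z (q Z r)"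
    and ker: "\<And>Z x x'. \<lbrakk>Z \<in> ob C; x \<in> fob F Z; x' \<in> fob F Z; c Z x = c Z x'\<rbrakk> \<Longrightarrow>
      \<exists>r\<in>fob R Z. p Z r = x \<and> q Z r = x'"
    and S: "S \<subseteq> ob C" and kan: "kan S F" "kan S R"
  shows "kan S H"
  unfolding kan_def
proof (intro allI impI)
  fix G b assume G: "psh G" and b: "partial_nt S H G b"
  have "partial_nt S F G (\<lambda>Z x. b Z (c Z x))"
    unfolding partial_nt_def
  proof (intro conjI ballI)
    fix Z x assume Z: "Z \<in> S" "x \<in> fob F Z"
    then show "b Z (c Z x) \<in> fob G Z"
      using b S ntD(3)[OF c(1)] unfolding partial_nt_def by blast
  next
    fix Z Z' h x assume Z: "Z \<in> S" "Z' \<in> S" "h \<in> hom C Z' Z" "x \<in> fob F Z"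
    then have ZC: "Z \<in> ob C" "Z' \<in> ob C" using S by blast+
    show "b Z' (c Z' (fmap F Z Z' h x)) = fmap G Z Z' h (b Z (c Z x))"
      using b Z ntD(3)[OF c(1) ZC(1) Z(4)] nt_natural[OF c(1) ZC Z(3,4)] unfolding partial_nt_def by simp
  qed
  then obtain \<alpha> where \<alpha>: "\<alpha> \<in> nt F G" "\<And>Z x. Z \<in> S \<Longrightarrow> x \<in> fob F Z \<Longrightarrow> \<alpha> Z x = b Z (c Z x)"
    using kan(1) G unfolding kan_def by blast
  have eq: "vcmp R \<alpha> p = vcmp R \<alpha> q"
  proof (rule kan_unique[OF kan(2) S G vcmp_in[OF psh(2) p \<alpha>(1)] vcmp_in[OF psh(2) q \<alpha>(1)]])
    fix Z r assume Z: "Z \<in> S" "r \<in> fob R Z"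
    then have "Z \<in> ob C" using S by blast
    then show "vcmp R \<alpha> p Z r = vcmp R \<alpha> q Z r"
      using Z \<alpha>(2)[OF Z(1)] ntD(3)[OF p] ntD(3)[OF q] cpq by simp
  qed
  have "\<alpha> Z (p Z r) = \<alpha> Z (q Z r)" if "Z \<in> ob C" "r \<in> fob R Z" for Z r
    using fun_cong[OF fun_cong[OF eq], of Z r] that by simp
  then have "\<alpha> Z x = \<alpha> Z x'" if "Z \<in> ob C" "x \<in> fob F Z" "x' \<in> fob F Z" "c Z x = c Z x'" for Z x x'
    using ker[OF that] that(1) by blast
  then obtain t where t: "t \<in> nt H G" "\<And>Z x. Z \<in> ob C \<Longrightarrow> x \<in> fob F Z \<Longrightarrow> t Z (c Z x) = \<alpha> Z x"
    using factor_through_surj[OF psh(1,3) G c \<alpha>(1)] by blast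
  have tb: "\<forall>Z\<in>S. \<forall>z\<in>fob H Z. t Z z = b Z z"
  proof (intro ballI)
    fix Z z assume Z: "Z \<in> S" "z \<in> fob H Z"
    then have ZC: "Z \<in> ob C" using S by blast
    obtain x where x: "x \<in> fob F Z" "c Z x = z" using surj_ntE[OF c(2) ZC Z(2)] by blast
    then show "t Z z = b Z z" using t(2)[OF ZC x(1)] \<alpha>(2)[OF Z(1) x(1)] by simp
  qed
  show "\<exists>!\<alpha>. \<alpha> \<in> nt H G \<and> (\<forall>Z\<in>S. \<forall>x\<in>fob H Z. \<alpha> Z x = b Z x)"
  proof (rule ex1I[of _ t])
    show "t \<in> nt H G \<and> (\<forall>Z\<in>S. \<forall>x\<in>fob H Z. t Z x = b Z x)" using t(1) tb by blast
    fix t' assume t': "t' \<in> nt H G \<and> (\<forall>Z\<in>S. \<forall>x\<in>fob H Z. t' Z x = b Z x)"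
    have "vcmp F t' c = vcmp F t c"
    proof (rule kan_unique[OF kan(1) S G vcmp_in[OF psh(1) c(1)] vcmp_in[OF psh(1) c(1) t(1)]])
      show "t' \<in> nt H G" using t' by blast
      fix Z x assume Z: "Z \<in> S" "x \<in> fob F Z"
      then have "Z \<in> ob C" using S by blast
      then show "vcmp F t' c Z x = vcmp F t c Z x"
        using Z t' tb ntD(3)[OF c(1)] by simp
    qed
    then show "t' = t"
      using surj_nt_cancel[OF c(2) conjunct1[OF t'] t(1)] vcmp_apply by metis
  qed
qed

text \<open>The one-element set \<open>{X}\<close> generates: by Yoneda a map out of
  \<open>y X\<close> is fixed by its value at the identity of \<open>X\<close>.\<close>

lemma small_presheaf_y:
  assumes u: "universe \<kappa>" and X: "X \<in> ob C"
  shows "small_presheaf \<kappa> C (y X)"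
proof -
  have "kan {X} (y X)"
    unfolding kan_def
  proof (intro allI impI)
    fix H b assume H: "psh H" and b: "partial_nt {X} (y X) H b"
    define x where "x = b X (ide C X)"
    have x: "x \<in> fob H X" using b X by (simp add: partial_nt_def x_def)
    have bf: "b X h = fmap H X X h x" if "h \<in> hom C X X" for h
    proof -
      have "b X (fmap (y X) X X h (ide C X)) = fmap H X X h x"
        using b X that unfolding partial_nt_def y_simps(1) x_def by blast
      then show ?thesis using X that by simp
    qed
    show "\<exists>!\<alpha>. \<alpha> \<in> nt (y X) H \<and> (\<forall>Z\<in>{X}. \<forall>x\<in>fob (y X) Z. \<alpha> Z x = b Z x)"
    proof (rule ex1I[of _ "yelt H X x"])
      show "yelt H X x \<in> nt (y X) H \<and> (\<forall>Z\<in>{X}. \<forall>f\<in>fob (y X) Z. yelt H X x Z f = b Z f)"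
        using yelt_in[OF H X x] X bf by simp
      fix \<alpha> assume \<alpha>: "\<alpha> \<in> nt (y X) H \<and> (\<forall>Z\<in>{X}. \<forall>x\<in>fob (y X) Z. \<alpha> Z x = b Z x)"
      have "\<alpha> X (ide C X) = x" using \<alpha> X by (simp add: x_def)
      then have "\<alpha> W h = yelt H X x W h" if "W \<in> ob C" "h \<in> hom C W X" for W h
        using nt_y[OF conjunct1[OF \<alpha>] X that] that by simp
      then show "\<alpha> = yelt H X x"
        by (intro nt_eqI[OF conjunct1[OF \<alpha>] yelt_in[OF H X x]]) simp
    qed
  qed
  moreover have "small \<kappa> {X}" by (rule small_finite[OF u]) simp
  ultimately show ?thesis
    using X psh_y[OF X] by (auto simp: small_presheaf_iff)
qed

end

section \<open>Colimits weighted by an image\<close>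

text \<open>\<open>e\<close> exhibits \<open>\<phi>\<close> as the pointwise image of \<open>K(-, f)\<close>.\<close>

definition image_weight ::
  "('k, 'l) cat \<Rightarrow> 'k \<Rightarrow> 'k \<Rightarrow> 'l \<Rightarrow> ('k, 'l, 'u set, 'u \<Rightarrow> 'u) func \<Rightarrow> ('k \<Rightarrow> 'l \<Rightarrow> 'u) \<Rightarrow> bool" where
  "image_weight K X Y f \<phi> e \<longleftrightarrow>
     (\<forall>k\<in>ob K. \<forall>a\<in>hom K k X. e k a \<in> fob \<phi> k) \<and>
     (\<forall>k\<in>ob K. \<forall>x\<in>fob \<phi> k. \<exists>a\<in>hom K k X. e k a = x) \<and>
     (\<forall>k\<in>ob K. \<forall>a\<in>hom K k X. \<forall>b\<in>hom K k X. e k a = e k b \<longleftrightarrow> cmp K k X Y f a = cmp K k X Y f b) \<and>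
     (\<forall>k\<in>ob K. \<forall>k'\<in>ob K. \<forall>u\<in>hom K k k'. \<forall>a\<in>hom K k' X.
        fmap \<phi> k' k u (e k' a) = e k (cmp K k k' X a u))"

lemma image_weightD:
  assumes "image_weight K X Y f \<phi> e"
  shows "\<lbrakk>k \<in> ob K; a \<in> hom K k X\<rbrakk> \<Longrightarrow> e k a \<in> fob \<phi> k"
    and "\<lbrakk>k \<in> ob K; x \<in> fob \<phi> k\<rbrakk> \<Longrightarrow> \<exists>a\<in>hom K k X. e k a = x"
    and "\<lbrakk>k \<in> ob K; a \<in> hom K k X; b \<in> hom K k X\<rbrakk> \<Longrightarrow>
      e k a = e k b \<longleftrightarrow> cmp K k X Y f a = cmp K k X Y f b"
    and "\<lbrakk>k \<in> ob K; k' \<in> ob K; u \<in> hom K k k'; a \<in> hom K k' X\<rbrakk> \<Longrightarrow>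
      fmap \<phi> k' k u (e k' a) = e k (cmp K k k' X a u)"
  using assms unfolding image_weight_def by blast+

context presheaf_subcat
begin

text \<open>As a quotient of \<open>K(-, X)\<close>, the weight makes a cocone with vertex
  \<open>M\<close> the same as a map \<open>t\<close> from \<open>D X\<close> to \<open>M\<close>
  that equalises the image under \<open>D\<close> of the kernel pair of \<open>f\<close>. Since
  \<open>D\<close> is lex, that image is the kernel pair of \<open>fmap D X Y f\<close>, whose
  pointwise quotient is \<open>H\<close>.\<close>

lemma image_is_weighted_colimit:
  assumes K: "category K" "finitely_complete K" and X: "X \<in> ob K" and Y: "Y \<in> ob K" and f: "f \<in> hom K X Y"
    and w: "image_weight K X Y f \<phi> e"
    and D: "lex_functor K (PE T) D"
    and H: "H \<in> T" and c: "c \<in> nt (fob D X) H" "surj_nt (fob D X) H c"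
    and n: "n \<in> nt H (fob D Y)" "inj_nt H n"
    and nc: "\<And>Z x. \<lbrakk>Z \<in> ob C; x \<in> fob (fob D X) Z\<rbrakk> \<Longrightarrow> n Z (c Z x) = fmap D X Y f Z x"
  shows "\<exists>\<eta>. is_weighted_colimit K \<phi> (PE T) D H \<eta>"
proof -
  interpret K: cat K using K(1) by unfold_locales
  note e_in = image_weightD(1)[OF w] and e_surj = image_weightD(2)[OF w]
    and e_eq = image_weightD(3)[OF w] and e_nat = image_weightD(4)[OF w]
  have fD: "is_functor K (PE T) D" using D by (simp add: lex_functor_def)
  have DT: "fob D k \<in> T" if "k \<in> ob K" for k using fD that by (simp add: is_functor_def)
  have Dp: "psh (fob D k)" if "k \<in> ob K" for k using psh_T[OF DT[OF that]] .
  have Dm: "fmap D k k' u \<in> nt (fob D k) (fob D k')" if "k \<in> ob K" "k' \<in> ob K" "u \<in> hom K k k'" for k k' u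
    using fD that by (simp add: is_functor_def)
  have Dc: "fmap D k l (cmp K k k' l v u) Z z = fmap D k' l v Z (fmap D k k' u Z z)"
    if "k \<in> ob K" "k' \<in> ob K" "l \<in> ob K" "u \<in> hom K k k'" "v \<in> hom K k' l" "Z \<in> ob C" "z \<in> fob (fob D k) Z"
    for k k' l u v Z z
  proof -
    have "fmap D k l (cmp K k k' l v u) = vcmp (fob D k) (fmap D k' l v) (fmap D k k' u)"
      using fD that(1-5) by (simp add: is_functor_def)
    then show ?thesis using that(6,7) by simp
  qed
  have Di: "fmap D k k (ide K k) Z z = z" if "k \<in> ob K" "Z \<in> ob C" "z \<in> fob (fob D k) Z" for k Z z
    using fD that by (simp add: is_functor_def)
  \<comment> \<open>A representative of the class \<open>x\<close>. Another one has the same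
    composite with \<open>f\<close>, so injectivity of \<open>n\<close> makes \<open>\<eta>\<close>
    independent of the choice; this is \<open>\<eta>_e\<close>.\<close>
  define s where "s k x = (SOME a. a \<in> hom K k X \<and> e k a = x)" for k x
  have s: "s k x \<in> hom K k X" "e k (s k x) = x" if "k \<in> ob K" "x \<in> fob \<phi> k" for k x
    using someI_ex[of "\<lambda>a. a \<in> hom K k X \<and> e k a = x"] e_surj[OF that] unfolding s_def by blast+
  define \<eta> where "\<eta> k x = vcmp (fob D k) c (fmap D k X (s k x))" for k x
  have \<eta>_in: "\<eta> k x \<in> nt (fob D k) H" if "k \<in> ob K" "x \<in> fob \<phi> k" for k x
    unfolding \<eta>_def using vcmp_in[OF Dp[OF that(1)] Dm[OF that(1) X s(1)[OF that]] c(1)] .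
  have \<eta>_e: "\<eta> k (e k a) Z z = c Z (fmap D k X a Z z)"
    if k: "k \<in> ob K" and a: "a \<in> hom K k X" and Z: "Z \<in> ob C" "z \<in> fob (fob D k) Z" for k a Z z
  proof -
    note e = e_in[OF k a]
    note sa = s[OF k e]
    have eq: "cmp K k X Y f (s k (e k a)) = cmp K k X Y f a"
      using e_eq[OF k sa(1) a] sa(2) by blast
    note in1 = ntD(3)[OF Dm[OF k X sa(1)] Z] and in2 = ntD(3)[OF Dm[OF k X a] Z]
    have "c Z (fmap D k X (s k (e k a)) Z z) = c Z (fmap D k X a Z z)"
    proof (rule inj_ntD[OF n(2) Z(1) ntD(3)[OF c(1) Z(1) in1] ntD(3)[OF c(1) Z(1) in2]])
      show "n Z (c Z (fmap D k X (s k (e k a)) Z z)) = n Z (c Z (fmap D k X a Z z))"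
        unfolding nc[OF Z(1) in1] nc[OF Z(1) in2] Dc[OF k X Y sa(1) f Z, symmetric]
          Dc[OF k X Y a f Z, symmetric] eq ..
    qed
    then show ?thesis using Z by (simp add: \<eta>_def)
  qed
  have "weighted_cocone K \<phi> (PE T) D H \<eta>"
    unfolding weighted_cocone_def PE_simps
  proof (intro conjI ballI H \<eta>_in)
    fix k k' u x assume k: "k \<in> ob K" "k' \<in> ob K" and u: "u \<in> hom K k k'" and x: "x \<in> fob \<phi> k'"
    note a = s[OF k(2) x]
    have \<phi>: "fmap \<phi> k' k u x = e k (cmp K k k' X (s k' x) u)"
      using e_nat[OF k u a(1)] a(2) by simp
    have au: "cmp K k k' X (s k' x) u \<in> hom K k X" using k X u a(1) by simp
    show "\<eta> k (fmap \<phi> k' k u x) = vcmp (fob D k) (\<eta> k' x) (fmap D k k' u)"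
    proof (rule nt_eqI[OF _ vcmp_in[OF Dp[OF k(1)] Dm[OF k u] \<eta>_in[OF k(2) x]]])
      show "\<eta> k (fmap \<phi> k' k u x) \<in> nt (fob D k) H"
        unfolding \<phi> by (rule \<eta>_in[OF k(1) e_in[OF k(1) au]])
      fix Z z assume Z: "Z \<in> ob C" "z \<in> fob (fob D k) Z"
      show "\<eta> k (fmap \<phi> k' k u x) Z z = vcmp (fob D k) (\<eta> k' x) (fmap D k k' u) Z z"
        using \<eta>_e[OF k(1) au Z] \<eta>_e[OF k(2) a(1) Z(1) ntD(3)[OF Dm[OF k u] Z]] Dc[OF k X u a(1) Z] Z
        by (simp add: \<phi> a(2))
    qed
  qed
  moreover have "\<exists>!h. h \<in> nt H M \<and> (\<forall>k\<in>ob K. \<forall>x\<in>fob \<phi> k. vcmp (fob D k) h (\<eta> k x) = \<theta> k x)"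
    if cocone: "weighted_cocone K \<phi> (PE T) D M \<theta>" for M \<theta>
  proof -
    have M: "M \<in> T"
      and \<theta>_in: "\<And>k x. k \<in> ob K \<Longrightarrow> x \<in> fob \<phi> k \<Longrightarrow> \<theta> k x \<in> nt (fob D k) M"
      and \<theta>_nat: "\<And>k k' u x. \<lbrakk>k \<in> ob K; k' \<in> ob K; u \<in> hom K k k'; x \<in> fob \<phi> k'\<rbrakk> \<Longrightarrow>
        \<theta> k (fmap \<phi> k' k u x) = vcmp (fob D k) (\<theta> k' x) (fmap D k k' u)"
      using cocone by (simp_all add: weighted_cocone_def)
    \<comment> \<open>The universal element of the weight: each \<open>e k a\<close> is its
      restriction along \<open>a\<close>, so the cocone is determined by its value \<open>t\<close>
      at \<open>g\<close>.\<close>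
    define g where "g = e X (ide K X)"
    have g: "g \<in> fob \<phi> X" unfolding g_def using X by (intro e_in) simp_all
    define t where "t = \<theta> X g"
    have t: "t \<in> nt (fob D X) M" unfolding t_def by (rule \<theta>_in[OF X g])
    have \<theta>_e: "\<theta> k (e k a) Z z = t Z (fmap D k X a Z z)"
      if k: "k \<in> ob K" and a: "a \<in> hom K k X" and Z: "Z \<in> ob C" "z \<in> fob (fob D k) Z" for k a Z z
    proof -
      have "fmap \<phi> X k a g = e k a"
        unfolding g_def using e_nat[OF k X a, of "ide K X"] k X a by simp
      then have "\<theta> k (e k a) = vcmp (fob D k) t (fmap D k X a)"
        unfolding t_def using \<theta>_nat[OF k X a g] by simp
      then show ?thesis using Z by simp
    qed
    obtain R p q where pb: "is_pullback K X X Y f f R p q"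
      using K.pullback_exists[OF K(2) X X Y f f] by blast
    note R = K.is_pullbackD[OF pb]
    have pbD: "is_pullback (PE T) (fob D X) (fob D X) (fob D Y) (fmap D X Y f) (fmap D X Y f)
      (fob D R) (fmap D R X p) (fmap D R X q)"
      by (rule K.lex_functor_pullback[OF D pb X X Y f f])
    \<comment> \<open>The cocone component at this common class can be computed along
      \<open>p\<close> or along \<open>q\<close>; this is why \<open>t\<close> equalises the kernel
      pair.\<close>
    have epq: "e R p = e R q" using e_eq[OF R(1-3)] R(4) by simp
    have t_eq: "t Z x = t Z x'"
      if Z: "Z \<in> ob C" "x \<in> fob (fob D X) Z" "x' \<in> fob (fob D X) Z" and eq: "c Z x = c Z x'" for Z x x'
    proof -
      have "fmap D X Y f Z x = fmap D X Y f Z x'"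
        using nc[OF Z(1,2)] nc[OF Z(1,3)] eq by simp
      then obtain r where r: "r \<in> fob (fob D R) Z" "fmap D R X p Z r = x" "fmap D R X q Z r = x'"
        using pullback_elements[OF pbD DT[OF X] DT[OF X] DT[OF Y] Dm[OF X Y f] Dm[OF X Y f] Z] by blast
      show ?thesis
        using \<theta>_e[OF R(1,2) Z(1) r(1)] \<theta>_e[OF R(1,3) Z(1) r(1)] epq r(2,3) by simp
    qed
    obtain h where h: "h \<in> nt H M" "\<And>Z x. \<lbrakk>Z \<in> ob C; x \<in> fob (fob D X) Z\<rbrakk> \<Longrightarrow> h Z (c Z x) = t Z x"
      using factor_through_surj[OF Dp[OF X] psh_T[OF H] psh_T[OF M] c t t_eq] by blast
    show ?thesis
    proof (rule ex1I[of _ h])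
      have "vcmp (fob D k) h (\<eta> k x) = \<theta> k x" if k: "k \<in> ob K" "x \<in> fob \<phi> k" for k x
      proof (rule nt_eqI[OF vcmp_in[OF Dp[OF k(1)] \<eta>_in[OF k] h(1)] \<theta>_in[OF k]])
        fix Z z assume Z: "Z \<in> ob C" "z \<in> fob (fob D k) Z"
        note a = s[OF k]
        show "vcmp (fob D k) h (\<eta> k x) Z z = \<theta> k x Z z"
          using \<eta>_e[OF k(1) a(1) Z] \<theta>_e[OF k(1) a(1) Z] h(2)[OF Z(1) ntD(3)[OF Dm[OF k(1) X a(1)] Z]] Z
          by (simp add: a(2))
      qed
      then show "h \<in> nt H M \<and> (\<forall>k\<in>ob K. \<forall>x\<in>fob \<phi> k. vcmp (fob D k) h (\<eta> k x) = \<theta> k x)"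
        using h(1) by blast
      fix h' assume h': "h' \<in> nt H M \<and> (\<forall>k\<in>ob K. \<forall>x\<in>fob \<phi> k. vcmp (fob D k) h' (\<eta> k x) = \<theta> k x)"
      then have eq: "vcmp (fob D X) h' (\<eta> X g) = t" using X g by (simp add: t_def)
      show "h' = h"
      proof (rule surj_nt_cancel[OF c(2) conjunct1[OF h'] h(1)])
        fix Z x assume Z: "Z \<in> ob C" "x \<in> fob (fob D X) Z"
        have "\<eta> X g Z x = c Z x"
          unfolding g_def using \<eta>_e[OF X K.ide_hom[OF X] Z] Di[OF X Z] by simp
        then show "h' Z (c Z x) = h Z (c Z x)"
          using fun_cong[OF fun_cong[OF eq], of Z x] h(2)[OF Z] Z by simp
      qed
    qed
  qed
  ultimately have "is_weighted_colimit K \<phi> (PE T) D H \<eta>"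
    by (simp add: is_weighted_colimit_def)
  then show ?thesis by (rule exI[of _ \<eta>])
qed

text \<open>The image is the quotient of \<open>F\<close> by the kernel pair \<open>R\<close>, so a
  set generating both \<open>F\<close> and \<open>R\<close> as Kan extensions serves for
  \<open>H\<close>. In the application \<open>R\<close> is the value of a lex diagram at a kernel
  pair, and therefore small.\<close>

lemma small_presheaf_image:
  assumes u: "universe \<kappa>" and F: "small_presheaf \<kappa> C F" and R: "small_presheaf \<kappa> C R"
    and pb: "is_pullback (PE T) F F G f f R p q" and T: "F \<in> T" "G \<in> T" and f: "f \<in> nt F G"
    and H: "psh H" and c: "c \<in> nt F H" "surj_nt F H c" and n: "n \<in> nt H G" "inj_nt H n"
    and nc: "\<And>Z x. \<lbrakk>Z \<in> ob C; x \<in> fob F Z\<rbrakk> \<Longrightarrow> n Z (c Z x) = f Z x"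
  shows "small_presheaf \<kappa> C H"
proof -
  obtain S1 S2 where S: "S1 \<subseteq> ob C" "small \<kappa> S1" "kan S1 F" "S2 \<subseteq> ob C" "small \<kappa> S2" "kan S2 R"
    and psh: "psh F" "psh R"
    using F R unfolding small_presheaf_iff by blast
  have pq: "p \<in> nt R F" "q \<in> nt R F" "vcmp R f p = vcmp R f q"
    using pb by (simp_all add: is_pullback_def)
  have "kan (S1 \<union> S2) H"
  proof (rule kan_quotient[OF psh H pq(1,2) c])
    fix Z r assume Z: "Z \<in> ob C" "r \<in> fob R Z"
    note pr = ntD(3)[OF pq(1) Z] ntD(3)[OF pq(2) Z]
    show "c Z (p Z r) = c Z (q Z r)"
      by (rule inj_ntD[OF n(2) Z(1) ntD(3)[OF c(1) Z(1) pr(1)] ntD(3)[OF c(1) Z(1) pr(2)]])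
        (use fun_cong[OF fun_cong[OF pq(3)], of Z r] Z in \<open>simp add: nc[OF Z(1) pr(1)] nc[OF Z(1) pr(2)]\<close>)
  next
    fix Z x x' assume Z: "Z \<in> ob C" "x \<in> fob F Z" "x' \<in> fob F Z" and eq: "c Z x = c Z x'"
    then have "f Z x = f Z x'" using nc[OF Z(1,2)] nc[OF Z(1,3)] by simp
    then show "\<exists>r\<in>fob R Z. p Z r = x \<and> q Z r = x'"
      using pullback_elements[OF pb T(1) T(1) T(2) f f Z] by blast
  next
    show "kan (S1 \<union> S2) F" "kan (S1 \<union> S2) R"
      by (rule kan_mono[OF psh(1) S(3)] kan_mono[OF psh(2) S(6)]; use S in blast)+
  qed (use S in blast)
  then show ?thesis
    unfolding small_presheaf_iff using H S small_Un[OF u S(2,5)] by blast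
qed

end

text \<open>The universal property that defines the weight is traded for its description in
  elements, which are classes of arrows of \<open>K\<close> into \<open>X\<close>.\<close>

lemma Phi_reg_weight:
  assumes "is_Phi_reg \<kappa> \<Phi>"
  shows "\<exists>K X Y f \<phi> e. \<Phi> = {(K, \<phi>)} \<and> free_lex_on_arrow \<kappa> K X Y f \<and> image_weight K X Y f \<phi> e"
proof -
  obtain K X Y f \<phi> R p q e where \<Phi>: "\<Phi> = {(K, \<phi>)}" and free: "free_lex_on_arrow \<kappa> K X Y f"
    and kp: "is_kernel_pair (presheaf_cat \<kappa> K) (yoneda_ob K X) (yoneda_ob K Y) (yoneda_map K X Y f) R p q"
    and co: "is_coequaliser (presheaf_cat \<kappa> K) R (yoneda_ob K X) p q \<phi> e"
    using assms unfolding is_Phi_reg_def by blast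
  have K: "category K" "locally_small \<kappa> K" and X: "X \<in> ob K" and Y: "Y \<in> ob K" and f: "f \<in> hom K X Y"
    using free by (auto simp: free_lex_on_arrow_def small_category_def)
  interpret K: presheaves K \<kappa> using K by unfold_locales
  note el = K.coequaliser_of_kernel_pair_elements[OF kp co K.psh_y[OF X] K.psh_y[OF Y] K.yoneda_map_in[OF X Y f]]
  have "image_weight K X Y f \<phi> e"
    unfolding image_weight_def
  proof (intro conjI ballI)
    show "e k a \<in> fob \<phi> k" if "k \<in> ob K" "a \<in> hom K k X" for k a
      using K.ntD(3)[OF el(1)] that by simp
    show "\<exists>a\<in>hom K k X. e k a = x" if "k \<in> ob K" "x \<in> fob \<phi> k" for k x
      using el(2) that unfolding K.surj_nt_def by simp
    show "e k a = e k b \<longleftrightarrow> cmp K k X Y f a = cmp K k X Y f b"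
      if "k \<in> ob K" "a \<in> hom K k X" "b \<in> hom K k X" for k a b
      using el(3)[of k a b] that by simp
    show "fmap \<phi> k' k u (e k' a) = e k (cmp K k k' X a u)"
      if "k \<in> ob K" "k' \<in> ob K" "u \<in> hom K k k'" "a \<in> hom K k' X" for k k' u a
      using K.nt_natural[OF el(1) that(2,1,3), of a] that by simp
  qed
  then show ?thesis using \<Phi> free by blast
qed

section \<open>Presheaves dense in a representable\<close>

locale regular_presheaves = presheaves C \<kappa> + regcat C for C :: "('o, 'u) cat" and \<kappa> :: "'u rel"
begin

text \<open>Identified with its image under \<open>m\<close>, the presheaf \<open>F\<close> is a
  covering sieve on \<open>I\<close> for the regular topology.\<close>

definition dense :: "('o, 'u) presheaf \<Rightarrow> 'o \<Rightarrow> ('o \<Rightarrow> 'u \<Rightarrow> 'u) \<Rightarrow> bool" where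
  "dense F I m \<longleftrightarrow> I \<in> ob C \<and> m \<in> nt F (y I) \<and> inj_nt F m \<and>
     (\<exists>X\<in>ob C. \<exists>x\<in>fob F X. eff_epi X I (m X x))"

lemma denseD:
  assumes "dense F I m"
  shows "I \<in> ob C" "m \<in> nt F (y I)" "inj_nt F m"
    and dense_hom: "\<And>Z x. \<lbrakk>Z \<in> ob C; x \<in> fob F Z\<rbrakk> \<Longrightarrow> m Z x \<in> hom C Z I"
    and dense_natural: "\<And>Z Z' h x. \<lbrakk>Z \<in> ob C; Z' \<in> ob C; h \<in> hom C Z' Z; x \<in> fob F Z\<rbrakk> \<Longrightarrow>
      m Z' (fmap F Z Z' h x) = cmp C Z' Z I (m Z x) h"
proof -
  show *: "I \<in> ob C" "m \<in> nt F (y I)" "inj_nt F m"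
    using assms by (simp_all add: dense_def)
  show hom: "m Z x \<in> hom C Z I" if "Z \<in> ob C" "x \<in> fob F Z" for Z x
    using ntD(3)[OF *(2) that] by simp
  show "m Z' (fmap F Z Z' h x) = cmp C Z' Z I (m Z x) h"
    if "Z \<in> ob C" "Z' \<in> ob C" "h \<in> hom C Z' Z" "x \<in> fob F Z" for Z Z' h x
    using nt_natural[OF *(2) that] hom[OF that(1,4)] by simp
qed

lemma dense_y: "X \<in> ob C \<Longrightarrow> dense (y X) X (mknt (y X) (\<lambda>Z f. f))"
  unfolding dense_def
  by (intro conjI ide_in psh_y bexI[of _ X] bexI[of _ "ide C X"])
    (simp_all add: inj_nt_def inj_on_def eff_epi_ide)

text \<open>Pulling the effective epimorphism in the sieve back along \<open>z\<close> gives a cover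
  of \<open>Z\<close> on which \<open>z\<close> lands in the sieve.\<close>

lemma dense_local:
  assumes F: "psh F" and m: "dense F I m" and Z: "Z \<in> ob C" "z \<in> hom C Z I"
  obtains W c x where "eff_epi W Z c" "x \<in> fob F W" "m W x = cmp C W Z I z c"
proof -
  obtain X x where X: "X \<in> ob C" "x \<in> fob F X" "eff_epi X I (m X x)"
    using m unfolding dense_def by blast
  obtain W p q where W: "W \<in> ob C" "p \<in> hom C W X" "eff_epi W Z q" "cmp C W X I (m X x) p = cmp C W Z I z q"
    using eff_epi_pullback[OF X(3) Z] by blast
  show thesis
    using that[OF W(3) psh_in[OF F X(1) W(1,2) X(2)]] dense_natural[OF m X(1) W(1,2) X(2)] W(4) by simp
qed

text \<open>Covers are stacked one above the other; the composite is again a cover by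
  \<open>eff_epi_cmp\<close>, and membership in the earlier sieves survives restriction.\<close>

lemma dense_common_cover:
  assumes "finite A" "\<And>j. j \<in> A \<Longrightarrow> psh (F j)" "\<And>j. j \<in> A \<Longrightarrow> dense (F j) (I j) (m j)"
    and "Z \<in> ob C" "\<And>j. j \<in> A \<Longrightarrow> z j \<in> hom C Z (I j)"
  shows "\<exists>W c. eff_epi W Z c \<and> (\<forall>j\<in>A. \<exists>x\<in>fob (F j) W. m j W x = cmp C W Z (I j) (z j) c)"
  using assms
proof (induction A rule: finite_induct)
  case empty
  then show ?case using eff_epi_ide by blast
next
  case (insert a A)
  then obtain W c where W: "eff_epi W Z c" "\<forall>j\<in>A. \<exists>x\<in>fob (F j) W. m j W x = cmp C W Z (I j) (z j) c"
    by (metis insertCI)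
  note Wc = eff_epiD[OF W(1)]
  have a: "psh (F a)" "dense (F a) (I a) (m a)" "z a \<in> hom C Z (I a)" using insert.prems by blast+
  have Ia: "I a \<in> ob C" using denseD(1)[OF a(2)] .
  have zc: "cmp C W Z (I a) (z a) c \<in> hom C W (I a)" using Wc Ia a(3) by simp
  obtain V d x where V: "eff_epi V W d" "x \<in> fob (F a) V" "m a V x = cmp C V W (I a) (cmp C W Z (I a) (z a) c) d"
    using dense_local[OF a(1,2) Wc(1) zc] by blast
  note Vd = eff_epiD[OF V(1)]
  have "\<exists>x\<in>fob (F j) V. m j V x = cmp C V Z (I j) (z j) (cmp C V W Z c d)" if j: "j \<in> insert a A" for j
  proof (cases "j = a")
    case True
    then show ?thesis
      using V(2,3) cmp_assoc[OF Vd(1) Wc(1,2) Ia Vd(3) Wc(3) a(3)] by auto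
  next
    case False
    then have jA: "j \<in> A" using j by simp
    then obtain x where x: "x \<in> fob (F j) W" "m j W x = cmp C W Z (I j) (z j) c" using W(2) by blast
    have F: "psh (F j)" "dense (F j) (I j) (m j)" "z j \<in> hom C Z (I j)" using insert.prems jA by blast+
    have "m j V (fmap (F j) W V d x) = cmp C V Z (I j) (z j) (cmp C V W Z c d)"
      using dense_natural[OF F(2) Wc(1) Vd(1,3) x(1)] x(2)
        cmp_assoc[OF Vd(1) Wc(1,2) denseD(1)[OF F(2)] Vd(3) Wc(3) F(3)] by simp
    then show ?thesis using psh_in[OF F(1) Wc(1) Vd(1,3) x(1)] by blast
  qed
  then show ?case using eff_epi_cmp[OF V(1) W(1)] by blast
qed

lemma dense_unique:
  assumes m: "dense F I m" and Z: "Z \<in> ob C" "h \<in> hom C I Z" "k \<in> hom C I Z"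
    and eq: "\<And>W x. \<lbrakk>W \<in> ob C; x \<in> fob F W\<rbrakk> \<Longrightarrow> cmp C W I Z h (m W x) = cmp C W I Z k (m W x)"
  shows "h = k"
proof -
  obtain X x where X: "X \<in> ob C" "x \<in> fob F X" "eff_epi X I (m X x)"
    using m unfolding dense_def by blast
  show ?thesis by (rule eff_epi_cancel[OF X(3) Z eq[OF X(1,2)]])
qed

text \<open>Representables are sheaves for the regular topology. The value of \<open>t\<close> at
  the covering element \<open>x\<close> descends along \<open>m X x\<close>, and agreement with
  \<open>t\<close> on any other element is checked on a pullback of that cover.\<close>

lemma dense_extend:
  assumes F: "psh F" and m: "dense F I m" and Z: "Z \<in> ob C" and t: "t \<in> nt F (y Z)"
  obtains h where "h \<in> hom C I Z" "\<And>W x. \<lbrakk>W \<in> ob C; x \<in> fob F W\<rbrakk> \<Longrightarrow> cmp C W I Z h (m W x) = t W x"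
proof -
  note I = denseD(1)[OF m]
  have t_hom: "t W x \<in> hom C W Z" if "W \<in> ob C" "x \<in> fob F W" for W x
    using ntD(3)[OF t that] by simp
  have t_nat: "t W' (fmap F W W' h x) = cmp C W' W Z (t W x) h"
    if "W \<in> ob C" "W' \<in> ob C" "h \<in> hom C W' W" "x \<in> fob F W" for W W' h x
    using nt_natural[OF t that] t_hom[OF that(1,4)] by simp
  obtain X x where X: "X \<in> ob C" "x \<in> fob F X" "eff_epi X I (m X x)"
    using m unfolding dense_def by blast
  have "cmp C T X Z (t X x) r = cmp C T X Z (t X x) s"
    if T: "T \<in> ob C" "r \<in> hom C T X" "s \<in> hom C T X" "cmp C T X I (m X x) r = cmp C T X I (m X x) s" for T r s
  proof -
    \<comment> \<open>Injectivity of \<open>m\<close> turns equal composites into \<open>I\<close>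
      into equal elements of \<open>F\<close>, on which \<open>t\<close> agrees by
      naturality.\<close>
    have "fmap F X T r x = fmap F X T s x"
      by (rule inj_ntD[OF denseD(3)[OF m] T(1) psh_in[OF F X(1) T(1,2) X(2)] psh_in[OF F X(1) T(1,3) X(2)]])
        (use dense_natural[OF m X(1) T(1,2) X(2)] dense_natural[OF m X(1) T(1,3) X(2)] T(4) in simp)
    then show ?thesis using t_nat[OF X(1) T(1,2) X(2)] t_nat[OF X(1) T(1,3) X(2)] by simp
  qed
  then obtain h where h: "h \<in> hom C I Z" "cmp C X I Z h (m X x) = t X x"
    using eff_epi_descend[OF X(3) Z t_hom[OF X(1,2)]] by blast
  have "cmp C W I Z h (m W w) = t W w" if W: "W \<in> ob C" "w \<in> fob F W" for W w
  proof -
    note mw = dense_hom[OF m W] and mx = dense_hom[OF m X(1,2)]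
    obtain V p q where V: "V \<in> ob C" "p \<in> hom C V X" "eff_epi V W q" "cmp C V X I (m X x) p = cmp C V W I (m W w) q"
      using eff_epi_pullback[OF X(3) W(1) mw] by blast
    note q = eff_epiD(3)[OF V(3)]
    \<comment> \<open>Over the cover \<open>V\<close> of \<open>W\<close> the element
      \<open>w\<close> becomes a restriction of the covering element \<open>x\<close>, where
      \<open>h\<close> is already known.\<close>
    have "fmap F X V p x = fmap F W V q w"
      by (rule inj_ntD[OF denseD(3)[OF m] V(1) psh_in[OF F X(1) V(1,2) X(2)] psh_in[OF F W(1) V(1) q W(2)]])
        (use dense_natural[OF m X(1) V(1,2) X(2)] dense_natural[OF m W(1) V(1) q W(2)] V(4) in simp)
    then have "cmp C V W Z (t W w) q = cmp C V X Z (t X x) p"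
      using t_nat[OF X(1) V(1,2) X(2)] t_nat[OF W(1) V(1) q W(2)] by simp
    also have "\<dots> = cmp C V I Z h (cmp C V X I (m X x) p)"
      using cmp_assoc[OF V(1) X(1) I Z V(2) mx h(1)] h(2) by simp
    also have "\<dots> = cmp C V W Z (cmp C W I Z h (m W w)) q"
      using cmp_assoc[OF V(1) W(1) I Z q mw h(1)] V(4) by simp
    finally have eq: "cmp C V W Z (cmp C W I Z h (m W w)) q = cmp C V W Z (t W w) q" ..
    show ?thesis
      by (rule eff_epi_cancel[OF V(3) Z cmp_hom[OF W(1) I Z mw h(1)] t_hom[OF W] eq])
  qed
  then show thesis using that h(1) by blast
qed

section \<open>The reflection of presheaves dense in a representable\<close>

definition separated :: "('o, 'u) presheaf set" where
  "separated = {F. psh F \<and> (\<exists>I m. dense F I m)}"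

text \<open>By \<open>dense_unique\<close> and \<open>dense_extend\<close> any such \<open>I\<close>
  is a reflection of \<open>F\<close>, hence determined up to isomorphism; fixing one makes the
  reflection a functor.\<close>

definition refl_ob :: "('o, 'u) presheaf \<Rightarrow> 'o" where
  "refl_ob F = (SOME I. \<exists>m. dense F I m)"

definition refl_unit :: "('o, 'u) presheaf \<Rightarrow> 'o \<Rightarrow> 'u \<Rightarrow> 'u" where
  "refl_unit F = (SOME m. dense F (refl_ob F) m)"

definition refl_map :: "('o, 'u) presheaf \<Rightarrow> ('o, 'u) presheaf \<Rightarrow> ('o \<Rightarrow> 'u \<Rightarrow> 'u) \<Rightarrow> 'u" where
  "refl_map F G t = (THE h. h \<in> hom C (refl_ob F) (refl_ob G) \<and>
     (\<forall>W\<in>ob C. \<forall>x\<in>fob F W. cmp C W (refl_ob F) (refl_ob G) h (refl_unit F W x) = refl_unit G W (t W x)))"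

definition reflector :: "(('o, 'u) presheaf, 'o \<Rightarrow> 'u \<Rightarrow> 'u, 'o, 'u) func" where
  "reflector = \<lparr>fob = refl_ob, fmap = refl_map\<rparr>"

lemma refl_dense: "F \<in> separated \<Longrightarrow> dense F (refl_ob F) (refl_unit F)"
  unfolding separated_def refl_unit_def refl_ob_def by (metis (mono_tags, lifting) mem_Collect_eq)

lemma separated_psh: "F \<in> separated \<Longrightarrow> psh F"
  by (simp add: separated_def)

text \<open>Since arrows out of \<open>refl_ob F\<close> are detected on the sieve, functoriality
  and all later identities of reflected arrows reduce to one equation on elements.\<close>

lemma refl_map_unique:
  assumes F: "F \<in> separated" "G \<in> separated" and h: "h \<in> hom C (refl_ob F) (refl_ob G)"
    and eq: "\<And>W x. \<lbrakk>W \<in> ob C; x \<in> fob F W\<rbrakk> \<Longrightarrow>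
      cmp C W (refl_ob F) (refl_ob G) h (refl_unit F W x) = refl_unit G W (t W x)"
  shows "refl_map F G t = h"
  unfolding refl_map_def
proof (rule the_equality)
  fix k assume k: "k \<in> hom C (refl_ob F) (refl_ob G) \<and>
     (\<forall>W\<in>ob C. \<forall>x\<in>fob F W. cmp C W (refl_ob F) (refl_ob G) k (refl_unit F W x) = refl_unit G W (t W x))"
  show "k = h"
    by (rule dense_unique[OF refl_dense[OF F(1)] denseD(1)[OF refl_dense[OF F(2)]] conjunct1[OF k] h])
      (use k eq in simp)
qed (use h eq in blast)

lemma refl_map:
  assumes F: "F \<in> separated" "G \<in> separated" and t: "t \<in> nt F G"
  shows "refl_map F G t \<in> hom C (refl_ob F) (refl_ob G)"
    and "\<And>W x. \<lbrakk>W \<in> ob C; x \<in> fob F W\<rbrakk> \<Longrightarrow>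
      cmp C W (refl_ob F) (refl_ob G) (refl_map F G t) (refl_unit F W x) = refl_unit G W (t W x)"
proof -
  note d = refl_dense[OF F(1)] refl_dense[OF F(2)]
  obtain h where h: "h \<in> hom C (refl_ob F) (refl_ob G)"
    "\<And>W x. \<lbrakk>W \<in> ob C; x \<in> fob F W\<rbrakk> \<Longrightarrow> cmp C W (refl_ob F) (refl_ob G) h (refl_unit F W x) = vcmp F (refl_unit G) t W x"
    using dense_extend[OF separated_psh[OF F(1)] d(1) denseD(1)[OF d(2)]
      vcmp_in[OF separated_psh[OF F(1)] t denseD(2)[OF d(2)]]] by blast
  have eq: "refl_map F G t = h"
    by (rule refl_map_unique[OF F h(1)]) (simp add: h(2))
  show "refl_map F G t \<in> hom C (refl_ob F) (refl_ob G)" using h(1) eq by simp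
  show "cmp C W (refl_ob F) (refl_ob G) (refl_map F G t) (refl_unit F W x) = refl_unit G W (t W x)"
    if "W \<in> ob C" "x \<in> fob F W" for W x
    using h(2)[OF that] that eq by simp
qed

lemma is_functor_reflector:
  assumes T: "T \<subseteq> separated"
  shows "is_functor (PE T) C reflector"
proof -
  have sep: "F \<in> separated" if "F \<in> T" for F using T that by blast
  have "refl_map F F (mknt F (\<lambda>Z x. x)) = ide C (refl_ob F)" if F: "F \<in> T" for F
  proof (rule refl_map_unique[OF sep[OF F] sep[OF F]])
    note d = refl_dense[OF sep[OF F]]
    show "ide C (refl_ob F) \<in> hom C (refl_ob F) (refl_ob F)" using denseD(1)[OF d] by simp
    fix W x assume W: "W \<in> ob C" "x \<in> fob F W"
    then show "cmp C W (refl_ob F) (refl_ob F) (ide C (refl_ob F)) (refl_unit F W x) =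
        refl_unit F W (mknt F (\<lambda>Z x. x) W x)"
      using dense_hom[OF d W] denseD(1)[OF d] by simp
  qed
  moreover have "refl_map F H (vcmp F u t) =
      cmp C (refl_ob F) (refl_ob G) (refl_ob H) (refl_map G H u) (refl_map F G t)"
    if T': "F \<in> T" "G \<in> T" "H \<in> T" and t: "t \<in> nt F G" and u: "u \<in> nt G H" for F G H t u
  proof (rule refl_map_unique[OF sep[OF T'(1)] sep[OF T'(3)]])
    note dF = refl_dense[OF sep[OF T'(1)]] and dG = refl_dense[OF sep[OF T'(2)]] and dH = refl_dense[OF sep[OF T'(3)]]
    note rt = refl_map[OF sep[OF T'(1)] sep[OF T'(2)] t] and ru = refl_map[OF sep[OF T'(2)] sep[OF T'(3)] u]
    note ob = denseD(1)[OF dF] denseD(1)[OF dG] denseD(1)[OF dH]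
    show "cmp C (refl_ob F) (refl_ob G) (refl_ob H) (refl_map G H u) (refl_map F G t) \<in> hom C (refl_ob F) (refl_ob H)"
      using ob rt(1) ru(1) by simp
    fix W x assume W: "W \<in> ob C" "x \<in> fob F W"
    show "cmp C W (refl_ob F) (refl_ob H) (cmp C (refl_ob F) (refl_ob G) (refl_ob H) (refl_map G H u) (refl_map F G t))
        (refl_unit F W x) = refl_unit H W (vcmp F u t W x)"
      using cmp_assoc[OF W(1) ob dense_hom[OF dF W] rt(1) ru(1)] rt(2)[OF W] ru(2)[OF W(1) ntD(3)[OF t W]] W
      by simp
  qed
  ultimately show ?thesis
    unfolding is_functor_def reflector_def
    using category category_PE[of T] sep separated_psh denseD(1)[OF refl_dense] refl_map(1)
    by (simp add: subset_iff)
qed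

text \<open>The transpose restricts an arrow to the sieve. It is injective by
  \<open>dense_unique\<close> and surjective by \<open>dense_extend\<close>.\<close>

lemma adjunction_reflector:
  assumes T: "T \<subseteq> separated" and y: "y ` ob C \<subseteq> T"
  shows "adjunction (PE T) C reflector (yoneda C)"
proof -
  have sep: "F \<in> separated" if "F \<in> T" for F using T that by blast
  have psh: "T \<subseteq> {F. psh F}" using sep separated_psh by blast
  note d = refl_dense[OF sep]
  define \<theta> where "\<theta> F Z h = mknt F (\<lambda>W x. cmp C W (refl_ob F) Z h (refl_unit F W x))" for F Z h
  have \<theta>_in: "\<theta> F Z h \<in> nt F (y Z)" if F: "F \<in> T" and Z: "Z \<in> ob C" and h: "h \<in> hom C (refl_ob F) Z" for F Z h
    unfolding \<theta>_def
  proof (rule mknt_in)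
    show "psh F" using F psh by blast
    note I = denseD(1)[OF d[OF F]]
    show "cmp C W (refl_ob F) Z h (refl_unit F W x) \<in> fob (y Z) W" if "W \<in> ob C" "x \<in> fob F W" for W x
      using that dense_hom[OF d[OF F] that] I Z h by simp
    show "cmp C W' (refl_ob F) Z h (refl_unit F W' (fmap F W W' g x)) =
        fmap (y Z) W W' g (cmp C W (refl_ob F) Z h (refl_unit F W x))"
      if W: "W \<in> ob C" "W' \<in> ob C" "g \<in> hom C W' W" "x \<in> fob F W" for W W' g x
      using dense_natural[OF d[OF F] W] dense_hom[OF d[OF F] W(1,4)]
        cmp_assoc[OF W(2,1) I Z W(3) dense_hom[OF d[OF F] W(1,4)] h] W I Z h by simp
  qed
  have \<theta>_apply: "\<theta> F Z h W x = cmp C W (refl_ob F) Z h (refl_unit F W x)" if "W \<in> ob C" "x \<in> fob F W" for F Z h W x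
    using that by (simp add: \<theta>_def)
  have bij: "bij_betw (\<theta> F Z) (hom C (refl_ob F) Z) (nt F (y Z))" if F: "F \<in> T" and Z: "Z \<in> ob C" for F Z
  proof (rule bij_betw_imageI)
    show "inj_on (\<theta> F Z) (hom C (refl_ob F) Z)"
    proof (rule inj_onI)
      fix h k assume hk: "h \<in> hom C (refl_ob F) Z" "k \<in> hom C (refl_ob F) Z" "\<theta> F Z h = \<theta> F Z k"
      show "h = k"
        by (rule dense_unique[OF d[OF F] Z hk(1,2)]) (use \<theta>_apply hk(3) in metis)
    qed
    show "\<theta> F Z ` hom C (refl_ob F) Z = nt F (y Z)"
    proof (intro equalityI subsetI)
      fix t assume t: "t \<in> nt F (y Z)"
      obtain h where h: "h \<in> hom C (refl_ob F) Z"
        "\<And>W x. \<lbrakk>W \<in> ob C; x \<in> fob F W\<rbrakk> \<Longrightarrow> cmp C W (refl_ob F) Z h (refl_unit F W x) = t W x"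
        using dense_extend[OF separated_psh[OF sep[OF F]] d[OF F] Z t] by blast
      have "\<theta> F Z h = t"
        by (rule nt_eqI[OF \<theta>_in[OF F Z h(1)] t]) (simp add: \<theta>_apply h(2))
      then show "t \<in> \<theta> F Z ` hom C (refl_ob F) Z" using h(1) by blast
    qed (use \<theta>_in[OF F Z] in blast)
  qed
  have nat: "\<theta> F' Z' (cmp C (refl_ob F') Z Z' v (cmp C (refl_ob F') (refl_ob F) Z h (refl_map F' F u))) =
      vcmp F' (yoneda_map C Z Z' v) (vcmp F' (\<theta> F Z h) u)"
    if F: "F \<in> T" "F' \<in> T" and Z: "Z \<in> ob C" "Z' \<in> ob C" and u: "u \<in> nt F' F" and v: "v \<in> hom C Z Z'"
      and h: "h \<in> hom C (refl_ob F) Z" for F F' Z Z' u v h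
  proof -
    note I = denseD(1)[OF d[OF F(1)]] denseD(1)[OF d[OF F(2)]]
    note ru = refl_map[OF sep[OF F(2)] sep[OF F(1)] u]
    have hu: "cmp C (refl_ob F') (refl_ob F) Z h (refl_map F' F u) \<in> hom C (refl_ob F') Z"
      using I Z h ru(1) by simp
    have psh': "psh F'" using F psh by blast
    show ?thesis
    proof (rule nt_eqI[OF \<theta>_in[OF F(2) Z(2) cmp_hom[OF I(2) Z hu v]]
        vcmp_in[OF psh' vcmp_in[OF psh' u \<theta>_in[OF F(1) Z(1) h]] yoneda_map_in[OF Z v]]])
      fix W x assume W: "W \<in> ob C" "x \<in> fob F' W"
      note m = dense_hom[OF d[OF F(2)] W] and ux = ntD(3)[OF u W]
      note m' = dense_hom[OF d[OF F(1)] W(1) ux]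
      have "\<theta> F Z h W (u W x) \<in> hom C W Z" using \<theta>_apply[OF W(1) ux] m' I(1) W(1) Z(1) h by simp
      then show "\<theta> F' Z' (cmp C (refl_ob F') Z Z' v (cmp C (refl_ob F') (refl_ob F) Z h (refl_map F' F u))) W x =
          vcmp F' (yoneda_map C Z Z' v) (vcmp F' (\<theta> F Z h) u) W x"
        using \<theta>_apply[OF W] \<theta>_apply[OF W(1) ux] W ru(2)[OF W]
          cmp_assoc[OF W(1) I(2) Z m hu v] cmp_assoc[OF W(1) I(2) I(1) Z(1) m ru(1) h]
        by simp
    qed
  qed
  show ?thesis
    unfolding adjunction_def
    using is_functor_reflector[OF T] is_functor_yoneda[OF psh y] bij nat
    by (intro conjI exI[of _ \<theta>]) (simp_all add: reflector_def yoneda_def)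
qed

end

section \<open>Exactness of regular categories\<close>

context presheaves
begin

lemma presheaf_subcat_small: "universe \<kappa> \<Longrightarrow> presheaf_subcat C \<kappa> {F. small_presheaf \<kappa> C F}"
  by unfold_locales (use small_presheaf_y small_presheaf_iff in blast)+

text \<open>The closure conditions only constrain colimits already given, so one must be exhibited.
  The pointwise image qualifies; it is small because \<open>D\<close> carries a kernel pair of
  \<open>f\<close> in \<open>K\<close> to a kernel pair among small presheaves.\<close>

lemma lex_image_weighted_colimit:
  assumes u: "universe \<kappa>"
    and K: "category K" "finitely_complete K" and X: "X \<in> ob K" and Y: "Y \<in> ob K" and f: "f \<in> hom K X Y"
    and w: "image_weight K X Y f \<phi> e"
    and D: "lex_functor K (small_presheaf_cat \<kappa> C) D"
  obtains H c n \<eta> where "small_presheaf \<kappa> C H" "c \<in> nt (fob D X) H" "n \<in> nt H (fob D Y)"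
    "surj_nt (fob D X) H c" "inj_nt H n"
    "\<And>Z x. \<lbrakk>Z \<in> ob C; x \<in> fob (fob D X) Z\<rbrakk> \<Longrightarrow> n Z (c Z x) = fmap D X Y f Z x"
    "is_weighted_colimit K \<phi> (small_presheaf_cat \<kappa> C) D H \<eta>"
proof -
  let ?T = "{F. small_presheaf \<kappa> C F}"
  interpret presheaf_subcat C \<kappa> ?T by (rule presheaf_subcat_small[OF u])
  interpret K: cat K using K(1) by unfold_locales
  have D': "lex_functor K (PE ?T) D" using D by (simp add: small_presheaf_cat_PE)
  have fD: "is_functor K (PE ?T) D" using D' by (simp add: lex_functor_def)
  have DT: "fob D k \<in> ?T" if "k \<in> ob K" for k using fD that by (simp add: is_functor_def)
  have Df: "fmap D X Y f \<in> nt (fob D X) (fob D Y)" using fD X Y f by (simp add: is_functor_def)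
  obtain R p q where pb: "is_pullback K X X Y f f R p q"
    using K.pullback_exists[OF K(2) X X Y f f] by blast
  note R = K.is_pullbackD(1)[OF pb]
  obtain H c n where H: "psh H" "c \<in> nt (fob D X) H" "n \<in> nt H (fob D Y)" "surj_nt (fob D X) H c" "inj_nt H n"
    and nc: "\<And>Z x. \<lbrakk>Z \<in> ob C; x \<in> fob (fob D X) Z\<rbrakk> \<Longrightarrow> n Z (c Z x) = fmap D X Y f Z x"
    using image_factorisation[OF psh_T[OF DT[OF X]] psh_T[OF DT[OF Y]] Df] by blast
  have small: "small_presheaf \<kappa> C H"
    by (rule small_presheaf_image[OF u _ _ K.lex_functor_pullback[OF D' pb X X Y f f] DT[OF X] DT[OF Y] Df
        H(1,2,4,3,5) nc]) (use DT X R in auto)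
  then have H_small: "H \<in> ?T" by simp
  have "\<exists>\<eta>. is_weighted_colimit K \<phi> (PE ?T) D H \<eta>"
    by (rule image_is_weighted_colimit[OF K X Y f w D' H_small H(2,4,3,5) nc])
  then show thesis
    using that[OF small H(2-5) nc] by (auto simp: small_presheaf_cat_PE)
qed

text \<open>The class of all small presheaves is itself one of the classes being intersected; in
  particular the intersection is not over an empty family.\<close>

lemma Phi_l_ob_subset_small: "Phi_l_ob \<kappa> \<Phi> C \<subseteq> {F. small_presheaf \<kappa> C F}" if u: "universe \<kappa>"
proof -
  let ?T = "{F. small_presheaf \<kappa> C F}"
  have "replete_in (PE ?T) ?T" by (simp add: replete_in_def)
  moreover have "y ` ob C \<subseteq> ?T" using small_presheaf_y[OF u] by blast
  moreover have "closed_under_finite_limits (PE ?T) ?T"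
    by (simp add: closed_under_finite_limits_def is_limit_def is_cone_def)
  moreover have "closed_under_lex_colimits \<Phi> (PE ?T) ?T"
    by (auto simp: closed_under_lex_colimits_def is_weighted_colimit_def weighted_cocone_def)
  ultimately show ?thesis
    unfolding Phi_l_ob_def small_presheaf_cat_PE by blast
qed

lemma y_Phi_l_ob: "X \<in> ob C \<Longrightarrow> y X \<in> Phi_l_ob \<kappa> \<Phi> C"
  unfolding Phi_l_ob_def by blast

lemma presheaf_subcat_Phi_l: "universe \<kappa> \<Longrightarrow> presheaf_subcat C \<kappa> (Phi_l_ob \<kappa> \<Phi> C)"
  using Phi_l_ob_subset_small[of \<Phi>] y_Phi_l_ob[of _ \<Phi>] small_presheaf_iff
  by unfold_locales blast+

end

context regular_presheaves
begin

lemma y_separated: "X \<in> ob C \<Longrightarrow> y X \<in> separated"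
  unfolding separated_def using psh_y dense_y by blast

lemma separated_iso:
  assumes T: "presheaf_subcat C \<kappa> T" and F: "F \<in> separated" "F \<in> T" and G: "G \<in> T"
    and iso: "isomorphic (PE T) F G"
  shows "G \<in> separated"
proof -
  interpret presheaf_subcat C \<kappa> T by (rule T)
  note psh = psh_T[OF F(2)] psh_T[OF G]
  obtain a b where a: "a \<in> nt F G" and b: "b \<in> nt G F" and ab: "vcmp F b a = mknt F (\<lambda>Z x. x)" "vcmp G a b = mknt G (\<lambda>Z x. x)"
    using iso unfolding isomorphic_def iso_in_def by auto
  have ba: "b Z (a Z x) = x" if "Z \<in> ob C" "x \<in> fob F Z" for Z x
    using fun_cong[OF fun_cong[OF ab(1)], of Z x] that by simp
  have ab': "a Z (b Z x) = x" if "Z \<in> ob C" "x \<in> fob G Z" for Z x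
    using fun_cong[OF fun_cong[OF ab(2)], of Z x] that by simp
  obtain I m where m: "dense F I m" using F(1) by (auto simp: separated_def)
  obtain X x where X: "X \<in> ob C" "x \<in> fob F X" "eff_epi X I (m X x)"
    using m unfolding dense_def by blast
  have "dense G I (vcmp G m b)"
    unfolding dense_def
  proof (intro conjI denseD(1)[OF m] vcmp_in[OF psh(2) b denseD(2)[OF m]] bexI[OF _ X(1)] bexI[of _ "a X x"])
    show "a X x \<in> fob G X" using ntD(3)[OF a X(1,2)] .
    then show "eff_epi X I (vcmp G m b X (a X x))" using X ba by simp
    show "inj_nt G (vcmp G m b)"
      unfolding inj_nt_def
    proof (intro ballI inj_onI)
      fix Z u v assume Z: "Z \<in> ob C" "u \<in> fob G Z" "v \<in> fob G Z" "vcmp G m b Z u = vcmp G m b Z v"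
      have "b Z u = b Z v"
        by (rule inj_ntD[OF denseD(3)[OF m] Z(1) ntD(3)[OF b Z(1,2)] ntD(3)[OF b Z(1,3)]])
          (use Z in simp)
      then show "u = v" using ab'[OF Z(1,2)] ab'[OF Z(1,3)] by metis
    qed
  qed
  then show ?thesis using psh(2) by (auto simp: separated_def)
qed

text \<open>Reflect \<open>f\<close> to an arrow \<open>?g\<close> of \<open>C\<close> and let
  \<open>e\<close> be the coequaliser of its kernel pair. The map \<open>F -> y Q\<close> identifies
  the same elements as \<open>c\<close>, so \<open>H\<close> embeds in \<open>y Q\<close>; the sieve
  \<open>H\<close> contains the composite of a cover of \<open>?I\<close> with \<open>e\<close>,
  again a cover.\<close>

lemma separated_image:
  assumes F: "F \<in> separated" and G: "G \<in> separated" and f: "f \<in> nt F G"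
    and H: "psh H" and c: "c \<in> nt F H" "surj_nt F H c" and n: "n \<in> nt H G" "inj_nt H n"
    and nc: "\<And>Z x. \<lbrakk>Z \<in> ob C; x \<in> fob F Z\<rbrakk> \<Longrightarrow> n Z (c Z x) = f Z x"
  shows "H \<in> separated"
proof -
  let ?I = "refl_ob F" and ?J = "refl_ob G" and ?m = "refl_unit F" and ?g = "refl_map F G f"
  note dF = refl_dense[OF F] and dG = refl_dense[OF G]
  note I = denseD(1)[OF dF] and J = denseD(1)[OF dG] and g = refl_map[OF F G f]
  have pF: "psh F" using separated_psh[OF F] .
  obtain R p q where pb: "is_pullback C ?I ?I ?J ?g ?g R p q"
    using pullback_exists[OF complete I I J g(1) g(1)] by blast
  then have kp: "is_kernel_pair C ?I ?J ?g R p q" by (simp add: is_kernel_pair_def)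
  note R = is_pullbackD[OF pb]
  obtain Q e where co: "is_coequaliser C R ?I p q Q e"
    using regular kp I J g(1) unfolding regular_category_def has_coequalisers_of_kernel_pairs_def by blast
  have Q: "Q \<in> ob C" "e \<in> hom C ?I Q"
    and e_eq: "\<And>T r s. \<lbrakk>T \<in> ob C; r \<in> hom C T ?I; s \<in> hom C T ?I; cmp C T ?I ?J ?g r = cmp C T ?I ?J ?g s\<rbrakk> \<Longrightarrow>
        cmp C T ?I Q e r = cmp C T ?I Q e s"
    using co unfolding is_coequaliser_kernel_pair_iff[OF kp I J g(1)] by blast+
  obtain k where k: "k \<in> hom C Q ?J" "cmp C ?I Q ?J k e = ?g"
    using co J g(1) R(4) unfolding is_coequaliser_def by blast
  \<comment> \<open>As \<open>?g\<close> factors through \<open>e\<close>, equality after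
    \<open>e\<close> implies equality after \<open>?g\<close>. With \<open>e_eq\<close>, both arrows
    have the same fibres.\<close>
  have g_eq: "cmp C T ?I ?J ?g r = cmp C T ?I ?J ?g s"
    if T: "T \<in> ob C" "r \<in> hom C T ?I" "s \<in> hom C T ?I" "cmp C T ?I Q e r = cmp C T ?I Q e s" for T r s
    using cmp_assoc[OF T(1) I Q(1) J T(2) Q(2) k(1)] cmp_assoc[OF T(1) I Q(1) J T(3) Q(2) k(1)] T(4) k(2)
    by simp
  have e: "eff_epi ?I Q e"
    by (rule regular_epi_imp_eff_epi[OF I]) (use co R in \<open>auto simp: regular_epi_def\<close>)
  define \<alpha> where "\<alpha> = vcmp F (yoneda_map C ?I Q e) ?m"
  have \<alpha>_in: "\<alpha> \<in> nt F (y Q)"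
    unfolding \<alpha>_def by (rule vcmp_in[OF pF denseD(2)[OF dF] yoneda_map_in[OF I Q]])
  have \<alpha>: "\<alpha> Z x = cmp C Z ?I Q e (?m Z x)" if "Z \<in> ob C" "x \<in> fob F Z" for Z x
    using that dense_hom[OF dF that] by (simp add: \<alpha>_def)
  \<comment> \<open>Fibres are transported along \<open>e\<close>, \<open>?g\<close>, the embedding
    of \<open>G\<close>, and finally the factorisation of \<open>f\<close>, whose second factor
    \<open>n\<close> is injective.\<close>
  have \<alpha>_iff: "\<alpha> Z x = \<alpha> Z x' \<longleftrightarrow> c Z x = c Z x'" if Z: "Z \<in> ob C" "x \<in> fob F Z" "x' \<in> fob F Z" for Z x x'
  proof -
    note m = dense_hom[OF dF Z(1,2)] dense_hom[OF dF Z(1,3)]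
    have "\<alpha> Z x = \<alpha> Z x' \<longleftrightarrow> cmp C Z ?I ?J ?g (?m Z x) = cmp C Z ?I ?J ?g (?m Z x')"
      using \<alpha>[OF Z(1,2)] \<alpha>[OF Z(1,3)] e_eq[OF Z(1) m] g_eq[OF Z(1) m] by auto
    also have "\<dots> \<longleftrightarrow> refl_unit G Z (f Z x) = refl_unit G Z (f Z x')"
      using g(2)[OF Z(1,2)] g(2)[OF Z(1,3)] by simp
    also have "\<dots> \<longleftrightarrow> f Z x = f Z x'"
      using inj_ntD[OF denseD(3)[OF dG] Z(1) ntD(3)[OF f Z(1,2)] ntD(3)[OF f Z(1,3)]] by auto
    also have "\<dots> \<longleftrightarrow> c Z x = c Z x'"
      using inj_ntD[OF n(2) Z(1) ntD(3)[OF c(1) Z(1,2)] ntD(3)[OF c(1) Z(1,3)]] nc[OF Z(1,2)] nc[OF Z(1,3)]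
      by auto
    finally show ?thesis .
  qed
  obtain t where t: "t \<in> nt H (y Q)" "\<And>Z x. \<lbrakk>Z \<in> ob C; x \<in> fob F Z\<rbrakk> \<Longrightarrow> t Z (c Z x) = \<alpha> Z x"
    using factor_through_surj[OF pF H psh_y[OF Q(1)] c \<alpha>_in] \<alpha>_iff by blast
  have "inj_nt H t"
    unfolding inj_nt_def
  proof (intro ballI inj_onI)
    fix Z u v assume Z: "Z \<in> ob C" "u \<in> fob H Z" "v \<in> fob H Z" "t Z u = t Z v"
    obtain x where x: "x \<in> fob F Z" "c Z x = u" using surj_ntE[OF c(2) Z(1,2)] by blast
    obtain x' where x': "x' \<in> fob F Z" "c Z x' = v" using surj_ntE[OF c(2) Z(1,3)] by blast
    show "u = v" using \<alpha>_iff[OF Z(1) x(1) x'(1)] t(2)[OF Z(1) x(1)] t(2)[OF Z(1) x'(1)] Z(4) x(2) x'(2) by simp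
  qed
  moreover obtain X x where X: "X \<in> ob C" "x \<in> fob F X" "eff_epi X ?I (?m X x)"
    using dF unfolding dense_def by blast
  moreover have "eff_epi X Q (t X (c X x))"
    using eff_epi_cmp[OF X(3) e] t(2)[OF X(1,2)] \<alpha>[OF X(1,2)] by simp
  ultimately have "dense H Q t"
    unfolding dense_def using Q(1) t(1) ntD(3)[OF c(1) X(1,2)] by blast
  then show ?thesis using H by (auto simp: separated_def)
qed

end

section \<open>Finite limits of presheaves dense in representables\<close>

locale separated_diagram = regular_presheaves C \<kappa> + presheaf_subcat C \<kappa> T for C :: "('o, 'u) cat" and \<kappa> T +
  fixes J :: "(nat, nat) cat" and D M p
  assumes J: "finite_category J" and D: "is_functor J (PE T) D" and sep: "\<And>j. j \<in> ob J \<Longrightarrow> fob D j \<in> separated"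
    and lim: "is_limit J (PE T) D M p"
begin

abbreviation "I j \<equiv> refl_ob (fob D j)"
abbreviation "m j \<equiv> refl_unit (fob D j)"

lemma diagram_dense: "j \<in> ob J \<Longrightarrow> dense (fob D j) (I j) (m j)"
  using refl_dense[OF sep] .

lemma D_map: "\<lbrakk>i \<in> ob J; j \<in> ob J; u \<in> hom J i j\<rbrakk> \<Longrightarrow> fmap D i j u \<in> nt (fob D i) (fob D j)"
  using D by (simp add: is_functor_def)

lemma apex: "M \<in> T" and leg: "j \<in> ob J \<Longrightarrow> p j \<in> nt M (fob D j)"
  and leg_cone: "\<lbrakk>i \<in> ob J; j \<in> ob J; u \<in> hom J i j; Z \<in> ob C; x \<in> fob M Z\<rbrakk> \<Longrightarrow> fmap D i j u Z (p i Z x) = p j Z x"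
proof -
  have *: "M \<in> T" "\<And>j. j \<in> ob J \<Longrightarrow> p j \<in> nt M (fob D j)"
    "\<And>i j u. \<lbrakk>i \<in> ob J; j \<in> ob J; u \<in> hom J i j\<rbrakk> \<Longrightarrow> vcmp M (fmap D i j u) (p i) = p j"
    using lim by (simp_all add: is_limit_def is_cone_def)
  show "M \<in> T" "j \<in> ob J \<Longrightarrow> p j \<in> nt M (fob D j)" using *(1,2) by blast+
  show "fmap D i j u Z (p i Z x) = p j Z x"
    if "i \<in> ob J" "j \<in> ob J" "u \<in> hom J i j" "Z \<in> ob C" "x \<in> fob M Z"
    using fun_cong[OF fun_cong[OF *(3)[OF that(1-3)]], of Z x] that(4,5) by simp
qed

lemma is_functor_refl_diagram: "is_functor J C (func_comp reflector D)"
proof -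
  \<comment> \<open>\<open>T\<close> may contain presheaves that have no reflection, but the diagram
    takes its values in this smaller subcategory, where \<open>reflector\<close> is a
    functor.\<close>
  have "category (PE (T \<inter> separated))" by (rule category_PE) (use T_psh in blast)
  then have "is_functor J (PE (T \<inter> separated)) D"
    using D sep by (simp add: is_functor_def)
  moreover have "is_functor (PE (T \<inter> separated)) C reflector"
    by (rule is_functor_reflector) blast
  ultimately show ?thesis
    by (simp add: is_functor_def func_comp_def)
qed

text \<open>The legs of the limit are jointly injective on elements, and each embedding
  \<open>m j\<close> is injective.\<close>

lemma limit_elements_eq:
  assumes Z: "Z \<in> ob C" "x \<in> fob M Z" "x' \<in> fob M Z" and eq: "\<And>j. j \<in> ob J \<Longrightarrow> m j Z (p j Z x) = m j Z (p j Z x')"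
  shows "x = x'"
proof -
  have eq': "p j Z x = p j Z x'" if j: "j \<in> ob J" for j
    by (rule inj_ntD[OF denseD(3)[OF diagram_dense[OF j]] Z(1) ntD(3)[OF leg[OF j] Z(1,2)] ntD(3)[OF leg[OF j] Z(1,3)] eq[OF j]])
  have "\<exists>!w. w \<in> fob M Z \<and> (\<forall>j\<in>ob J. p j Z w = p j Z x)"
    by (rule limit_elements[OF lim D Z(1)]) (use ntD(3)[OF leg _ Z(2)] leg_cone Z in simp_all)
  then show ?thesis using Z eq' by metis
qed

text \<open>As \<open>J\<close> has finitely many objects, one cover of \<open>Q\<close> brings
  every leg into its sieve. The resulting elements form a compatible family because each
  \<open>m j\<close> is injective, hence define an element of the limit presheaf.\<close>

lemma cone_lifts_locally:
  assumes cone: "is_cone J C (func_comp reflector D) Q q"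
  obtains W c x where "eff_epi W Q c" "x \<in> fob M W" "\<And>j. j \<in> ob J \<Longrightarrow> m j W (p j W x) = cmp C W Q (I j) (q j) c"
proof -
  have Q: "Q \<in> ob C" "\<And>j. j \<in> ob J \<Longrightarrow> q j \<in> hom C Q (I j)"
    "\<And>i j u. \<lbrakk>i \<in> ob J; j \<in> ob J; u \<in> hom J i j\<rbrakk> \<Longrightarrow> cmp C Q (I i) (I j) (refl_map (fob D i) (fob D j) (fmap D i j u)) (q i) = q j"
    using cone by (simp_all add: is_cone_def func_comp_def reflector_def)
  obtain W c where W: "eff_epi W Q c" "\<forall>j\<in>ob J. \<exists>x\<in>fob (fob D j) W. m j W x = cmp C W Q (I j) (q j) c"
    using dense_common_cover[of "ob J" "fob D" I m Q q] J separated_psh[OF sep] diagram_dense Q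
    unfolding finite_category_def by blast
  note Wc = eff_epiD[OF W(1)]
  obtain x where x: "\<And>j. j \<in> ob J \<Longrightarrow> x j \<in> fob (fob D j) W" "\<And>j. j \<in> ob J \<Longrightarrow> m j W (x j) = cmp C W Q (I j) (q j) c"
    using bchoice[OF W(2)[unfolded Bex_def]] by blast
  have "fmap D i j u W (x i) = x j" if ij: "i \<in> ob J" "j \<in> ob J" "u \<in> hom J i j" for i j u
  proof (rule inj_ntD[OF denseD(3)[OF diagram_dense[OF ij(2)]] Wc(1) ntD(3)[OF D_map[OF ij] Wc(1) x(1)[OF ij(1)]] x(1)[OF ij(2)]])
    note r = refl_map[OF sep[OF ij(1)] sep[OF ij(2)] D_map[OF ij]]
    show "m j W (fmap D i j u W (x i)) = m j W (x j)"
      using r(2)[OF Wc(1) x(1)[OF ij(1)]] x(2)[OF ij(1)] x(2)[OF ij(2)] Q(3)[OF ij]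
        cmp_assoc[OF Wc(1) Q(1) denseD(1)[OF diagram_dense[OF ij(1)]] denseD(1)[OF diagram_dense[OF ij(2)]] Wc(3) Q(2)[OF ij(1)] r(1)]
      by simp
  qed
  then have "\<exists>!w. w \<in> fob M W \<and> (\<forall>j\<in>ob J. p j W w = x j)"
    by (intro limit_elements[OF lim D Wc(1)] x(1))
  then show thesis using that[OF W(1)] x(2) by metis
qed

lemma element_cone:
  assumes Z: "Z \<in> ob C" "x \<in> fob M Z"
  shows "is_cone J C (func_comp reflector D) Z (\<lambda>j. m j Z (p j Z x))"
proof -
  have "cmp C Z (I i) (I j) (refl_map (fob D i) (fob D j) (fmap D i j u)) (m i Z (p i Z x)) = m j Z (p j Z x)"
    if ij: "i \<in> ob J" "j \<in> ob J" "u \<in> hom J i j" for i j u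
    using refl_map(2)[OF sep[OF ij(1)] sep[OF ij(2)] D_map[OF ij] Z(1) ntD(3)[OF leg[OF ij(1)] Z]] leg_cone[OF ij Z]
    by simp
  then show ?thesis
    using Z(1) dense_hom[OF diagram_dense _ ntD(3)[OF leg]] Z by (simp add: is_cone_def func_comp_def reflector_def)
qed

text \<open>Let \<open>P\<close> be the limit in \<open>C\<close> of the reflected diagram. Elements
  of \<open>M\<close> give cones over it, and so arrows into \<open>P\<close>; this embeds
  \<open>M\<close> as a sieve on \<open>P\<close>.\<close>

lemma limit_separated: "M \<in> separated"
proof -
  note G = is_functor_refl_diagram
  obtain P \<pi> where P: "is_limit J C (func_comp reflector D) P \<pi>"
    using complete J G unfolding finitely_complete_def by blast
  have cone: "is_cone J C (func_comp reflector D) P \<pi>" using P by (simp add: is_limit_def)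
  then have PC: "P \<in> ob C" "\<And>j. j \<in> ob J \<Longrightarrow> \<pi> j \<in> hom C P (I j)"
    by (simp_all add: is_cone_def func_comp_def reflector_def)
  have ex: "\<exists>!h. h \<in> hom C Z P \<and> (\<forall>j\<in>ob J. cmp C Z P (I j) (\<pi> j) h = m j Z (p j Z x))"
    if "Z \<in> ob C" "x \<in> fob M Z" for Z x
    using P element_cone[OF that] by (simp add: is_limit_def func_comp_def reflector_def)
  let ?P = "\<lambda>Z x h. \<forall>j\<in>ob J. cmp C Z P (I j) (\<pi> j) h = m j Z (p j Z x)"
  have "\<exists>!\<mu>. \<mu> \<in> nt M (y P) \<and> (\<forall>Z\<in>ob C. \<forall>x\<in>fob M Z. ?P Z x (\<mu> Z x))"
  proof (rule nt_by_unique_choice[OF psh_T[OF apex] psh_y[OF PC(1)]])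
    show "\<exists>!h. h \<in> fob (y P) Z \<and> ?P Z x h" if "Z \<in> ob C" "x \<in> fob M Z" for Z x
      using ex[OF that] by simp
    fix Z Z' g x h assume Z: "Z \<in> ob C" "Z' \<in> ob C" "g \<in> hom C Z' Z" "x \<in> fob M Z"
      and "h \<in> fob (y P) Z" and Ph: "?P Z x h"
    then have h: "h \<in> hom C Z P" by simp
    have "cmp C Z' P (I j) (\<pi> j) (cmp C Z' Z P h g) = m j Z' (p j Z' (fmap M Z Z' g x))" if j: "j \<in> ob J" for j
      using cmp_assoc[OF Z(2,1) PC(1) denseD(1)[OF diagram_dense[OF j]] Z(3) h PC(2)[OF j]] Ph j
        nt_natural[OF leg[OF j] Z] dense_natural[OF diagram_dense[OF j] Z(1-3) ntD(3)[OF leg[OF j] Z(1,4)]] by simp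
    then show "?P Z' (fmap M Z Z' g x) (fmap (y P) Z Z' g h)" using h by simp
  qed
  then obtain \<mu> where \<mu>: "\<mu> \<in> nt M (y P)" "\<And>Z x. \<lbrakk>Z \<in> ob C; x \<in> fob M Z\<rbrakk> \<Longrightarrow> ?P Z x (\<mu> Z x)"
    by blast
  have "inj_nt M \<mu>"
    unfolding inj_nt_def
  proof (intro ballI inj_onI)
    fix Z x x' assume Z: "Z \<in> ob C" "x \<in> fob M Z" "x' \<in> fob M Z" "\<mu> Z x = \<mu> Z x'"
    show "x = x'"
      by (rule limit_elements_eq[OF Z(1-3)]) (use \<mu>(2)[OF Z(1,2)] \<mu>(2)[OF Z(1,3)] Z(4) in simp)
  qed
  \<comment> \<open>Local lifting is applied to the limit cone itself. Uniqueness of the mediating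
    arrow then forces \<open>\<mu> W x = c\<close>, so the cover \<open>c\<close> of
    \<open>P\<close> belongs to the sieve.\<close>
  moreover obtain W c x where W: "eff_epi W P c" "x \<in> fob M W"
      "\<And>j. j \<in> ob J \<Longrightarrow> m j W (p j W x) = cmp C W P (I j) (\<pi> j) c"
    using cone_lifts_locally[OF cone] by blast
  note Wc = eff_epiD[OF W(1)]
  have "\<mu> W x \<in> hom C W P" using ntD(3)[OF \<mu>(1) Wc(1) W(2)] by simp
  then have "\<mu> W x = c" using ex[OF Wc(1) W(2)] \<mu>(2)[OF Wc(1) W(2)] W(3) Wc(3) by metis
  ultimately have "dense M P \<mu>"
    unfolding dense_def using PC(1) \<mu>(1) Wc(1) W(1,2) by blast
  then show ?thesis using psh_T[OF apex] by (auto simp: separated_def)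
qed

text \<open>The chosen reflection \<open>refl_ob M\<close> need not be the limit used in
  \<open>limit_separated\<close>, so its universal property is verified directly: a mediating arrow
  exists on a cover and descends, and two of them are compared on a cover.\<close>

lemma reflector_preserves_limit:
  "is_limit J C (func_comp reflector D) (fob reflector M) (\<lambda>j. fmap reflector M (fob D j) (p j))"
proof -
  let ?G = "func_comp reflector D" and ?L = "refl_ob M" and ?\<pi> = "\<lambda>j. refl_map M (fob D j) (p j)"
  let ?\<eta> = "refl_unit M"
  note Ms = limit_separated
  note dM = refl_dense[OF Ms]
  note L = denseD(1)[OF dM]
  note Ij = denseD(1)[OF diagram_dense]
  note \<pi> = refl_map[OF Ms sep leg]
  have "cmp C ?L (I i) (I j) (refl_map (fob D i) (fob D j) (fmap D i j u)) (?\<pi> i) = ?\<pi> j"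
    if ij: "i \<in> ob J" "j \<in> ob J" "u \<in> hom J i j" for i j u
  proof (rule sym, rule refl_map_unique[OF Ms sep[OF ij(2)]])
    note r = refl_map[OF sep[OF ij(1)] sep[OF ij(2)] D_map[OF ij]]
    show "cmp C ?L (I i) (I j) (refl_map (fob D i) (fob D j) (fmap D i j u)) (?\<pi> i) \<in> hom C ?L (I j)"
      using L Ij[OF ij(1)] Ij[OF ij(2)] r(1) \<pi>(1)[OF ij(1,1)] by simp
    fix W x assume W: "W \<in> ob C" "x \<in> fob M W"
    show "cmp C W ?L (I j) (cmp C ?L (I i) (I j) (refl_map (fob D i) (fob D j) (fmap D i j u)) (?\<pi> i)) (?\<eta> W x)
        = m j W (p j W x)"
      using cmp_assoc[OF W(1) L Ij[OF ij(1)] Ij[OF ij(2)] dense_hom[OF dM W] \<pi>(1)[OF ij(1,1)] r(1)]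
        \<pi>(2)[OF ij(1,1) W] r(2)[OF W(1) ntD(3)[OF leg[OF ij(1)] W]] leg_cone[OF ij W] by simp
  qed
  then have cone: "is_cone J C ?G ?L ?\<pi>"
    using L \<pi>(1) by (simp add: is_cone_def func_comp_def reflector_def)
  have "\<exists>!h. h \<in> hom C Q ?L \<and> (\<forall>j\<in>ob J. cmp C Q ?L (I j) (?\<pi> j) h = q j)" if q: "is_cone J C ?G Q q" for Q q
  proof (rule ex_ex1I)
    have Q: "Q \<in> ob C" "\<And>j. j \<in> ob J \<Longrightarrow> q j \<in> hom C Q (I j)"
      using q by (simp_all add: is_cone_def func_comp_def reflector_def)
    obtain W c x where W: "eff_epi W Q c" "x \<in> fob M W"
        "\<And>j. j \<in> ob J \<Longrightarrow> m j W (p j W x) = cmp C W Q (I j) (q j) c"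
      using cone_lifts_locally[OF q] by blast
    note Wc = eff_epiD[OF W(1)]
    have \<eta>x: "?\<eta> W x \<in> hom C W ?L" using dense_hom[OF dM Wc(1) W(2)] .
    \<comment> \<open>Descent data for the locally defined mediating arrow: \<open>r\<close> and
      \<open>s\<close> restrict \<open>x\<close> to elements with equal images under all
      legs.\<close>
    have "cmp C V W ?L (?\<eta> W x) r = cmp C V W ?L (?\<eta> W x) s"
      if V: "V \<in> ob C" "r \<in> hom C V W" "s \<in> hom C V W" "cmp C V W Q c r = cmp C V W Q c s" for V r s
    proof -
      have eq: "m j V (p j V (fmap M W V r x)) = m j V (p j V (fmap M W V s x))" if j: "j \<in> ob J" for j
      proof -
        have "m j V (p j V (fmap M W V g x)) = cmp C V Q (I j) (q j) (cmp C V W Q c g)" if "g \<in> hom C V W" for g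
          using nt_natural[OF leg[OF j] Wc(1) V(1) that W(2)] W(3)[OF j]
            dense_natural[OF diagram_dense[OF j] Wc(1) V(1) that ntD(3)[OF leg[OF j] Wc(1) W(2)]]
            cmp_assoc[OF V(1) Wc(1,2) Ij[OF j] that Wc(3) Q(2)[OF j]] by simp
        then show ?thesis using V(2-4) by simp
      qed
      have "fmap M W V r x = fmap M W V s x"
        by (rule limit_elements_eq[OF V(1) psh_in[OF psh_T[OF apex] Wc(1) V(1,2) W(2)]
          psh_in[OF psh_T[OF apex] Wc(1) V(1,3) W(2)] eq])
      then show ?thesis
        using dense_natural[OF dM Wc(1) V(1,2) W(2)] dense_natural[OF dM Wc(1) V(1,3) W(2)] by simp
    qed
    then obtain h where h: "h \<in> hom C Q ?L" "cmp C W Q ?L h c = ?\<eta> W x"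
      using eff_epi_descend[OF W(1) L \<eta>x] by blast
    have "cmp C Q ?L (I j) (?\<pi> j) h = q j" if j: "j \<in> ob J" for j
    proof (rule eff_epi_cancel[OF W(1) Ij[OF j] cmp_hom[OF Q(1) L Ij[OF j] h(1) \<pi>(1)[OF j j]] Q(2)[OF j]])
      show "cmp C W Q (I j) (cmp C Q ?L (I j) (?\<pi> j) h) c = cmp C W Q (I j) (q j) c"
        using cmp_assoc[OF Wc(1) Q(1) L Ij[OF j] Wc(3) h(1) \<pi>(1)[OF j j]] h(2)
          \<pi>(2)[OF j j Wc(1) W(2)] W(3)[OF j] by simp
    qed
    then show "\<exists>h. h \<in> hom C Q ?L \<and> (\<forall>j\<in>ob J. cmp C Q ?L (I j) (?\<pi> j) h = q j)" using h(1) by blast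
    fix h k
    assume h: "h \<in> hom C Q ?L \<and> (\<forall>j\<in>ob J. cmp C Q ?L (I j) (?\<pi> j) h = q j)"
      and k: "k \<in> hom C Q ?L \<and> (\<forall>j\<in>ob J. cmp C Q ?L (I j) (?\<pi> j) k = q j)"
    \<comment> \<open>First \<open>h\<close> and then \<open>k\<close> is turned into an element of
      \<open>M\<close> by passing to a cover; over \<open>V\<close> both are elements, to which
      \<open>limit_elements_eq\<close> applies.\<close>
    obtain W c x where W: "eff_epi W Q c" "x \<in> fob M W" "?\<eta> W x = cmp C W Q ?L h c"
      using dense_local[OF psh_T[OF apex] dM Q(1) conjunct1[OF h]] by blast
    note Wc = eff_epiD[OF W(1)]
    have kc: "cmp C W Q ?L k c \<in> hom C W ?L" using Wc Q(1) L k by simp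
    obtain V d' z where V: "eff_epi V W d'" "z \<in> fob M V" "?\<eta> V z = cmp C V W ?L (cmp C W Q ?L k c) d'"
      using dense_local[OF psh_T[OF apex] dM Wc(1) kc] by blast
    note Vd = eff_epiD[OF V(1)]
    let ?cd = "cmp C V W Q c d'"
    have cd: "?cd \<in> hom C V Q" using Vd Wc by simp
    have zk: "?\<eta> V z = cmp C V Q ?L k ?cd"
      using V(3) cmp_assoc[OF Vd(1) Wc(1,2) L Vd(3) Wc(3) conjunct1[OF k]] by simp
    have xV: "fmap M W V d' x \<in> fob M V" using psh_in[OF psh_T[OF apex] Wc(1) Vd(1,3) W(2)] .
    have xh: "?\<eta> V (fmap M W V d' x) = cmp C V Q ?L h ?cd"
      using dense_natural[OF dM Wc(1) Vd(1,3) W(2)] W(3)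
        cmp_assoc[OF Vd(1) Wc(1,2) L Vd(3) Wc(3) conjunct1[OF h]] by simp
    have eq: "m j V (p j V (fmap M W V d' x)) = m j V (p j V z)" if j: "j \<in> ob J" for j
      using \<pi>(2)[OF j j Vd(1) xV] \<pi>(2)[OF j j Vd(1) V(2)] xh zk h k j
        cmp_assoc[OF Vd(1) Q(1) L Ij[OF j] cd conjunct1[OF h] \<pi>(1)[OF j j]]
        cmp_assoc[OF Vd(1) Q(1) L Ij[OF j] cd conjunct1[OF k] \<pi>(1)[OF j j]] by simp
    have "fmap M W V d' x = z"
      by (rule limit_elements_eq[OF Vd(1) xV V(2) eq])
    then have "cmp C V Q ?L h ?cd = cmp C V Q ?L k ?cd" using xh zk by simp
    then show "h = k"
      by (rule eff_epi_cancel[OF eff_epi_cmp[OF V(1) W(1)] L conjunct1[OF h] conjunct1[OF k]])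
  qed
  then show ?thesis
    using cone by (simp add: is_limit_def func_comp_def reflector_def)
qed

end

section \<open>The lex reflection on the closure of the representables\<close>

context regular_presheaves
begin

text \<open>The small presheaves dense in a representable form one of the classes whose intersection
  defines \<open>Phi_l_ob\<close>.\<close>

lemma Phi_l_ob_separated:
  assumes u: "universe \<kappa>" and \<Phi>: "is_Phi_reg \<kappa> \<Phi>"
  shows "Phi_l_ob \<kappa> \<Phi> C \<subseteq> separated"
proof -
  let ?T = "{F. small_presheaf \<kappa> C F}"
  let ?S = "?T \<inter> separated"
  interpret T: presheaf_subcat C \<kappa> ?T by (rule presheaf_subcat_small[OF u])
  have "replete_in (PE ?T) ?S"
    using separated_iso[OF T.presheaf_subcat_axioms] by (auto simp: replete_in_def)
  moreover have "y ` ob C \<subseteq> ?S"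
    using small_presheaf_y[OF u] y_separated by blast
  moreover have "closed_under_finite_limits (PE ?T) ?S"
    unfolding closed_under_finite_limits_def
  proof (intro allI impI)
    fix J :: "(nat, nat) cat" and D M p
    assume a: "finite_category J" "is_functor J (PE ?T) D" "\<forall>j\<in>ob J. fob D j \<in> ?S" "is_limit J (PE ?T) D M p"
    interpret R: separated_diagram C \<kappa> ?T J D M p
      by unfold_locales (use a in blast)+
    show "M \<in> ?S" using R.apex R.limit_separated by blast
  qed
  moreover have "closed_under_lex_colimits \<Phi> (PE ?T) ?S"
  proof -
    obtain K X Y f \<phi> e where \<Phi>_eq: "\<Phi> = {(K, \<phi>)}" and free: "free_lex_on_arrow \<kappa> K X Y f"
      and w: "image_weight K X Y f \<phi> e"
      using Phi_reg_weight[OF \<Phi>] by blast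
    have K: "category K" "finitely_complete K" and XY: "X \<in> ob K" "Y \<in> ob K" "f \<in> hom K X Y"
      using free by (auto simp: free_lex_on_arrow_def small_category_def)
    have "L \<in> ?S" if D: "lex_functor K (PE ?T) D" and DS: "\<And>k. k \<in> ob K \<Longrightarrow> fob D k \<in> ?S"
      and L: "is_weighted_colimit K \<phi> (PE ?T) D L \<eta>" for D L \<eta>
    proof -
      have fD: "is_functor K (PE ?T) D" using D by (simp add: lex_functor_def)
      obtain H c n \<theta> where H: "small_presheaf \<kappa> C H" "c \<in> nt (fob D X) H" "n \<in> nt H (fob D Y)"
          "surj_nt (fob D X) H c" "inj_nt H n"
          "\<And>Z x. \<lbrakk>Z \<in> ob C; x \<in> fob (fob D X) Z\<rbrakk> \<Longrightarrow> n Z (c Z x) = fmap D X Y f Z x"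
          "is_weighted_colimit K \<phi> (PE ?T) D H \<theta>"
        using lex_image_weighted_colimit[OF u K XY w, of D] D unfolding small_presheaf_cat_PE by blast
      have Df: "fmap D X Y f \<in> nt (fob D X) (fob D Y)" using fD XY by (simp add: is_functor_def)
      have Hs: "H \<in> separated"
        by (rule separated_image[OF _ _ Df _ H(2,4,3,5,6)]) (use DS XY H(1) small_presheaf_iff in auto)
      have LT: "L \<in> ?T" using L by (simp add: is_weighted_colimit_def weighted_cocone_def)
      \<comment> \<open>The given colimit is arbitrary, whereas density is known for the pointwise
        image; it is carried across the isomorphism.\<close>
      have "isomorphic (PE ?T) H L"
        by (rule weighted_colimit_isomorphic[OF category_PE[OF T.T_psh] _ H(7) L]) (use DS in auto)
      then show ?thesis
        using separated_iso[OF T.presheaf_subcat_axioms Hs _ LT] H(1) LT by simp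
    qed
    then show ?thesis
      unfolding closed_under_lex_colimits_def \<Phi>_eq by (simp only: ball_simps prod.case simp_thms) blast
  qed
  ultimately show ?thesis
    unfolding Phi_l_ob_def small_presheaf_cat_PE by blast
qed

lemma Phi_exact_if_regular:
  assumes u: "universe \<kappa>" and \<Phi>: "is_Phi_reg \<kappa> \<Phi>"
  shows "Phi_exact \<kappa> \<Phi> C"
proof -
  let ?T = "Phi_l_ob \<kappa> \<Phi> C"
  note sep = Phi_l_ob_separated[OF u \<Phi>]
  interpret T: presheaf_subcat C \<kappa> ?T by (rule presheaf_subcat_Phi_l[OF u])
  have "is_limit J C (func_comp reflector D) (fob reflector M) (\<lambda>j. fmap reflector M (fob D j) (p j))"
    if a: "finite_category J" "is_functor J (PE ?T) D" "is_limit J (PE ?T) D M p"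
    for J :: "(nat, nat) cat" and D M p
  proof -
    have "fob D j \<in> ?T" if "j \<in> ob J" for j using a(2) that by (simp add: is_functor_def)
    \<comment> \<open>Here limits are taken in the smaller subcategory on \<open>Phi_l_ob\<close>;
      since it contains the representables, they are still pointwise.\<close>
    then interpret R: separated_diagram C \<kappa> ?T J D M p
      by unfold_locales (use a sep in blast)+
    show ?thesis by (rule R.reflector_preserves_limit)
  qed
  then have "lex_functor (PE ?T) C reflector"
    using is_functor_reflector[OF sep] by (simp add: lex_functor_def)
  then show ?thesis
    unfolding Phi_exact_def Phi_l_PE using complete adjunction_reflector[OF sep T.T_y] by blast
qed

end

section \<open>Small finitely complete subcategories\<close>

lemma small_UN:
  assumes "universe \<kappa>" "small \<kappa> I" "\<And>i. i \<in> I \<Longrightarrow> small \<kappa> (A i)"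
  shows "small \<kappa> (\<Union>i\<in>I. A i)"
  using universe_Cinfinite[OF assms(1)] assms
    card_of_UNION_ordLess_infinite_Field_regularCard[of \<kappa> I A]
  by (simp add: small_def universe_def)

lemma small_Times:
  assumes "universe \<kappa>" "small \<kappa> A" "small \<kappa> B"
  shows "small \<kappa> (A \<times> B)"
proof -
  have "A \<times> B = (\<Union>a\<in>A. Pair a ` B)" by auto
  then show ?thesis using small_UN[OF assms(1,2) small_image[OF assms(3)], of Pair] by metis
qed

lemma small_countable:
  assumes "universe \<kappa>"
  shows "small \<kappa> (UNIV :: nat set)"
  using assms card_of_nat ordIso_ordLess_trans unfolding small_def universe_def by blast

text \<open>Finite subsets are ranges of lists. Lists of each length form a small set, and the union
  over all lengths is small because the regular cardinal \<open>\<kappa>\<close> exceeds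
  \<open>natLeq\<close>.\<close>

lemma small_Fpow:
  assumes u: "universe \<kappa>" and A: "small \<kappa> A"
  shows "small \<kappa> (Fpow A)"
proof -
  have lists: "small \<kappa> {xs. set xs \<subseteq> A \<and> length xs = n}" for n
  proof (induction n)
    case 0
    have "{xs. set xs \<subseteq> A \<and> length xs = 0} = {[]}" by auto
    then show ?case by (simp add: small_finite[OF u])
  next
    case (Suc n)
    have "{xs. set xs \<subseteq> A \<and> length xs = Suc n} = (\<lambda>(x, xs). x # xs) ` (A \<times> {xs. set xs \<subseteq> A \<and> length xs = n})"
      by (auto simp: length_Suc_conv image_iff)
    then show ?case using small_image[OF small_Times[OF u A Suc]] by simp
  qed
  have sub: "Fpow A \<subseteq> set ` (\<Union>n. {xs. set xs \<subseteq> A \<and> length xs = n})"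
  proof
    fix B assume "B \<in> Fpow A"
    then obtain xs where "set xs = B" "B \<subseteq> A" by (auto simp: Fpow_def dest: finite_list)
    then show "B \<in> set ` (\<Union>n. {xs. set xs \<subseteq> A \<and> length xs = n})" by auto
  qed
  show ?thesis
    by (rule small_subset[OF small_image[OF small_UN[OF u small_countable[OF u] lists]] sub])
qed

text \<open>Being a limit of \<open>D\<close> depends only on this finite piece of data.\<close>

definition diagram_code ::
  "('j, 'i) cat \<Rightarrow> ('j, 'i, 'o, 'm) func \<Rightarrow> ('j \<times> 'o) set \<times> (('j \<times> 'j \<times> 'i) \<times> 'm) set" where
  "diagram_code J D = ((\<lambda>j. (j, fob D j)) ` ob J,
     {((i, j, u), fmap D i j u) | i j u. i \<in> ob J \<and> j \<in> ob J \<and> u \<in> hom J i j})"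

text \<open>The tags in the code recover the objects and hom-sets of the shape together with the
  values of the diagram. Identities and composition of the shape do not enter
  \<open>is_limit\<close>.\<close>

lemma is_limit_cong_code:
  assumes "diagram_code J D = diagram_code J' D'" "is_limit J C D L p"
  shows "is_limit J' C D' L p"
proof -
  have ob: "(\<lambda>j. (j, fob D j)) ` ob J = (\<lambda>j. (j, fob D' j)) ` ob J'"
    and ar: "{((i, j, u), fmap D i j u) | i j u. i \<in> ob J \<and> j \<in> ob J \<and> u \<in> hom J i j} =
      {((i, j, u), fmap D' i j u) | i j u. i \<in> ob J' \<and> j \<in> ob J' \<and> u \<in> hom J' i j}"
    using assms(1) by (simp_all add: diagram_code_def)
  have J: "ob J = ob J'" using arg_cong[OF ob, of "image fst"] by (simp add: image_image)
  have D: "fob D j = fob D' j" if "j \<in> ob J" for j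
  proof -
    have "(j, fob D j) \<in> (\<lambda>j. (j, fob D' j)) ` ob J'" using that ob by blast
    then show ?thesis by auto
  qed
  have hom: "u \<in> hom J i j \<longleftrightarrow> u \<in> hom J' i j" and fmap: "u \<in> hom J i j \<Longrightarrow> fmap D i j u = fmap D' i j u"
    if "i \<in> ob J" "j \<in> ob J" for i j u
  proof -
    have *: "i \<in> ob J \<and> j \<in> ob J \<and> u \<in> hom J i j \<and> x = fmap D i j u \<longleftrightarrow>
        i \<in> ob J' \<and> j \<in> ob J' \<and> u \<in> hom J' i j \<and> x = fmap D' i j u" for x
      using arg_cong[OF ar, of "\<lambda>A. ((i, j, u), x) \<in> A"] by auto
    show "u \<in> hom J i j \<longleftrightarrow> u \<in> hom J' i j" using *[of "fmap D i j u"] *[of "fmap D' i j u"] that J by auto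
    show "fmap D i j u = fmap D' i j u" if "u \<in> hom J i j" using *[of "fmap D i j u"] that \<open>i \<in> ob J\<close> \<open>j \<in> ob J\<close> by auto
  qed
  have cone: "is_cone J C D M q \<longleftrightarrow> is_cone J' C D' M q" for M q
    unfolding is_cone_def J[symmetric]
    by (intro conj_cong ball_cong refl iffI ballI; use D hom fmap in fastforce)
  show ?thesis
    using assms(2) D unfolding is_limit_def cone J[symmetric] by (simp cong: ball_cong)
qed

context presheaves
begin

text \<open>Diagrams take arbitrary values outside their shape and need not form a small set, so a
  limit is chosen per code. A finite diagram in the union of the countably many stages already lies
  in one of them, and its limit is adjoined at the next.\<close>

lemma small_lex_closure:
  assumes u: "universe \<kappa>" and fc: "finitely_complete C" and V: "V \<subseteq> ob C" "finite V"
  obtains U where "V \<subseteq> U" "U \<subseteq> ob C" "small \<kappa> U"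
    "\<And>(J :: (nat, nat) cat) D. \<lbrakk>finite_category J; is_functor J C D; \<And>j. j \<in> ob J \<Longrightarrow> fob D j \<in> U\<rbrakk>
       \<Longrightarrow> \<exists>L\<in>U. \<exists>p. is_limit J C D L p"
proof -
  define lims where "lims c L \<longleftrightarrow> (\<exists>(J :: (nat, nat) cat) D p. finite_category J \<and> is_functor J C D \<and>
      diagram_code J D = c \<and> is_limit J C D L p)" for c L
  \<comment> \<open>The two factors bound the finite sets of tagged objects and tagged arrows of
    diagrams in \<open>A\<close>; both are small when \<open>A\<close> is.\<close>
  define step where "step A = A \<union> (\<lambda>c. SOME L. lims c L) ` {c \<in> Fpow (UNIV \<times> A) \<times>
      Fpow (UNIV \<times> (\<Union>X\<in>A. \<Union>Y\<in>A. hom C X Y)). \<exists>L. lims c L}" for A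
  define S where "S n = (step ^^ n) V" for n
  have S_Suc: "S (Suc n) = step (S n)" and S_0: "S 0 = V" for n by (simp_all add: S_def)
  have S_ob: "S n \<subseteq> ob C" for n
  proof (induction n)
    case (Suc n)
    have "(SOME L. lims c L) \<in> ob C" if "\<exists>L. lims c L" for c
    proof -
      have "lims c (SOME L. lims c L)" using someI_ex[OF that] .
      then show ?thesis unfolding lims_def is_limit_def is_cone_def by blast
    qed
    then show ?case using Suc unfolding S_Suc step_def by blast
  qed (use V S_0 in simp)
  have nat: "small \<kappa> (UNIV :: nat set)" by (rule small_countable[OF u])
  have nat3: "small \<kappa> (UNIV :: (nat \<times> nat \<times> nat) set)"
    using small_Times[OF u nat small_Times[OF u nat nat]] by simp
  have S_small: "small \<kappa> (S n)" for n
  proof (induction n)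
    case 0
    then show ?case using small_finite[OF u V(2)] S_0 by simp
  next
    case (Suc n)
    have hom: "small \<kappa> (\<Union>X\<in>S n. \<Union>Y\<in>S n. hom C X Y)"
      by (intro small_UN[OF u] Suc) (use locally_small S_ob in \<open>auto simp: locally_small_def\<close>)
    note Fpow = small_Times[OF u small_Fpow[OF u small_Times[OF u nat Suc]]
      small_Fpow[OF u small_Times[OF u nat3 hom]]]
    show ?case
      unfolding S_Suc step_def by (rule small_Un[OF u Suc small_image[OF small_subset[OF Fpow]]]) blast
  qed
  have mono: "S i \<subseteq> S j" if "i \<le> j" for i j
    using that by (rule lift_Suc_mono_le[rotated]) (auto simp: S_Suc step_def)
  show thesis
  proof (rule that[of "\<Union>n. S n"])
    show "V \<subseteq> (\<Union>n. S n)" using S_0 by blast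
    show "(\<Union>n. S n) \<subseteq> ob C" using S_ob by blast
    show "small \<kappa> (\<Union>n. S n)" by (rule small_UN[OF u nat S_small])
    fix J :: "(nat, nat) cat" and D
    assume J: "finite_category J" and D: "is_functor J C D" and DU: "\<And>j. j \<in> ob J \<Longrightarrow> fob D j \<in> (\<Union>n. S n)"
    have fin: "finite (ob J)" "\<And>i j. \<lbrakk>i \<in> ob J; j \<in> ob J\<rbrakk> \<Longrightarrow> finite (hom J i j)"
      using J by (simp_all add: finite_category_def)
    have "\<forall>j\<in>ob J. \<exists>n. fob D j \<in> S n" using DU by blast
    then obtain N where N: "\<And>j. j \<in> ob J \<Longrightarrow> fob D j \<in> S (N j)" by metis
    \<comment> \<open>A stage containing the whole diagram. For empty \<open>J\<close> the value is
      unspecified, but then nothing is asked of it.\<close>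
    define n where "n = Max (N ` ob J)"
    have Dn: "fob D j \<in> S n" if "j \<in> ob J" for j
      using N[OF that] mono[of "N j" n] fin(1) that by (auto simp: n_def)
    have Dm: "fmap D i j u \<in> (\<Union>X\<in>S n. \<Union>Y\<in>S n. hom C X Y)" if "i \<in> ob J" "j \<in> ob J" "u \<in> hom J i j" for i j u
      using D Dn that unfolding is_functor_def by blast
    let ?c = "diagram_code J D"
    have "{((i, j, u), fmap D i j u) | i j u. i \<in> ob J \<and> j \<in> ob J \<and> u \<in> hom J i j} =
        (\<Union>i\<in>ob J. \<Union>j\<in>ob J. (\<lambda>u. ((i, j, u), fmap D i j u)) ` hom J i j)" by auto
    then have "finite {((i, j, u), fmap D i j u) | i j u. i \<in> ob J \<and> j \<in> ob J \<and> u \<in> hom J i j}"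
      using fin by simp
    moreover have "{((i, j, u), fmap D i j u) | i j u. i \<in> ob J \<and> j \<in> ob J \<and> u \<in> hom J i j}
        \<subseteq> UNIV \<times> (\<Union>X\<in>S n. \<Union>Y\<in>S n. hom C X Y)"
      by clarify (intro conjI UNIV_I Dm)
    moreover have "(\<lambda>j. (j, fob D j)) ` ob J \<subseteq> UNIV \<times> S n" using Dn by auto
    ultimately have code: "?c \<in> Fpow (UNIV \<times> S n) \<times> Fpow (UNIV \<times> (\<Union>X\<in>S n. \<Union>Y\<in>S n. hom C X Y))"
      unfolding diagram_code_def Fpow_def by (intro SigmaI CollectI conjI finite_imageI fin(1))
    obtain L p where "is_limit J C D L p" using fc J D unfolding finitely_complete_def by blast
    then have ex: "\<exists>L. lims ?c L" using J D unfolding lims_def by blast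
    let ?L = "SOME L. lims ?c L"
    have "?L \<in> S (Suc n)" unfolding S_Suc step_def by (intro UnI2 imageI CollectI conjI code ex)
    \<comment> \<open>The chosen object is a limit of some diagram with the same code, hence of
      \<open>D\<close>.\<close>
    moreover obtain J' :: "(nat, nat) cat" and D' p' where "diagram_code J' D' = ?c" "is_limit J' C D' ?L p'"
      using someI_ex[OF ex] unfolding lims_def by blast
    then have "is_limit J C D ?L p'" by (rule is_limit_cong_code)
    ultimately show "\<exists>L\<in>\<Union>n. S n. \<exists>p. is_limit J C D L p" by blast
  qed
qed

end

section \<open>Renaming the objects of a full subcategory\<close>

definition inverse_image_cat :: "('o, 'm) cat \<Rightarrow> 'p set \<Rightarrow> ('p \<Rightarrow> 'o) \<Rightarrow> ('p, 'm) cat" where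
  "inverse_image_cat C N v = \<lparr>ob = N, hom = (\<lambda>a b. hom C (v a) (v b)), ide = (\<lambda>a. ide C (v a)),
     cmp = (\<lambda>a b c. cmp C (v a) (v b) (v c))\<rparr>"

definition inverse_image_proj :: "('p \<Rightarrow> 'o) \<Rightarrow> ('p, 'm, 'o, 'm) func" where
  "inverse_image_proj v = \<lparr>fob = v, fmap = (\<lambda>_ _ f. f)\<rparr>"

text \<open>The image of \<open>v\<close> contains some limit of each finite diagram in it, not all
  of them: it is not assumed replete. This is what a closure under chosen limits provides.\<close>

locale lex_inverse_image = cat C for C :: "('o, 'm) cat" +
  fixes N :: "'p set" and v :: "'p \<Rightarrow> 'o"
  assumes v: "v ` N \<subseteq> ob C"
    and lim: "\<And>(J :: (nat, nat) cat) D. \<lbrakk>finite_category J; is_functor J C D; \<And>j. j \<in> ob J \<Longrightarrow> fob D j \<in> v ` N\<rbrakk>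
       \<Longrightarrow> \<exists>L\<in>v ` N. \<exists>p. is_limit J C D L p"
begin

abbreviation "B \<equiv> inverse_image_cat C N v"
abbreviation "V \<equiv> inverse_image_proj v"

lemma V_simps: "fob V = v" "fmap V a b f = f" "ob B = N" "hom B a b = hom C (v a) (v b)"
  "cmp B a b c = cmp C (v a) (v b) (v c)" "ide B a = ide C (v a)"
  by (simp_all add: inverse_image_proj_def inverse_image_cat_def)

lemma v_ob: "a \<in> N \<Longrightarrow> v a \<in> ob C"
  using v by blast

lemma category_B: "category B"
  unfolding category_def V_simps by (intro conjI ballI) (simp_all add: v_ob cmp_assoc)

lemma is_functor_V: "is_functor B C V"
  unfolding is_functor_def V_simps using category category_B v_ob by (intro conjI ballI) simp_all

lemma V_diagram: "is_functor J B D \<Longrightarrow> is_functor J C (func_comp V D)"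
  using is_functor_V by (simp add: is_functor_def func_comp_def)

lemma B_limit:
  assumes J: "finite_category J" and D: "is_functor (J :: (nat, nat) cat) B D"
  obtains n p where "n \<in> N" "is_limit J C (func_comp V D) (v n) p" "is_limit J B D n p"
proof -
  have "fob (func_comp V D) j \<in> v ` N" if "j \<in> ob J" for j
    using D that by (simp add: is_functor_def func_comp_def V_simps)
  then obtain n p where n: "n \<in> N" "is_limit J C (func_comp V D) (v n) p"
    using lim[OF J V_diagram[OF D]] by blast
  have cone: "is_cone J B D m q \<longleftrightarrow> m \<in> N \<and> is_cone J C (func_comp V D) (v m) q" for m q
    using v by (auto simp: is_cone_def func_comp_def V_simps)
  have "is_limit J B D n p"
    using n unfolding is_limit_def cone by (simp add: func_comp_def V_simps)
  then show thesis using that n by blast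
qed

lemma finitely_complete_B: "finitely_complete B"
  unfolding finitely_complete_def using category_B B_limit by blast

text \<open>A limit in the renamed category is compared with the limit known to lie in the image and
  to be one in \<open>C\<close> as well. The two are isomorphic, and the isomorphism transports
  universality against all cones of \<open>C\<close>.\<close>

lemma lex_V: "lex_functor B C V"
  unfolding lex_functor_def
proof (intro conjI is_functor_V allI impI)
  fix J :: "(nat, nat) cat" and D l p
  assume J: "finite_category J" and D: "is_functor J B D" and l: "is_limit J B D l p"
  interpret B: cat B by unfold_locales (rule category_B)
  obtain n q where n: "n \<in> N" "is_limit J C (func_comp V D) (v n) q" "is_limit J B D n q"
    using B_limit[OF J D] by blast
  have lN: "l \<in> N" and lc: "\<And>j. j \<in> ob J \<Longrightarrow> p j \<in> hom C (v l) (v (fob D j))"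
    "\<And>i j u. \<lbrakk>i \<in> ob J; j \<in> ob J; u \<in> hom J i j\<rbrakk> \<Longrightarrow>
      cmp C (v l) (v (fob D i)) (v (fob D j)) (fmap D i j u) (p i) = p j"
    using l by (simp_all add: is_limit_def is_cone_def V_simps)
  have nc: "\<And>j. j \<in> ob J \<Longrightarrow> q j \<in> hom C (v n) (v (fob D j))"
    using n(3) by (simp add: is_limit_def is_cone_def V_simps)
  have vob: "v l \<in> ob C" "v n \<in> ob C" "\<And>j. j \<in> ob J \<Longrightarrow> v (fob D j) \<in> ob C"
    using v lN n(1) D by (auto simp: is_functor_def V_simps)
  have cone: "is_cone J C (func_comp V D) (v l) p"
    using vob lc by (simp add: is_cone_def func_comp_def V_simps)
  have cones: "is_cone J B D l p" "is_cone J B D n q" using l n(3) by (simp_all add: is_limit_def)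
  obtain k where k: "k \<in> hom C (v n) (v l)" "\<And>j. j \<in> ob J \<Longrightarrow> cmp C (v n) (v l) (v (fob D j)) (p j) k = q j"
    using l cones(2) unfolding is_limit_def V_simps by blast
  obtain k' where k': "k' \<in> hom C (v l) (v n)" "\<And>j. j \<in> ob J \<Longrightarrow> cmp C (v l) (v n) (v (fob D j)) (q j) k' = p j"
    using n(3) cones(1) unfolding is_limit_def V_simps by blast
  have kk': "cmp C (v l) (v n) (v l) k k' = ide C (v l)"
  proof -
    have "\<exists>!h. h \<in> hom C (v l) (v l) \<and> (\<forall>j\<in>ob J. cmp C (v l) (v l) (v (fob D j)) (p j) h = p j)"
      using l cones(1) unfolding is_limit_def V_simps by blast
    moreover have "cmp C (v l) (v l) (v (fob D j)) (p j) (cmp C (v l) (v n) (v l) k k') = p j" if j: "j \<in> ob J" for j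
      using cmp_assoc[OF vob(1,2,1) vob(3)[OF j] k'(1) k(1) lc(1)[OF j]] k(2)[OF j] k'(2)[OF j] by simp
    moreover have "cmp C (v l) (v l) (v (fob D j)) (p j) (ide C (v l)) = p j" if j: "j \<in> ob J" for j
      using vob(1) vob(3)[OF j] lc(1)[OF j] by simp
    moreover have "cmp C (v l) (v n) (v l) k k' \<in> hom C (v l) (v l)" "ide C (v l) \<in> hom C (v l) (v l)"
      using vob k(1) k'(1) by simp_all
    ultimately show ?thesis by blast
  qed
  have "\<exists>!h. h \<in> hom C M (v l) \<and> (\<forall>j\<in>ob J. cmp C M (v l) (v (fob D j)) (p j) h = r j)"
    if r: "is_cone J C (func_comp V D) M r" for M r
  proof -
    have M: "M \<in> ob C" using r by (simp add: is_cone_def)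
    have ex: "\<exists>!h. h \<in> hom C M (v n) \<and> (\<forall>j\<in>ob J. cmp C M (v n) (v (fob D j)) (q j) h = r j)"
      using n(2) r by (simp add: is_limit_def func_comp_def V_simps)
    then obtain h where h: "h \<in> hom C M (v n)" "\<And>j. j \<in> ob J \<Longrightarrow> cmp C M (v n) (v (fob D j)) (q j) h = r j"
      by blast
    show ?thesis
    proof (rule ex1I[of _ "cmp C M (v n) (v l) k h"])
      have "cmp C M (v l) (v (fob D j)) (p j) (cmp C M (v n) (v l) k h) = r j" if j: "j \<in> ob J" for j
        using cmp_assoc[OF M vob(2,1) vob(3)[OF j] h(1) k(1) lc(1)[OF j]] k(2)[OF j] h(2)[OF j] by simp
      then show "cmp C M (v n) (v l) k h \<in> hom C M (v l) \<and>
          (\<forall>j\<in>ob J. cmp C M (v l) (v (fob D j)) (p j) (cmp C M (v n) (v l) k h) = r j)"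
        using M vob h(1) k(1) by simp
      fix g assume g: "g \<in> hom C M (v l) \<and> (\<forall>j\<in>ob J. cmp C M (v l) (v (fob D j)) (p j) g = r j)"
      have "cmp C M (v n) (v (fob D j)) (q j) (cmp C M (v l) (v n) k' g) = r j" if j: "j \<in> ob J" for j
        using cmp_assoc[OF M vob(1,2) vob(3)[OF j] conjunct1[OF g] k'(1) nc[OF j]] k'(2)[OF j] g j by simp
      moreover have "cmp C M (v l) (v n) k' g \<in> hom C M (v n)" using M vob g k'(1) by simp
      ultimately have "cmp C M (v l) (v n) k' g = h" using ex h by blast
      then show "g = cmp C M (v n) (v l) k h"
        using cmp_assoc[OF M vob(1,2,1) conjunct1[OF g] k'(1) k(1)] kk' M vob g by simp
    qed
  qed
  then show "is_limit J C (func_comp V D) (fob V l) (\<lambda>j. fmap V l (fob D j) (p j))"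
    using cone by (simp add: is_limit_def func_comp_def V_simps)
qed

end

section \<open>Arrows of C classified by the free category, and their presheaf images\<close>

context presheaves
begin

text \<open>\<open>C\<close> may be large, with objects of any type, whereas \<open>K\<close> is
  free only against small categories on \<open>'u\<close>. The arrow is classified in a renamed
  small lex closure of its two ends, and the inclusion of that closure is lex.\<close>

lemma lex_functor_classifying_arrow:
  assumes u: "universe \<kappa>" and fc: "finitely_complete C" and K: "free_lex_on_arrow \<kappa> K X\<^sub>0 Y\<^sub>0 f\<^sub>0"
    and X: "X \<in> ob C" and Y: "Y \<in> ob C" and f: "f \<in> hom C X Y"
  shows "\<exists>F a b. lex_functor K C F \<and> iso_in C (fob F X\<^sub>0) X a \<and> iso_in C (fob F Y\<^sub>0) Y b \<and>
    cmp C (fob F X\<^sub>0) X Y f a = cmp C (fob F X\<^sub>0) (fob F Y\<^sub>0) Y b (fmap F X\<^sub>0 Y\<^sub>0 f\<^sub>0)"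
proof -
  obtain U where U: "{X, Y} \<subseteq> U" "U \<subseteq> ob C" "small \<kappa> U"
    "\<And>(J :: (nat, nat) cat) D. \<lbrakk>finite_category J; is_functor J C D; \<And>j. j \<in> ob J \<Longrightarrow> fob D j \<in> U\<rbrakk>
       \<Longrightarrow> \<exists>L\<in>U. \<exists>p. is_limit J C D L p"
    by (rule small_lex_closure[OF u fc, of "{X, Y}"]) (use X Y in \<open>simp, simp, blast\<close>)
  \<comment> \<open>\<open>U\<close> has fewer than \<open>\<kappa>\<close> elements and
    \<open>\<kappa>\<close> is an order on a subset of \<open>'u\<close>, so \<open>'u\<close> has
    enough names for the objects in \<open>U\<close>.\<close>
  have "|U| \<le>o |Field \<kappa>|"
    using U(3) u unfolding small_def universe_def
    by (meson card_of_Field_ordIso ordIso_symmetric ordLeq_ordIso_trans ordLess_imp_ordLeq)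
  then obtain i :: "'o \<Rightarrow> 'u" where i: "inj_on i U" unfolding card_of_ordLeq[symmetric] by blast
  let ?N = "i ` U" and ?v = "inv_into U i"
  have vN: "?v ` ?N = U" using i by simp
  interpret N: lex_inverse_image C ?N ?v
  proof unfold_locales
    show "?v ` ?N \<subseteq> ob C" using vN U(2) by simp
    show "\<exists>L\<in>?v ` ?N. \<exists>p. is_limit J C D L p"
      if "finite_category J" "is_functor J C D" "\<And>j. j \<in> ob J \<Longrightarrow> fob D j \<in> ?v ` ?N" for J :: "(nat, nat) cat" and D
      using U(4) that unfolding vN by blast
  qed
  have "locally_small \<kappa> N.B"
    using locally_small vN U(2) unfolding locally_small_def N.V_simps by blast
  then have "small_category \<kappa> N.B"
    using N.category_B small_image[OF U(3)] by (simp add: small_category_def N.V_simps)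
  moreover have iX: "i X \<in> ob N.B" "i Y \<in> ob N.B" and vi: "?v (i X) = X" "?v (i Y) = Y"
    using U(1) i by (simp_all add: N.V_simps)
  moreover have "f \<in> hom N.B (i X) (i Y)" using f vi by (simp add: N.V_simps)
  ultimately obtain F a b where F: "lex_functor K N.B F" "iso_in N.B (fob F X\<^sub>0) (i X) a" "iso_in N.B (fob F Y\<^sub>0) (i Y) b"
    "cmp N.B (fob F X\<^sub>0) (i X) (i Y) f a = cmp N.B (fob F X\<^sub>0) (fob F Y\<^sub>0) (i Y) b (fmap F X\<^sub>0 Y\<^sub>0 f\<^sub>0)"
    using K N.finitely_complete_B unfolding free_lex_on_arrow_def by blast
  show ?thesis
  proof (intro exI conjI)
    show "lex_functor K C (func_comp N.V F)" by (rule lex_functor_comp[OF F(1) N.lex_V])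
    show "iso_in C (fob (func_comp N.V F) X\<^sub>0) X a" "iso_in C (fob (func_comp N.V F) Y\<^sub>0) Y b"
      using F(2,3) vi by (simp_all add: iso_in_def func_comp_def N.V_simps)
    show "cmp C (fob (func_comp N.V F) X\<^sub>0) X Y f a =
        cmp C (fob (func_comp N.V F) X\<^sub>0) (fob (func_comp N.V F) Y\<^sub>0) Y b (fmap (func_comp N.V F) X\<^sub>0 Y\<^sub>0 f\<^sub>0)"
      using F(4) vi by (simp add: func_comp_def N.V_simps)
  qed
qed

text \<open>The generic arrow is carried by a lex diagram of representables to a conjugate of
  \<open>f\<close>, so the image presheaf is a weighted colimit that every closed class contains.
  Freeness holds only up to isomorphism, hence the corrections by \<open>a'\<close> and
  \<open>b\<close>.\<close>

lemma representable_image_in_Phi_l: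
  assumes u: "universe \<kappa>" and \<Phi>: "is_Phi_reg \<kappa> \<Phi>" and fc: "finitely_complete C"
    and X: "X \<in> ob C" and Y: "Y \<in> ob C" and f: "f \<in> hom C X Y"
  obtains H c n where "H \<in> Phi_l_ob \<kappa> \<Phi> C" "c \<in> nt (y X) H" "n \<in> nt H (y Y)" "surj_nt (y X) H c" "inj_nt H n"
    "\<And>Z x. \<lbrakk>Z \<in> ob C; x \<in> hom C Z X\<rbrakk> \<Longrightarrow> n Z (c Z x) = cmp C Z X Y f x"
proof -
  let ?T = "{F. small_presheaf \<kappa> C F}"
  interpret T: presheaf_subcat C \<kappa> ?T by (rule presheaf_subcat_small[OF u])
  obtain K X\<^sub>0 Y\<^sub>0 f\<^sub>0 \<phi> e where \<Phi>_eq: "\<Phi> = {(K, \<phi>)}" and free: "free_lex_on_arrow \<kappa> K X\<^sub>0 Y\<^sub>0 f\<^sub>0"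
      and w: "image_weight K X\<^sub>0 Y\<^sub>0 f\<^sub>0 \<phi> e"
    using Phi_reg_weight[OF \<Phi>] by blast
  have K: "category K" "finitely_complete K" and XY: "X\<^sub>0 \<in> ob K" "Y\<^sub>0 \<in> ob K" "f\<^sub>0 \<in> hom K X\<^sub>0 Y\<^sub>0"
    using free by (auto simp: free_lex_on_arrow_def small_category_def)
  obtain F a b where F: "lex_functor K C F" and a: "iso_in C (fob F X\<^sub>0) X a" and b: "iso_in C (fob F Y\<^sub>0) Y b"
      and sq: "cmp C (fob F X\<^sub>0) X Y f a = cmp C (fob F X\<^sub>0) (fob F Y\<^sub>0) Y b (fmap F X\<^sub>0 Y\<^sub>0 f\<^sub>0)"
    using lex_functor_classifying_arrow[OF u fc free X Y f] by blast
  let ?A = "fob F X\<^sub>0" and ?B = "fob F Y\<^sub>0" and ?g = "fmap F X\<^sub>0 Y\<^sub>0 f\<^sub>0"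
  have fF: "is_functor K C F" using F by (simp add: lex_functor_def)
  have A: "?A \<in> ob C" "?B \<in> ob C" "?g \<in> hom C ?A ?B" using fF XY by (simp_all add: is_functor_def)
  obtain a' where a': "a \<in> hom C ?A X" "a' \<in> hom C X ?A" "cmp C ?A X ?A a' a = ide C ?A" "cmp C X ?A X a a' = ide C X"
    using a unfolding iso_in_def by blast
  obtain b' where b': "b \<in> hom C ?B Y" "b' \<in> hom C Y ?B" "cmp C ?B Y ?B b' b = ide C ?B"
    using b unfolding iso_in_def by blast
  let ?D = "func_comp (yoneda C) F"
  have D: "lex_functor K (small_presheaf_cat \<kappa> C) ?D"
    unfolding small_presheaf_cat_PE by (rule lex_functor_comp[OF F T.lex_functor_yoneda])
  have D_simps: "fob ?D X\<^sub>0 = y ?A" "fob ?D Y\<^sub>0 = y ?B" "fmap ?D X\<^sub>0 Y\<^sub>0 f\<^sub>0 = yoneda_map C ?A ?B ?g"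
    by (simp_all add: func_comp_def yoneda_def)
  obtain H c n \<eta> where H: "small_presheaf \<kappa> C H" "c \<in> nt (y ?A) H" "n \<in> nt H (y ?B)"
      "surj_nt (y ?A) H c" "inj_nt H n"
      "\<And>Z x. \<lbrakk>Z \<in> ob C; x \<in> fob (y ?A) Z\<rbrakk> \<Longrightarrow> n Z (c Z x) = yoneda_map C ?A ?B ?g Z x"
      "is_weighted_colimit K \<phi> (small_presheaf_cat \<kappa> C) ?D H \<eta>"
    using lex_image_weighted_colimit[OF u K XY w D] unfolding D_simps by blast
  \<comment> \<open>All values of the diagram are representable, so it lies in any \<open>S\<close>
    that contains the representables.\<close>
  have "H \<in> S" if S: "y ` ob C \<subseteq> S" "closed_under_lex_colimits \<Phi> (small_presheaf_cat \<kappa> C) S" for S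
  proof -
    have "fob ?D k \<in> S" if "k \<in> ob K" for k
    proof -
      have "fob F k \<in> ob C" using fF that by (simp add: is_functor_def)
      then show ?thesis using S(1) by (auto simp: func_comp_def yoneda_def)
    qed
    then show ?thesis
      using S(2) D H(7) unfolding closed_under_lex_colimits_def \<Phi>_eq
      by (simp only: ball_simps prod.case simp_thms) blast
  qed
  then have HT: "H \<in> Phi_l_ob \<kappa> \<Phi> C" unfolding Phi_l_ob_def by blast
  have psh: "psh (y X)" "psh (y ?A)" "psh H" using psh_y X A(1) H(1) small_presheaf_iff by blast+
  \<comment> \<open>Conjugation turns an image factorisation of \<open>?g\<close> into one of
    \<open>f\<close>: the quotient is precomposed with \<open>X -> ?A\<close> and the embedding
    postcomposed with \<open>?B -> Y\<close>.\<close>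
  let ?c = "vcmp (y X) c (yoneda_map C X ?A a')" and ?n = "vcmp H (yoneda_map C ?B Y b) n"
  have n_hom: "n Z z \<in> hom C Z ?B" if "Z \<in> ob C" "z \<in> fob H Z" for Z z
    using ntD(3)[OF H(3) that] by simp
  have c_in: "?c \<in> nt (y X) H" by (rule vcmp_in[OF psh(1) yoneda_map_in[OF X A(1) a'(2)] H(2)])
  have n_in: "?n \<in> nt H (y Y)" by (rule vcmp_in[OF psh(3) H(3) yoneda_map_in[OF A(2) Y b'(1)]])
  show thesis
  proof (rule that[OF HT c_in n_in])
    show "surj_nt (y X) H ?c"
      unfolding surj_nt_def
    proof (intro ballI)
      fix Z z assume Z: "Z \<in> ob C" "z \<in> fob H Z"
      obtain x where x: "x \<in> hom C Z ?A" "c Z x = z" using surj_ntE[OF H(4) Z] by auto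
      have ax: "cmp C Z ?A X a x \<in> hom C Z X" using Z X A x(1) a'(1) by simp
      have "cmp C Z X ?A a' (cmp C Z ?A X a x) = x"
        using cmp_assoc[OF Z(1) A(1) X A(1) x(1) a'(1,2)] a'(3) Z(1) A(1) x(1) by simp
      then have "?c Z (cmp C Z ?A X a x) = z" using Z(1) ax x(2) by simp
      then show "\<exists>x\<in>fob (y X) Z. ?c Z x = z" using ax by auto
    qed
    show "inj_nt H ?n"
      unfolding inj_nt_def
    proof (intro ballI inj_onI)
      fix Z z z' assume Z: "Z \<in> ob C" "z \<in> fob H Z" "z' \<in> fob H Z" and eq: "?n Z z = ?n Z z'"
      have bn: "cmp C Z Y ?B b' (?n Z w) = n Z w" if w: "w \<in> fob H Z" for w
        using cmp_assoc[OF Z(1) A(2) Y A(2) n_hom[OF Z(1) w] b'(1,2)] b'(3) Z(1) A(2) n_hom[OF Z(1) w] w by simp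
      show "z = z'"
        by (rule inj_ntD[OF H(5) Z]) (use bn[OF Z(2)] bn[OF Z(3)] eq in metis)
    qed
    fix Z x assume Z: "Z \<in> ob C" "x \<in> hom C Z X"
    have a'x: "cmp C Z X ?A a' x \<in> hom C Z ?A" using Z X A a'(2) by simp
    have cx: "c Z (cmp C Z X ?A a' x) \<in> fob H Z" using ntD(3)[OF H(2) Z(1)] a'x by simp
    have "n Z (c Z (cmp C Z X ?A a' x)) = cmp C Z ?A ?B ?g (cmp C Z X ?A a' x)"
      using H(6)[OF Z(1)] a'x Z(1) by simp
    then have "?n Z (?c Z x) = cmp C Z ?B Y b (cmp C Z ?A ?B ?g (cmp C Z X ?A a' x))"
      using Z cx n_hom[OF Z(1) cx] by simp
    also have "\<dots> = cmp C Z ?A Y (cmp C ?A X Y f a) (cmp C Z X ?A a' x)"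
      unfolding sq using cmp_assoc[OF Z(1) A(1,2) Y a'x A(3) b'(1)] by simp
    also have "\<dots> = cmp C Z X Y f (cmp C Z ?A X a (cmp C Z X ?A a' x))"
      using cmp_assoc[OF Z(1) A(1) X Y a'x a'(1) f] .
    also have "cmp C Z ?A X a (cmp C Z X ?A a' x) = x"
      using cmp_assoc[OF Z(1) X A(1) X Z(2) a'(2,1)] a'(4) Z X by simp
    finally show "?n Z (?c Z x) = cmp C Z X Y f x" .
  qed
qed

end

section \<open>Regularity of exact categories\<close>

text \<open>The adjunction in terms of its unit, evaluated on elements: arrows out of
  \<open>fob L F\<close> correspond to natural families of arrows indexed by the elements of
  \<open>F\<close>.\<close>

locale lex_reflection = presheaf_subcat C \<kappa> T for C :: "('o, 'u) cat" and \<kappa> and T +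
  fixes L :: "(('o, 'u) presheaf, 'o \<Rightarrow> 'u \<Rightarrow> 'u, 'o, 'u) func" and \<eta>
  assumes complete: "finitely_complete C"
    and lex: "lex_functor (PE T) C L"
    and unit: "F \<in> T \<Longrightarrow> \<eta> F \<in> nt F (y (fob L F))"
    and unit_natural: "\<lbrakk>F \<in> T; G \<in> T; t \<in> nt F G; W \<in> ob C; x \<in> fob F W\<rbrakk> \<Longrightarrow>
      cmp C W (fob L F) (fob L G) (fmap L F G t) (\<eta> F W x) = \<eta> G W (t W x)"
    and universal: "\<lbrakk>F \<in> T; Z \<in> ob C; t \<in> nt F (y Z)\<rbrakk> \<Longrightarrow>
      \<exists>!h. h \<in> hom C (fob L F) Z \<and> (\<forall>W\<in>ob C. \<forall>x\<in>fob F W. cmp C W (fob L F) Z h (\<eta> F W x) = t W x)"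
begin

lemma L_ob: "F \<in> T \<Longrightarrow> fob L F \<in> ob C"
  using lex by (simp add: lex_functor_def is_functor_def)

lemma L_hom: "\<lbrakk>F \<in> T; G \<in> T; t \<in> nt F G\<rbrakk> \<Longrightarrow> fmap L F G t \<in> hom C (fob L F) (fob L G)"
  using lex by (simp add: lex_functor_def is_functor_def)

lemma unit_hom: "\<lbrakk>F \<in> T; W \<in> ob C; x \<in> fob F W\<rbrakk> \<Longrightarrow> \<eta> F W x \<in> hom C W (fob L F)"
  using ntD(3)[OF unit] by simp

lemma unit_restrict:
  "\<lbrakk>F \<in> T; W \<in> ob C; W' \<in> ob C; h \<in> hom C W' W; x \<in> fob F W\<rbrakk> \<Longrightarrow>
    \<eta> F W' (fmap F W W' h x) = cmp C W' W (fob L F) (\<eta> F W x) h"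
  using nt_natural[OF unit] unit_hom by simp

lemma unit_cancel:
  assumes F: "F \<in> T" and Z: "Z \<in> ob C" and h: "h \<in> hom C (fob L F) Z" and k: "k \<in> hom C (fob L F) Z"
    and eq: "\<And>W x. \<lbrakk>W \<in> ob C; x \<in> fob F W\<rbrakk> \<Longrightarrow>
      cmp C W (fob L F) Z h (\<eta> F W x) = cmp C W (fob L F) Z k (\<eta> F W x)"
  shows "h = k"
proof -
  note LF = L_ob[OF F]
  let ?t = "mknt F (\<lambda>W x. cmp C W (fob L F) Z h (\<eta> F W x))"
  have "?t \<in> nt F (y Z)"
  proof (rule mknt_in[OF psh_T[OF F]])
    show "cmp C W (fob L F) Z h (\<eta> F W x) \<in> fob (y Z) W" if "W \<in> ob C" "x \<in> fob F W" for W x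
      using unit_hom[OF F that] that LF Z h by simp
    show "cmp C W' (fob L F) Z h (\<eta> F W' (fmap F W W' g x)) = fmap (y Z) W W' g (cmp C W (fob L F) Z h (\<eta> F W x))"
      if W: "W \<in> ob C" "W' \<in> ob C" "g \<in> hom C W' W" "x \<in> fob F W" for W W' g x
      using unit_restrict[OF F W] cmp_assoc[OF W(2,1) LF Z W(3) unit_hom[OF F W(1,4)] h]
        unit_hom[OF F W(1,4)] W LF Z h by simp
  qed
  from universal[OF F Z this] show ?thesis
    using h k eq by (simp cong: ball_cong) metis
qed

lemma universalE:
  assumes "F \<in> T" "Z \<in> ob C" "t \<in> nt F (y Z)"
  obtains h where "h \<in> hom C (fob L F) Z" "\<And>W x. \<lbrakk>W \<in> ob C; x \<in> fob F W\<rbrakk> \<Longrightarrow> cmp C W (fob L F) Z h (\<eta> F W x) = t W x"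
  using universal[OF assms] by blast

text \<open>Full faithfulness of the Yoneda embedding makes the counit invertible. Its inverse is
  the unit at \<open>y Z\<close> evaluated at the identity of \<open>Z\<close>; one composite is
  checked with \<open>unit_cancel\<close>.\<close>

lemma counit:
  assumes Z: "Z \<in> ob C"
  obtains \<epsilon> where "\<epsilon> \<in> hom C (fob L (y Z)) Z"
    "\<And>W x. \<lbrakk>W \<in> ob C; x \<in> hom C W Z\<rbrakk> \<Longrightarrow> cmp C W (fob L (y Z)) Z \<epsilon> (\<eta> (y Z) W x) = x"
    "\<eta> (y Z) Z (ide C Z) \<in> hom C Z (fob L (y Z))"
    "cmp C Z (fob L (y Z)) Z \<epsilon> (\<eta> (y Z) Z (ide C Z)) = ide C Z"
    "cmp C (fob L (y Z)) Z (fob L (y Z)) (\<eta> (y Z) Z (ide C Z)) \<epsilon> = ide C (fob L (y Z))"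
proof -
  note yT = y_T[OF Z]
  note LZ = L_ob[OF yT]
  let ?\<iota> = "\<eta> (y Z) Z (ide C Z)"
  obtain \<epsilon> where \<epsilon>: "\<epsilon> \<in> hom C (fob L (y Z)) Z"
    "\<And>W x. \<lbrakk>W \<in> ob C; x \<in> fob (y Z) W\<rbrakk> \<Longrightarrow> cmp C W (fob L (y Z)) Z \<epsilon> (\<eta> (y Z) W x) = mknt (y Z) (\<lambda>W x. x) W x"
    using universalE[OF yT Z ide_in[OF psh_y[OF Z]]] by blast
  have \<epsilon>': "cmp C W (fob L (y Z)) Z \<epsilon> (\<eta> (y Z) W x) = x" if "W \<in> ob C" "x \<in> hom C W Z" for W x
    using \<epsilon>(2)[OF that(1)] that by simp
  have \<iota>: "?\<iota> \<in> hom C Z (fob L (y Z))" using unit_hom[OF yT Z] Z by simp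
  have unit_\<iota>: "\<eta> (y Z) W x = cmp C W Z (fob L (y Z)) ?\<iota> x" if "W \<in> ob C" "x \<in> hom C W Z" for W x
    using unit_restrict[OF yT Z that, of "ide C Z"] Z that by simp
  have "cmp C (fob L (y Z)) Z (fob L (y Z)) ?\<iota> \<epsilon> = ide C (fob L (y Z))"
  proof (rule unit_cancel[OF yT LZ])
    fix W x assume W: "W \<in> ob C" "x \<in> fob (y Z) W"
    then have x: "x \<in> hom C W Z" by simp
    note \<eta>x = unit_hom[OF yT W]
    show "cmp C W (fob L (y Z)) (fob L (y Z)) (cmp C (fob L (y Z)) Z (fob L (y Z)) ?\<iota> \<epsilon>) (\<eta> (y Z) W x) =
        cmp C W (fob L (y Z)) (fob L (y Z)) (ide C (fob L (y Z))) (\<eta> (y Z) W x)"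
      unfolding cmp_assoc[OF W(1) LZ Z LZ \<eta>x \<epsilon>(1) \<iota>] \<epsilon>'[OF W(1) x] cmp_ide(2)[OF W(1) LZ \<eta>x]
      using unit_\<iota>[OF W(1) x] ..
  qed (use Z LZ \<epsilon>(1) \<iota> in simp_all)
  then show thesis using that[OF \<epsilon>(1) \<epsilon>' \<iota>] \<epsilon>'[OF Z ide_hom[OF Z]] by blast
qed

end

text \<open>
  The factorisation of \<open>f\<close> through its presheaf image \<open>H\<close>: as \<open>L\<close> preserves colimits,
  \<open>e : X \<rightarrow> L H\<close> is the universal arrow identifying what \<open>f\<close> identifies.
\<close>

locale reflected_image = lex_reflection C \<kappa> T L \<eta> for C :: "('o, 'u) cat" and \<kappa> T L \<eta> +
  fixes X Y f H c n
  assumes X: "X \<in> ob C" and Y: "Y \<in> ob C" and f: "f \<in> hom C X Y"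
    and H: "H \<in> T" and c: "c \<in> nt (y X) H" "surj_nt (y X) H c" and n: "n \<in> nt H (y Y)" "inj_nt H n"
    and nc: "\<lbrakk>Z \<in> ob C; x \<in> hom C Z X\<rbrakk> \<Longrightarrow> n Z (c Z x) = cmp C Z X Y f x"
begin

text \<open>Under Yoneda this is the composite \<open>y X -> H -> y (L H)\<close> of the quotient
  with the unit.\<close>

definition e :: 'u where "e = \<eta> H X (c X (ide C X))"

lemma c_in: "\<lbrakk>Z \<in> ob C; x \<in> hom C Z X\<rbrakk> \<Longrightarrow> c Z x \<in> fob H Z"
  using ntD(3)[OF c(1)] by simp

lemma c_lift: "\<lbrakk>Z \<in> ob C; z \<in> fob H Z\<rbrakk> \<Longrightarrow> \<exists>x\<in>hom C Z X. c Z x = z"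
  using c(2) by (simp add: surj_nt_def)

lemma c_eq_iff:
  assumes Z: "Z \<in> ob C" "x \<in> hom C Z X" "x' \<in> hom C Z X"
  shows "c Z x = c Z x' \<longleftrightarrow> cmp C Z X Y f x = cmp C Z X Y f x'"
  using inj_ntD[OF n(2) Z(1) c_in[OF Z(1,2)] c_in[OF Z(1,3)]] nc[OF Z(1,2)] nc[OF Z(1,3)] by auto

lemma n_hom: "\<lbrakk>Z \<in> ob C; z \<in> fob H Z\<rbrakk> \<Longrightarrow> n Z z \<in> hom C Z Y"
  using ntD(3)[OF n(1)] by simp

lemma LH: "fob L H \<in> ob C"
  by (rule L_ob[OF H])

lemma e: "e \<in> hom C X (fob L H)"
  unfolding e_def by (rule unit_hom[OF H X c_in[OF X ide_hom[OF X]]])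

lemma e_cmp:
  assumes Z: "Z \<in> ob C" "x \<in> hom C Z X"
  shows "cmp C Z X (fob L H) e x = \<eta> H Z (c Z x)"
proof -
  have "c Z x = fmap H X Z x (c X (ide C X))"
    using nt_natural[OF c(1) X Z, of "ide C X"] X Z by simp
  then show ?thesis
    unfolding e_def using unit_restrict[OF H X Z c_in[OF X ide_hom[OF X]]] by simp
qed

lemma e_identifies:
  assumes Z: "Z \<in> ob C" "x \<in> hom C Z X" "x' \<in> hom C Z X" and eq: "cmp C Z X Y f x = cmp C Z X Y f x'"
  shows "cmp C Z X (fob L H) e x = cmp C Z X (fob L H) e x'"
  using e_cmp[OF Z(1,2)] e_cmp[OF Z(1,3)] c_eq_iff[OF Z] eq by simp

text \<open>Every element of \<open>H\<close> comes from an arrow into \<open>X\<close>, and arrows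
  out of \<open>L H\<close> are detected on elements of \<open>H\<close>.\<close>

lemma e_cancel:
  assumes Z: "Z \<in> ob C" and h: "h \<in> hom C (fob L H) Z" "k \<in> hom C (fob L H) Z"
    and eq: "cmp C X (fob L H) Z h e = cmp C X (fob L H) Z k e"
  shows "h = k"
proof (rule unit_cancel[OF H Z h])
  fix W z assume W: "W \<in> ob C" "z \<in> fob H W"
  obtain x where x: "x \<in> hom C W X" "c W x = z" using c_lift[OF W] by blast
  have "cmp C W (fob L H) Z g (\<eta> H W z) = cmp C W X Z (cmp C X (fob L H) Z g e) x"
    if "g \<in> hom C (fob L H) Z" for g
    using cmp_assoc[OF W(1) X LH Z x(1) e that] e_cmp[OF W(1) x(1)] x(2) by simp
  then show "cmp C W (fob L H) Z h (\<eta> H W z) = cmp C W (fob L H) Z k (\<eta> H W z)"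
    using h eq by simp
qed

text \<open>The quotient \<open>c\<close> has the fibres of \<open>f\<close>, so \<open>a\<close>
  factors through it in presheaves; universality of the unit then yields an arrow from
  \<open>L H\<close>.\<close>

lemma e_descend:
  assumes Z: "Z \<in> ob C" and a: "a \<in> hom C X Z"
    and eq: "\<And>T r s. \<lbrakk>T \<in> ob C; r \<in> hom C T X; s \<in> hom C T X; cmp C T X Y f r = cmp C T X Y f s\<rbrakk> \<Longrightarrow>
      cmp C T X Z a r = cmp C T X Z a s"
  obtains h where "h \<in> hom C (fob L H) Z" "cmp C X (fob L H) Z h e = a"
proof -
  obtain t where t: "t \<in> nt H (y Z)" "\<And>W x. \<lbrakk>W \<in> ob C; x \<in> fob (y X) W\<rbrakk> \<Longrightarrow> t W (c W x) = yoneda_map C X Z a W x"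
  proof (rule factor_through_surj[OF psh_y[OF X] psh_T[OF H] psh_y[OF Z] c yoneda_map_in[OF X Z a]])
    fix W x x' assume W: "W \<in> ob C" "x \<in> fob (y X) W" "x' \<in> fob (y X) W" "c W x = c W x'"
    then have x: "x \<in> hom C W X" "x' \<in> hom C W X" by simp_all
    show "yoneda_map C X Z a W x = yoneda_map C X Z a W x'"
      using eq[OF W(1) x] c_eq_iff[OF W(1) x] W(1,4) x by simp
  qed blast
  obtain h where h: "h \<in> hom C (fob L H) Z" "\<And>W z. \<lbrakk>W \<in> ob C; z \<in> fob H W\<rbrakk> \<Longrightarrow> cmp C W (fob L H) Z h (\<eta> H W z) = t W z"
    using universalE[OF H Z t(1)] by blast
  have "cmp C X (fob L H) Z h e = a"
    unfolding e_def using h(2)[OF X c_in[OF X ide_hom[OF X]]] t(2)[OF X] X Z a by simp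
  then show thesis using that h(1) by blast
qed

lemma coequaliser:
  assumes kp: "is_kernel_pair C X Y f R p q"
  shows "is_coequaliser C R X p q (fob L H) e"
  unfolding is_coequaliser_kernel_pair_iff[OF kp X Y f]
proof (intro conjI ballI impI LH e)
  fix Z a assume Z: "Z \<in> ob C" "a \<in> hom C X Z"
    and eq: "\<forall>T\<in>ob C. \<forall>r\<in>hom C T X. \<forall>s\<in>hom C T X. cmp C T X Y f r = cmp C T X Y f s \<longrightarrow> cmp C T X Z a r = cmp C T X Z a s"
  obtain h where h: "h \<in> hom C (fob L H) Z" "cmp C X (fob L H) Z h e = a"
    using e_descend[OF Z] eq by blast
  show "\<exists>!h. h \<in> hom C (fob L H) Z \<and> cmp C X (fob L H) Z h e = a"
  proof (rule ex1I[of _ h])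
    fix k assume k: "k \<in> hom C (fob L H) Z \<and> cmp C X (fob L H) Z k e = a"
    show "k = h"
      by (rule e_cancel[OF Z(1) conjunct1[OF k] h(1) trans[OF conjunct2[OF k] h(2)[symmetric]]])
  qed (use h in blast)
qed (rule e_identifies)

end

section \<open>Stability of effective epimorphisms under pullback\<close>

context lex_reflection
begin

text \<open>Effectiveness of \<open>e\<close> makes the comparison \<open>h : L H -> Z\<close>
  invertible. The presheaf image \<open>H'\<close> of \<open>q\<close> is the pullback of
  \<open>H\<close> along \<open>yoneda_map C Y Z g\<close>, and \<open>L\<close> preserves this
  pullback. So \<open>h' : L H' -> Y\<close> is invertible as well, and \<open>q\<close> is up to
  isomorphism \<open>Q.e\<close>, along which arrows descend.\<close>

lemma eff_epi_pullback_stable: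
  assumes im: "reflected_image C \<kappa> T L \<eta> X Z e H c n" and im': "reflected_image C \<kappa> T L \<eta> P Y q H' c' n'"
    and epi: "eff_epi X Z e" and pb: "is_pullback C X Y Z e g P p q" and g: "g \<in> hom C Y Z"
  shows "eff_epi P Y q"
proof -
  interpret E: reflected_image C \<kappa> T L \<eta> X Z e H c n by (rule im)
  interpret Q: reflected_image C \<kappa> T L \<eta> P Y q H' c' n' by (rule im')
  note PB = is_pullbackD[OF pb]
  have peq: "cmp C W X Z e (cmp C W P X p x) = cmp C W Y Z g (cmp C W P Y q x)" if W: "W \<in> ob C" "x \<in> hom C W P" for W x
    using cmp_assoc[OF W(1) PB(1) E.X E.Y W(2) PB(2) E.f] cmp_assoc[OF W(1) PB(1) Q.Y E.Y W(2) PB(3) g] PB(4) by simp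
  have px: "cmp C W P X p x \<in> hom C W X" if "W \<in> ob C" "x \<in> hom C W P" for W x
    using that PB(1,2) E.X by simp
  \<comment> \<open>Since \<open>e p = g q\<close>, arrows into \<open>P\<close> that
    \<open>q\<close> identifies are sent by \<open>p\<close> to arrows that \<open>e\<close>
    identifies.\<close>
  obtain k where k: "k \<in> nt H' H" "\<And>W x. \<lbrakk>W \<in> ob C; x \<in> fob (y P) W\<rbrakk> \<Longrightarrow> k W (c' W x) = vcmp (y P) c (yoneda_map C P X p) W x"
  proof (rule factor_through_surj[OF psh_y[OF PB(1)] psh_T[OF Q.H] psh_T[OF E.H] Q.c
        vcmp_in[OF psh_y[OF PB(1)] yoneda_map_in[OF PB(1) E.X PB(2)] E.c(1)]])
    fix W x x' assume W: "W \<in> ob C" "x \<in> fob (y P) W" "x' \<in> fob (y P) W" "c' W x = c' W x'"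
    then have x: "x \<in> hom C W P" "x' \<in> hom C W P" by simp_all
    have "cmp C W P Y q x = cmp C W P Y q x'" using Q.c_eq_iff[OF W(1) x] W(4) by simp
    then have "c W (cmp C W P X p x) = c W (cmp C W P X p x')"
      using E.c_eq_iff[OF W(1) px[OF W(1) x(1)] px[OF W(1) x(2)]] peq[OF W(1) x(1)] peq[OF W(1) x(2)] by simp
    then show "vcmp (y P) c (yoneda_map C P X p) W x = vcmp (y P) c (yoneda_map C P X p) W x'"
      using W(1) x by simp
  qed blast
  have kc: "k W (c' W x) = c W (cmp C W P X p x)" if "W \<in> ob C" "x \<in> hom C W P" for W x
    using k(2)[of W x] that by simp
  have nk: "n W (k W m) = cmp C W Y Z g (n' W m)" if W: "W \<in> ob C" "m \<in> fob H' W" for W m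
  proof -
    obtain x where x: "x \<in> hom C W P" "c' W x = m" using Q.c_lift[OF W] by blast
    show ?thesis
      using kc[OF W(1) x(1)] E.nc[OF W(1) px[OF W(1) x(1)]] Q.nc[OF W(1) x(1)] peq[OF W(1) x(1)] x(2) by simp
  qed
  have yg: "yoneda_map C Y Z g \<in> nt (y Y) (y Z)" by (rule yoneda_map_in[OF Q.Y E.Y g])
  have "is_pullback (PE T) H (y Y) (y Z) n (yoneda_map C Y Z g) H' k n'"
  proof (rule pullback_from_elements[OF Q.H E.H y_T[OF Q.Y] y_T[OF E.Y] E.n(1) yg k(1) Q.n(1)])
    fix W m assume W: "W \<in> ob C" "m \<in> fob H' W"
    show "n W (k W m) = yoneda_map C Y Z g W (n' W m)"
      using nk[OF W] W(1) Q.n_hom[OF W] by simp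
  next
    \<comment> \<open>Lift \<open>a\<close> to an arrow into \<open>X\<close>; with \<open>b\<close>
      it factors through \<open>P\<close>, and the class of the factor is the required element,
      unique as \<open>n'\<close> is injective.\<close>
    fix W a b assume W: "W \<in> ob C" "a \<in> fob H W" "b \<in> fob (y Y) W" and eq: "n W a = yoneda_map C Y Z g W b"
    have b: "b \<in> hom C W Y" using W(3) by simp
    obtain x where x: "x \<in> hom C W X" "c W x = a" using E.c_lift[OF W(1,2)] by blast
    have "cmp C W X Z e x = cmp C W Y Z g b" using eq E.nc[OF W(1) x(1)] x(2) W(1) b by simp
    then obtain w where w: "w \<in> hom C W P" "cmp C W P X p w = x" "cmp C W P Y q w = b"
      using pullback_lift[OF pb W(1) x(1) b] by blast
    show "\<exists>!m. m \<in> fob H' W \<and> k W m = a \<and> n' W m = b"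
    proof (rule ex1I[of _ "c' W w"])
      show "c' W w \<in> fob H' W \<and> k W (c' W w) = a \<and> n' W (c' W w) = b"
        using Q.c_in[OF W(1) w(1)] kc[OF W(1) w(1)] Q.nc[OF W(1) w(1)] w(2,3) x(2) by simp
      fix m assume m: "m \<in> fob H' W \<and> k W m = a \<and> n' W m = b"
      show "m = c' W w"
        by (rule inj_ntD[OF Q.n(2) W(1) _ Q.c_in[OF W(1) w(1)]]) (use m Q.nc[OF W(1) w(1)] w(3) in simp_all)
    qed
  qed
  then have pbL: "is_pullback C (fob L H) (fob L (y Y)) (fob L (y Z)) (fmap L H (y Z) n)
      (fmap L (y Y) (y Z) (yoneda_map C Y Z g)) (fob L H') (fmap L H' H k) (fmap L H' (y Y) n')"
    using cat.lex_functor_pullback[OF cat.intro[OF category_PE[OF T_psh]] lex] E.H y_T[OF Q.Y] y_T[OF E.Y] E.n(1) yg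
    by (metis PE_simps(1,2))
  let ?LY = "fob L (y Y)" and ?LZ = "fob L (y Z)" and ?LH = "fob L H" and ?LH' = "fob L H'"
  let ?Ln = "fmap L H (y Z) n" and ?Lg = "fmap L (y Y) (y Z) (yoneda_map C Y Z g)"
  let ?Lk = "fmap L H' H k" and ?Ln' = "fmap L H' (y Y) n'"
  note obs = E.LH Q.LH L_ob[OF y_T[OF Q.Y]] L_ob[OF y_T[OF E.Y]]
  note Ln = L_hom[OF E.H y_T[OF E.Y] E.n(1)] and Lg = L_hom[OF y_T[OF Q.Y] y_T[OF E.Y] yg]
    and Lk = L_hom[OF Q.H E.H k(1)] and Ln' = L_hom[OF Q.H y_T[OF Q.Y] Q.n(1)]
  obtain \<epsilon> where \<epsilon>: "\<epsilon> \<in> hom C ?LZ Z" "\<And>W x. \<lbrakk>W \<in> ob C; x \<in> hom C W Z\<rbrakk> \<Longrightarrow> cmp C W ?LZ Z \<epsilon> (\<eta> (y Z) W x) = x"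
    "\<eta> (y Z) Z (ide C Z) \<in> hom C Z ?LZ" "cmp C ?LZ Z ?LZ (\<eta> (y Z) Z (ide C Z)) \<epsilon> = ide C ?LZ"
    using counit[OF E.Y] by metis
  let ?\<iota> = "\<eta> (y Y) Y (ide C Y)"
  obtain \<delta> where \<delta>: "\<delta> \<in> hom C ?LY Y" "\<And>W x. \<lbrakk>W \<in> ob C; x \<in> hom C W Y\<rbrakk> \<Longrightarrow> cmp C W ?LY Y \<delta> (\<eta> (y Y) W x) = x"
    "?\<iota> \<in> hom C Y ?LY" "cmp C Y ?LY Y \<delta> ?\<iota> = ide C Y" "cmp C ?LY Y ?LY ?\<iota> \<delta> = ide C ?LY"
    using counit[OF Q.Y] by metis
  \<comment> \<open>The counit has a left inverse, so equations between arrows into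
    \<open>?LZ\<close> may be checked in \<open>Z\<close>.\<close>
  have \<epsilon>_mono: "u = v" if u: "U \<in> ob C" "u \<in> hom C U ?LZ" "v \<in> hom C U ?LZ" "cmp C U ?LZ Z \<epsilon> u = cmp C U ?LZ Z \<epsilon> v" for U u v
  proof -
    have "w = cmp C U Z ?LZ (\<eta> (y Z) Z (ide C Z)) (cmp C U ?LZ Z \<epsilon> w)" if w: "w \<in> hom C U ?LZ" for w
      using cmp_assoc[OF u(1) obs(4) E.Y obs(4) w \<epsilon>(1,3)] \<epsilon>(4) u(1) obs(4) w by simp
    from this[OF u(2)] this[OF u(3)] u(4) show ?thesis by simp
  qed
  define h where "h = cmp C ?LH ?LZ Z \<epsilon> ?Ln"
  define h' where "h' = cmp C ?LH' ?LY Y \<delta> ?Ln'"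
  have h: "h \<in> hom C ?LH Z" unfolding h_def using obs E.Y Ln \<epsilon>(1) by simp
  have h': "h' \<in> hom C ?LH' Y" unfolding h'_def using obs Q.Y Ln' \<delta>(1) by simp
  have h_unit: "cmp C W ?LH Z h (\<eta> H W m) = n W m" if W: "W \<in> ob C" "m \<in> fob H W" for W m
    unfolding h_def using cmp_assoc[OF W(1) obs(1,4) E.Y unit_hom[OF E.H W] Ln \<epsilon>(1)]
      unit_natural[OF E.H y_T[OF E.Y] E.n(1) W] \<epsilon>(2)[OF W(1) E.n_hom[OF W]] by simp
  have h'_unit: "cmp C W ?LH' Y h' (\<eta> H' W m) = n' W m" if W: "W \<in> ob C" "m \<in> fob H' W" for W m
    unfolding h'_def using cmp_assoc[OF W(1) obs(2,3) Q.Y unit_hom[OF Q.H W] Ln' \<delta>(1)]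
      unit_natural[OF Q.H y_T[OF Q.Y] Q.n(1) W] \<delta>(2)[OF W(1) Q.n_hom[OF W]] by simp
  have he: "cmp C X ?LH Z h E.e = e"
    unfolding E.e_def using h_unit[OF E.X E.c_in[OF E.X ide_hom[OF E.X]]] E.nc[OF E.X ide_hom[OF E.X]] E.X E.Y E.f by simp
  have h'e: "cmp C P ?LH' Y h' Q.e = q"
    unfolding Q.e_def using h'_unit[OF Q.X Q.c_in[OF Q.X ide_hom[OF Q.X]]] Q.nc[OF Q.X ide_hom[OF Q.X]] Q.X Q.Y Q.f by simp
  \<comment> \<open>Here effectiveness of \<open>e\<close> enters: \<open>E.e\<close> identifies
    whatever \<open>e\<close> does, hence descends along \<open>e\<close> to the inverse of
    \<open>h\<close>.\<close>
  obtain s where s: "s \<in> hom C Z ?LH" "cmp C X Z ?LH s e = E.e"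
    using eff_epi_descend[OF epi E.LH E.e E.e_identifies] by blast
  have hs: "cmp C Z ?LH Z h s = ide C Z"
    by (rule eff_epi_cancel[OF epi E.Y cmp_hom[OF E.Y obs(1) E.Y s(1) h] ide_hom[OF E.Y]])
      (use cmp_assoc[OF E.X E.Y obs(1) E.Y E.f s(1) h] s(2) he E.X E.Y E.f in simp)
  have sh: "cmp C ?LH Z ?LH s h = ide C ?LH"
    by (rule E.e_cancel[OF obs(1) cmp_hom[OF obs(1) E.Y obs(1) h s(1)] ide_hom[OF obs(1)]])
      (use cmp_assoc[OF E.X obs(1) E.Y obs(1) E.e h s(1)] s(2) he E.X obs(1) E.e in simp)
  have sg: "cmp C Y Z ?LH s g \<in> hom C Y ?LH" using Q.Y E.Y obs(1) g s(1) by simp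
  \<comment> \<open>The compatible pair that induces the inverse \<open>\<sigma>\<close> of
    \<open>h'\<close>: one component goes through the inverse \<open>s\<close> of \<open>h\<close>,
    the other is the inverse of the counit at \<open>Y\<close>.\<close>
  have "cmp C Y ?LH ?LZ ?Ln (cmp C Y Z ?LH s g) = cmp C Y ?LY ?LZ ?Lg ?\<iota>"
  proof (rule \<epsilon>_mono[OF Q.Y])
    show "cmp C Y ?LH ?LZ ?Ln (cmp C Y Z ?LH s g) \<in> hom C Y ?LZ" "cmp C Y ?LY ?LZ ?Lg ?\<iota> \<in> hom C Y ?LZ"
      using Q.Y obs sg Ln \<delta>(3) Lg by simp_all
    have "cmp C Y ?LZ Z \<epsilon> (cmp C Y ?LH ?LZ ?Ln (cmp C Y Z ?LH s g)) = cmp C Y ?LH Z h (cmp C Y Z ?LH s g)"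
      using cmp_assoc[OF Q.Y obs(1,4) E.Y sg Ln \<epsilon>(1)] by (simp add: h_def)
    also have "\<dots> = g"
      using cmp_assoc[OF Q.Y E.Y obs(1) E.Y g s(1) h] hs Q.Y E.Y g by simp
    also have "g = cmp C Y ?LZ Z \<epsilon> (cmp C Y ?LY ?LZ ?Lg ?\<iota>)"
      using unit_natural[OF y_T[OF Q.Y] y_T[OF E.Y] yg Q.Y, of "ide C Y"] \<epsilon>(2)[OF Q.Y g] Q.Y E.Y g by simp
    finally show "cmp C Y ?LZ Z \<epsilon> (cmp C Y ?LH ?LZ ?Ln (cmp C Y Z ?LH s g)) = cmp C Y ?LZ Z \<epsilon> (cmp C Y ?LY ?LZ ?Lg ?\<iota>)" .
  qed
  then obtain \<sigma> where \<sigma>: "\<sigma> \<in> hom C Y ?LH'" "cmp C Y ?LH' ?LH ?Lk \<sigma> = cmp C Y Z ?LH s g" "cmp C Y ?LH' ?LY ?Ln' \<sigma> = ?\<iota>"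
    using pullback_lift[OF pbL Q.Y sg \<delta>(3)] by blast
  have h'\<sigma>: "cmp C Y ?LH' Y h' \<sigma> = ide C Y"
    unfolding h'_def using cmp_assoc[OF Q.Y obs(2,3) Q.Y \<sigma>(1) Ln' \<delta>(1)] \<sigma>(3) \<delta>(4) by simp
  have gh': "cmp C ?LH' Y Z g h' = cmp C ?LH' ?LH Z h ?Lk"
  proof (rule unit_cancel[OF Q.H E.Y])
    fix W m assume W: "W \<in> ob C" "m \<in> fob H' W"
    show "cmp C W ?LH' Z (cmp C ?LH' Y Z g h') (\<eta> H' W m) = cmp C W ?LH' Z (cmp C ?LH' ?LH Z h ?Lk) (\<eta> H' W m)"
      using cmp_assoc[OF W(1) obs(2) Q.Y E.Y unit_hom[OF Q.H W] h' g] h'_unit[OF W] nk[OF W]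
        cmp_assoc[OF W(1) obs(2,1) E.Y unit_hom[OF Q.H W] Lk h] unit_natural[OF Q.H E.H k(1) W]
        h_unit[OF W(1) ntD(3)[OF k(1) W]] by simp
  qed (use obs Q.Y E.Y g h h' Lk in simp_all)
  \<comment> \<open>The projections \<open>?Lk\<close> and \<open>?Ln'\<close> of the preserved
    pullback are jointly monic, so both sides are compared after each.\<close>
  have \<sigma>h': "cmp C ?LH' Y ?LH' \<sigma> h' = ide C ?LH'"
  proof (rule pullback_unique[OF pbL obs(1,3,4,2) Ln Lg cmp_hom[OF obs(2) Q.Y obs(2) h' \<sigma>(1)] ide_hom[OF obs(2)]])
    have "cmp C ?LH' ?LH' ?LH ?Lk (cmp C ?LH' Y ?LH' \<sigma> h') = cmp C ?LH' Y ?LH (cmp C Y Z ?LH s g) h'"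
      using cmp_assoc[OF obs(2) Q.Y obs(2,1) h' \<sigma>(1) Lk] \<sigma>(2) by simp
    also have "\<dots> = cmp C ?LH' Z ?LH s (cmp C ?LH' ?LH Z h ?Lk)"
      using cmp_assoc[OF obs(2) Q.Y E.Y obs(1) h' g s(1)] gh' by simp
    also have "\<dots> = ?Lk"
      using cmp_assoc[OF obs(2,1) E.Y obs(1) Lk h s(1)] sh obs Lk by simp
    finally show "cmp C ?LH' ?LH' ?LH ?Lk (cmp C ?LH' Y ?LH' \<sigma> h') = cmp C ?LH' ?LH' ?LH ?Lk (ide C ?LH')"
      using obs Lk by simp
    have "cmp C ?LH' ?LH' ?LY ?Ln' (cmp C ?LH' Y ?LH' \<sigma> h') = cmp C ?LH' Y ?LY ?\<iota> h'"
      using cmp_assoc[OF obs(2) Q.Y obs(2,3) h' \<sigma>(1) Ln'] \<sigma>(3) by simp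
    also have "\<dots> = ?Ln'"
      unfolding h'_def using cmp_assoc[OF obs(2,3) Q.Y obs(3) Ln' \<delta>(1,3)] \<delta>(5) obs Ln' by simp
    finally show "cmp C ?LH' ?LH' ?LY ?Ln' (cmp C ?LH' Y ?LH' \<sigma> h') = cmp C ?LH' ?LH' ?LY ?Ln' (ide C ?LH')"
      using obs Ln' by simp
  qed
  show ?thesis
    unfolding eff_epi_def
  proof (intro conjI ballI impI Q.X Q.Y Q.f)
    fix A a assume A: "A \<in> ob C" "a \<in> hom C P A"
      and eq: "\<forall>T\<in>ob C. \<forall>r\<in>hom C T P. \<forall>s\<in>hom C T P. cmp C T P Y q r = cmp C T P Y q s \<longrightarrow> cmp C T P A a r = cmp C T P A a s"
    obtain b where b: "b \<in> hom C ?LH' A" "cmp C P ?LH' A b Q.e = a"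
      using Q.e_descend[OF A] eq by blast
    \<comment> \<open>Transporting along \<open>\<sigma>\<close> replaces descent along
      \<open>q\<close> by descent along \<open>Q.e\<close>.\<close>
    have \<sigma>q: "cmp C P Y ?LH' \<sigma> q = Q.e"
      using cmp_assoc[OF Q.X obs(2) Q.Y obs(2) Q.e h' \<sigma>(1)] h'e \<sigma>h' Q.X obs(2) Q.e by simp
    show "\<exists>!l. l \<in> hom C Y A \<and> cmp C P Y A l q = a"
    proof (rule ex1I[of _ "cmp C Y ?LH' A b \<sigma>"])
      show "cmp C Y ?LH' A b \<sigma> \<in> hom C Y A \<and> cmp C P Y A (cmp C Y ?LH' A b \<sigma>) q = a"
        using cmp_assoc[OF Q.X Q.Y obs(2) A(1) Q.f \<sigma>(1) b(1)] \<sigma>q b Q.Y obs(2) A(1) \<sigma>(1) by simp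
      fix l assume l: "l \<in> hom C Y A \<and> cmp C P Y A l q = a"
      have lh': "cmp C ?LH' Y A l h' \<in> hom C ?LH' A" using obs(2) Q.Y A(1) h' l by simp
      have "cmp C P ?LH' A (cmp C ?LH' Y A l h') Q.e = cmp C P ?LH' A b Q.e"
        using cmp_assoc[OF Q.X obs(2) Q.Y A(1) Q.e h' conjunct1[OF l]] h'e l b(2) by simp
      then have "cmp C ?LH' Y A l h' = b" by (rule Q.e_cancel[OF A(1) lh' b(1)])
      then show "l = cmp C Y ?LH' A b \<sigma>"
        using cmp_assoc[OF Q.Y obs(2) Q.Y A(1) \<sigma>(1) h' conjunct1[OF l]] h'\<sigma> Q.Y A(1) l by simp
    qed
  qed
qed

end

context presheaves
begin

text \<open>A natural family of bijections is determined by its values at identities, which form the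
  unit; naturality expresses every transpose as composition with it.\<close>

lemma lex_reflection_of_adjunction:
  assumes T: "presheaf_subcat C \<kappa> T" and fc: "finitely_complete C" and lex: "lex_functor (PE T) C L"
    and adj: "adjunction (PE T) C L (yoneda C)"
  shows "\<exists>\<eta>. lex_reflection C \<kappa> T L \<eta>"
proof -
  interpret presheaf_subcat C \<kappa> T by (rule T)
  have fL: "is_functor (PE T) C L" using lex by (simp add: lex_functor_def)
  have L_ob: "fob L F \<in> ob C" if "F \<in> T" for F using fL that by (simp add: is_functor_def)
  have L_hom: "fmap L F G t \<in> hom C (fob L F) (fob L G)" if "F \<in> T" "G \<in> T" "t \<in> nt F G" for F G t
    using fL that by (simp add: is_functor_def)
  have L_ide: "fmap L F F (mknt F (\<lambda>Z x. x)) = ide C (fob L F)" if "F \<in> T" for F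
    using fL that by (simp add: is_functor_def)
  obtain \<theta> where bij: "\<And>F Z. \<lbrakk>F \<in> T; Z \<in> ob C\<rbrakk> \<Longrightarrow> bij_betw (\<theta> F Z) (hom C (fob L F) Z) (nt F (y Z))"
    and nat: "\<And>F F' Z Z' u v h. \<lbrakk>F \<in> T; F' \<in> T; Z \<in> ob C; Z' \<in> ob C; u \<in> nt F' F; v \<in> hom C Z Z'; h \<in> hom C (fob L F) Z\<rbrakk> \<Longrightarrow>
      \<theta> F' Z' (cmp C (fob L F') Z Z' v (cmp C (fob L F') (fob L F) Z h (fmap L F' F u))) =
      vcmp F' (yoneda_map C Z Z' v) (vcmp F' (\<theta> F Z h) u)"
    using adj unfolding adjunction_def PE_simps yoneda_def func.simps by blast
  define \<eta> where "\<eta> F = \<theta> F (fob L F) (ide C (fob L F))" for F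
  have \<eta>: "\<eta> F \<in> nt F (y (fob L F))" if "F \<in> T" for F
    unfolding \<eta>_def using bij_betw_apply[OF bij[OF that L_ob[OF that]] ide_hom[OF L_ob[OF that]]] .
  have \<eta>_hom: "\<eta> F W x \<in> hom C W (fob L F)" if "F \<in> T" "W \<in> ob C" "x \<in> fob F W" for F W x
    using ntD(3)[OF \<eta>[OF that(1)] that(2,3)] by simp
  \<comment> \<open>Naturality of \<open>\<theta>\<close> at an identity. With \<open>v\<close> an
    identity it yields naturality of the unit, with \<open>u\<close> an identity the formula
    \<open>\<theta>_apply\<close>.\<close>
  have \<theta>_eq: "\<theta> F' Z' (cmp C (fob L F') (fob L F) Z' v (fmap L F' F u)) W x = cmp C W (fob L F) Z' v (\<eta> F W (u W x))"
    if F: "F \<in> T" "F' \<in> T" and Z: "Z' \<in> ob C" and u: "u \<in> nt F' F" and v: "v \<in> hom C (fob L F) Z'"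
      and W: "W \<in> ob C" "x \<in> fob F' W" for F F' Z' u v W x
    using nat[OF F L_ob[OF F(1)] Z u v ide_hom[OF L_ob[OF F(1)]]] L_ob F L_hom[OF F(2,1) u] W
      \<eta>_hom[OF F(1) W(1) ntD(3)[OF u W]] by (simp add: \<eta>_def)
  have \<theta>_apply: "\<theta> F Z h W x = cmp C W (fob L F) Z h (\<eta> F W x)"
    if F: "F \<in> T" and Z: "Z \<in> ob C" and h: "h \<in> hom C (fob L F) Z" and W: "W \<in> ob C" "x \<in> fob F W" for F Z h W x
    using \<theta>_eq[OF F F Z ide_in[OF psh_T[OF F]] h W] L_ide[OF F] L_ob[OF F] Z h W by simp
  have "lex_reflection C \<kappa> T L \<eta>"
  proof unfold_locales
    show "finitely_complete C" by (rule fc)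
    show "lex_functor (PE T) C L" by (rule lex)
    show "\<eta> F \<in> nt F (y (fob L F))" if "F \<in> T" for F by (rule \<eta>[OF that])
    show "cmp C W (fob L F) (fob L G) (fmap L F G t) (\<eta> F W x) = \<eta> G W (t W x)"
      if F: "F \<in> T" "G \<in> T" and t: "t \<in> nt F G" and W: "W \<in> ob C" "x \<in> fob F W" for F G t W x
    proof -
      note Lt = L_hom[OF F t]
      have "\<theta> F (fob L G) (fmap L F G t) W x = \<eta> G W (t W x)"
        using \<theta>_eq[OF F(2,1) L_ob[OF F(2)] t ide_hom[OF L_ob[OF F(2)]] W] L_ob F Lt W
          \<eta>_hom[OF F(2) W(1) ntD(3)[OF t W]] by simp
      then show ?thesis using \<theta>_apply[OF F(1) L_ob[OF F(2)] Lt W] by simp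
    qed
    show "\<exists>!h. h \<in> hom C (fob L F) Z \<and> (\<forall>W\<in>ob C. \<forall>x\<in>fob F W. cmp C W (fob L F) Z h (\<eta> F W x) = t W x)"
      if F: "F \<in> T" and Z: "Z \<in> ob C" and t: "t \<in> nt F (y Z)" for F Z t
    proof -
      have in_nt: "\<theta> F Z h \<in> nt F (y Z)" if "h \<in> hom C (fob L F) Z" for h
        using bij_betw_apply[OF bij[OF F Z] that] .
      obtain h where h: "h \<in> hom C (fob L F) Z" "\<theta> F Z h = t"
        using t unfolding bij_betw_imp_surj_on[OF bij[OF F Z], symmetric] by blast
      show ?thesis
      proof (rule ex1I[of _ h])
        show "h \<in> hom C (fob L F) Z \<and> (\<forall>W\<in>ob C. \<forall>x\<in>fob F W. cmp C W (fob L F) Z h (\<eta> F W x) = t W x)"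
          using h(1) \<theta>_apply[OF F Z h(1)] h(2) by simp
        fix k assume k: "k \<in> hom C (fob L F) Z \<and> (\<forall>W\<in>ob C. \<forall>x\<in>fob F W. cmp C W (fob L F) Z k (\<eta> F W x) = t W x)"
        have "\<theta> F Z k = \<theta> F Z h"
          unfolding h(2)
          by (rule nt_eqI[OF in_nt[OF conjunct1[OF k]] t]) (use \<theta>_apply[OF F Z conjunct1[OF k]] k in simp)
        then show "k = h"
          by (rule inj_onD[OF bij_betw_imp_inj_on[OF bij[OF F Z]] _ conjunct1[OF k] h(1)])
      qed
    qed
  qed
  then show ?thesis by (rule exI[of _ \<eta>])
qed

lemma regular_if_Phi_exact:
  assumes u: "universe \<kappa>" and \<Phi>: "is_Phi_reg \<kappa> \<Phi>" and ex: "Phi_exact \<kappa> \<Phi> C"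
  shows "regular_category C"
proof -
  let ?T = "Phi_l_ob \<kappa> \<Phi> C"
  have fc: "finitely_complete C" using ex by (simp add: Phi_exact_def)
  interpret T: presheaf_subcat C \<kappa> ?T by (rule presheaf_subcat_Phi_l[OF u])
  obtain L where L: "lex_functor (PE ?T) C L" "adjunction (PE ?T) C L (yoneda C)"
    using ex unfolding Phi_exact_def Phi_l_PE by blast
  obtain \<eta> where "lex_reflection C \<kappa> ?T L \<eta>"
    using lex_reflection_of_adjunction[OF T.presheaf_subcat_axioms fc L] by blast
  then interpret R: lex_reflection C \<kappa> ?T L \<eta> .
  have image: "\<exists>H c n. reflected_image C \<kappa> ?T L \<eta> X Y f H c n"
    if X: "X \<in> ob C" and Y: "Y \<in> ob C" and f: "f \<in> hom C X Y" for X Y f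
  proof -
    obtain H c n where "H \<in> ?T" "c \<in> nt (y X) H" "n \<in> nt H (y Y)" "surj_nt (y X) H c" "inj_nt H n"
      "\<And>Z x. \<lbrakk>Z \<in> ob C; x \<in> hom C Z X\<rbrakk> \<Longrightarrow> n Z (c Z x) = cmp C Z X Y f x"
      using representable_image_in_Phi_l[OF u \<Phi> fc X Y f] by blast
    then have "reflected_image C \<kappa> ?T L \<eta> X Y f H c n"
      by unfold_locales (use X Y f in blast)+
    then show ?thesis by blast
  qed
  have "has_coequalisers_of_kernel_pairs C"
    unfolding has_coequalisers_of_kernel_pairs_def
  proof (intro ballI allI impI)
    fix X Y f R p q
    assume ob: "X \<in> ob C" "Y \<in> ob C" "f \<in> hom C X Y" and kp: "is_kernel_pair C X Y f R p q"
    obtain H c n where im: "reflected_image C \<kappa> ?T L \<eta> X Y f H c n" using image[OF ob] by blast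
    show "\<exists>Q e. is_coequaliser C R X p q Q e"
      by (intro exI, rule reflected_image.coequaliser[OF im kp])
  qed
  moreover have "regular_epis_stable C"
    unfolding regular_epis_stable_def
  proof (intro ballI allI impI)
    fix X Y Z e g P p q
    assume ob: "X \<in> ob C" "Y \<in> ob C" "Z \<in> ob C" and e: "e \<in> hom C X Z" and g: "g \<in> hom C Y Z"
      and epi: "regular_epi C X Z e" and pb: "is_pullback C X Y Z e g P p q"
    note P = is_pullbackD[OF pb]
    obtain H c n where im: "reflected_image C \<kappa> ?T L \<eta> X Z e H c n" using image[OF ob(1,3) e] by blast
    obtain H' c' n' where im': "reflected_image C \<kappa> ?T L \<eta> P Y q H' c' n'" using image[OF P(1) ob(2) P(3)] by blast
    show "regular_epi C P Y q"
      by (rule eff_epi_imp_regular_epi[OF fc R.eff_epi_pullback_stable[OF im im' regular_epi_imp_eff_epi[OF ob(1) epi] pb g]])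
  qed
  ultimately show ?thesis using fc by (simp add: regular_category_def)
qed

end

theorem mainTheorem5:
  fixes \<kappa> :: "'u rel"
    and \<Phi> :: "'u weight set"
    and C :: "('o, 'u) cat"
  assumes "universe \<kappa>"
    and "is_Phi_reg \<kappa> \<Phi>"
    and "category C"
    and "locally_small \<kappa> C"
    and "finitely_complete C"
  shows "Phi_exact \<kappa> \<Phi> C \<longleftrightarrow> regular_category C"
proof
  interpret presheaves C \<kappa> using assms(3,4) by unfold_locales
  show "regular_category C" if "Phi_exact \<kappa> \<Phi> C"
    by (rule regular_if_Phi_exact[OF assms(1,2) that])
next
  assume "regular_category C"
  then interpret regular_presheaves C \<kappa> using assms(3,4) by unfold_locales
  show "Phi_exact \<kappa> \<Phi> C" by (rule Phi_exact_if_regular[OF assms(1,2)])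
qed

end
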